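(* Let $(M^7,g,\omega^3)$ be a $7$-dimensional nearly parallel $G_2$-manifold and let $T=\frac16(d\omega^3,*\omega^3)\cdot\omega^3$ be the torsion form of its unique connection with totally skew-symmetric torsion preserving $\omega^3$. Then the triple $(M^7,g,T^*:=3\cdot T)$ is a solution of the string equations with constant dilation: $$\mathrm{Ric}^g_{ij}-\frac14\,T^*_{imn}T^*_{jmn}=0,\qquad \delta^g(T^* )=0.$$
   Context: On $\mathbb R^7$ let $\omega^3=e_{127}+e_{135}-e_{146}-e_{236}-e_{245}+e_{347}+e_{567}$, $e_{ijk}=e_i\wedge e_j\wedge e_k$. A $G_2$-structure on an oriented Riemannian $7$-manifold $(M^7,g)$ is a $3$-form $\omega^3$ having this form in suitable local oriented orthonormal frames $e_1,\dots,e_7$. It is nearly parallel if $\nabla^g_X\omega^3=-\frac\lambda4(X\lrcorner*\omega^3)$ for all $X$ and some function $\lambda$ (which is then constant); then $d\omega^3=-\lambda\,( *\omega^3)$ and $\lambda=-\frac17(d\omega^3,*\omega^3)$. Here $\nabla^g$ is the Levi-Civita connection, $*$ the Hodge star, $(\cdot,\cdot)$ the inner product on forms for which the $e_{i_1}\wedge\dots\wedge e_{i_p}$ ($i_1<\dots<i_p$) are orthonormal, $\delta^g$ the codifferential, $\mathrm{Ric}^g$ the Riemannian Ricci tensor. Indices refer to a local orthonormal frame and repeated indices $m,n$ are summed from $1$ to $7$.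
   Formalization: The printed factor 1/6 in T is false for the stated inner product: (dω,*ω) = −7λ, while the torsion form is −(λ/6)ω (e.g. round S⁷, λ = 4). The formal theorem takes T as the torsion form and proves T = (1/42)(dω,*ω)ω. *)

theory Defs
  imports "HOL-Analysis.Analysis"
begin

text \<open>
  Classical tensor calculus on smooth manifolds.  A manifold is a Hausdorff, second countable
  topological space (the type \<^typ>\<open>'m\<close>) with an atlas of charts onto open subsets of
  \<^typ>\<open>real^'n\<close>.  A tensor field is the family of its component functions with respect to the
  coordinate fields of the charts of the atlas, subject to the usual transformation law.
\<close>

section \<open>Smooth functions\<close>

primrec Ck_on :: "nat \<Rightarrow> ('a::real_normed_vector \<Rightarrow> 'b::real_normed_vector) \<Rightarrow> 'a set \<Rightarrow> bool" where
  "Ck_on 0 f S \<longleftrightarrow> continuous_on S f"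
| "Ck_on (Suc k) f S \<longleftrightarrow> (\<forall>x\<in>S. f differentiable (at x)) \<and>
     (\<forall>v. Ck_on k (\<lambda>x. frechet_derivative f (at x) v) S)"

text \<open>Only used for open \<^term>\<open>S\<close>.\<close>
definition smooth_on :: "('a::real_normed_vector \<Rightarrow> 'b::real_normed_vector) \<Rightarrow> 'a set \<Rightarrow> bool" where
  "smooth_on f S \<longleftrightarrow> (\<forall>k. Ck_on k f S)"

definition pd :: "'n::finite \<Rightarrow> (real^'n \<Rightarrow> real) \<Rightarrow> real^'n \<Rightarrow> real" where
  "pd i f x = frechet_derivative f (at x) (axis i 1)"

section \<open>Charts and atlases\<close>

text \<open>A chart consists of its domain in the manifold and its coordinate map.\<close>
type_synonym ('m, 'n) chart = "'m set \<times> ('m \<Rightarrow> real^'n)"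

definition cimg :: "('m, 'n::finite) chart \<Rightarrow> (real^'n) set" where
  "cimg c = snd c ` fst c"

definition cinv :: "('m, 'n::finite) chart \<Rightarrow> real^'n \<Rightarrow> 'm" where
  "cinv c = inv_into (fst c) (snd c)"

definition is_chart :: "('m::topological_space, 'n::finite) chart \<Rightarrow> bool" where
  "is_chart c \<longleftrightarrow> open (fst c) \<and> open (cimg c) \<and> homeomorphism (fst c) (cimg c) (snd c) (cinv c)"

definition transition :: "('m, 'n::finite) chart \<Rightarrow> ('m, 'n) chart \<Rightarrow> real^'n \<Rightarrow> real^'n" where
  "transition c c' = snd c' \<circ> cinv c"

definition overlap :: "('m, 'n::finite) chart \<Rightarrow> ('m, 'n) chart \<Rightarrow> (real^'n) set" where
  "overlap c c' = snd c ` (fst c \<inter> fst c')"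

text \<open>\<^term>\<open>jac c c' x $ a $ i\<close> is the derivative of the \<open>a\<close>-th coordinate of \<^term>\<open>c'\<close> with respect
  to the \<open>i\<close>-th coordinate of \<^term>\<open>c\<close>.\<close>
definition jac :: "('m, 'n::finite) chart \<Rightarrow> ('m, 'n) chart \<Rightarrow> real^'n \<Rightarrow> real^'n^'n" where
  "jac c c' x = matrix (frechet_derivative (transition c c') (at x))"

text \<open>The orientation is the one for which all charts of the atlas are positively oriented.\<close>
definition oriented_smooth_atlas :: "('m::topological_space, 'n::finite) chart set \<Rightarrow> bool" where
  "oriented_smooth_atlas A \<longleftrightarrow>
     (\<forall>c\<in>A. is_chart c) \<and> (\<Union>c\<in>A. fst c) = UNIV \<and>
     (\<forall>c\<in>A. \<forall>c'\<in>A. smooth_on (transition c c') (overlap c c') \<and>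
        (\<forall>x\<in>overlap c c'. det (jac c c' x) > 0))"

section \<open>Tensor fields\<close>

text \<open>\<^term>\<open>t c x i j\<close> is the component along the \<open>i\<close>-th and \<open>j\<close>-th coordinate fields of the chart
  \<^term>\<open>c\<close>, at the point with coordinates \<^term>\<open>x\<close>.\<close>
type_synonym ('m, 'n) field2 = "('m, 'n) chart \<Rightarrow> real^'n \<Rightarrow> 'n \<Rightarrow> 'n \<Rightarrow> real"
type_synonym ('m, 'n) field3 = "('m, 'n) chart \<Rightarrow> real^'n \<Rightarrow> 'n \<Rightarrow> 'n \<Rightarrow> 'n \<Rightarrow> real"
type_synonym ('m, 'n) field4 = "('m, 'n) chart \<Rightarrow> real^'n \<Rightarrow> 'n \<Rightarrow> 'n \<Rightarrow> 'n \<Rightarrow> 'n \<Rightarrow> real"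

definition eval2 :: "('n::finite \<Rightarrow> 'n \<Rightarrow> real) \<Rightarrow> real^'n \<Rightarrow> real^'n \<Rightarrow> real" where
  "eval2 t u v = (\<Sum>i\<in>UNIV. \<Sum>j\<in>UNIV. t i j * u$i * v$j)"

definition eval3 :: "('n::finite \<Rightarrow> 'n \<Rightarrow> 'n \<Rightarrow> real) \<Rightarrow> real^'n \<Rightarrow> real^'n \<Rightarrow> real^'n \<Rightarrow> real" where
  "eval3 t u v w = (\<Sum>i\<in>UNIV. \<Sum>j\<in>UNIV. \<Sum>k\<in>UNIV. t i j k * u$i * v$j * w$k)"

definition tensor_field2 :: "('m, 'n::finite) chart set \<Rightarrow> ('m, 'n) field2 \<Rightarrow> bool" where
  "tensor_field2 A t \<longleftrightarrow>
     (\<forall>c\<in>A. \<forall>i j. smooth_on (\<lambda>x. t c x i j) (cimg c)) \<and>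
     (\<forall>c\<in>A. \<forall>c'\<in>A. \<forall>x\<in>overlap c c'. \<forall>i j.
        t c x i j = eval2 (t c' (transition c c' x))
                      (column i (jac c c' x)) (column j (jac c c' x)))"

definition tensor_field3 :: "('m, 'n::finite) chart set \<Rightarrow> ('m, 'n) field3 \<Rightarrow> bool" where
  "tensor_field3 A t \<longleftrightarrow>
     (\<forall>c\<in>A. \<forall>i j k. smooth_on (\<lambda>x. t c x i j k) (cimg c)) \<and>
     (\<forall>c\<in>A. \<forall>c'\<in>A. \<forall>x\<in>overlap c c'. \<forall>i j k.
        t c x i j k = eval3 (t c' (transition c c' x))
                        (column i (jac c c' x)) (column j (jac c c' x)) (column k (jac c c' x)))"

definition totally_skew :: "('m, 'n::finite) chart set \<Rightarrow> ('m, 'n) field3 \<Rightarrow> bool" where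
  "totally_skew A t \<longleftrightarrow> (\<forall>c\<in>A. \<forall>x\<in>cimg c. \<forall>i j k.
     t c x i j k = - t c x j i k \<and> t c x i j k = - t c x i k j)"

definition three_form :: "('m, 'n::finite) chart set \<Rightarrow> ('m, 'n) field3 \<Rightarrow> bool" where
  "three_form A \<omega> \<longleftrightarrow> tensor_field3 A \<omega> \<and> totally_skew A \<omega>"

definition riemannian_metric :: "('m, 'n::finite) chart set \<Rightarrow> ('m, 'n) field2 \<Rightarrow> bool" where
  "riemannian_metric A g \<longleftrightarrow> tensor_field2 A g \<and>
     (\<forall>c\<in>A. \<forall>x\<in>cimg c. (\<forall>i j. g c x i j = g c x j i) \<and>
        (\<forall>v. v \<noteq> 0 \<longrightarrow> eval2 (g c x) v v > 0))"

text \<open>The contravariant components of the metric.\<close>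
definition ginv :: "('m, 'n::finite) field2 \<Rightarrow> ('m, 'n) field2" where
  "ginv g c x i j = matrix_inv (\<chi> a b. g c x a b) $ i $ j"

definition orthonormal_frame :: "('n::finite \<Rightarrow> 'n \<Rightarrow> real) \<Rightarrow> ('n \<Rightarrow> real^'n) \<Rightarrow> bool" where
  "orthonormal_frame h e \<longleftrightarrow> (\<forall>i j. eval2 h (e i) (e j) = (if i = j then 1 else 0))"

section \<open>Connections and curvature\<close>

text \<open>An affine connection is given by its coefficients: \<^term>\<open>N c x k i j\<close> is the \<open>k\<close>-th component of
  the covariant derivative, in the direction of the \<open>i\<close>-th coordinate field, of the \<open>j\<close>-th
  coordinate field.\<close>
definition affine_connection :: "('m, 'n::finite) chart set \<Rightarrow> ('m, 'n) field3 \<Rightarrow> bool" where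
  "affine_connection A N \<longleftrightarrow>
     (\<forall>c\<in>A. \<forall>k i j. smooth_on (\<lambda>x. N c x k i j) (cimg c)) \<and>
     (\<forall>c\<in>A. \<forall>c'\<in>A. \<forall>x\<in>overlap c c'. \<forall>i j r.
        (\<Sum>k\<in>UNIV. jac c c' x $ r $ k * N c x k i j) =
          pd i (\<lambda>y. jac c c' y $ r $ j) x +
          (\<Sum>a\<in>UNIV. \<Sum>b\<in>UNIV.
             N c' (transition c c' x) r a b * jac c c' x $ a $ i * jac c c' x $ b $ j))"

text \<open>The first index of \<open>cov2\<close> and \<open>cov3\<close> is the direction of differentiation.\<close>
definition cov2 :: "('m, 'n::finite) field3 \<Rightarrow> ('m, 'n) field2 \<Rightarrow> ('m, 'n) field3" where
  "cov2 N t c x i j k = pd i (\<lambda>y. t c y j k) x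
     - (\<Sum>m\<in>UNIV. N c x m i j * t c x m k) - (\<Sum>m\<in>UNIV. N c x m i k * t c x j m)"

definition cov3 :: "('m, 'n::finite) field3 \<Rightarrow> ('m, 'n) field3 \<Rightarrow> ('m, 'n) field4" where
  "cov3 N t c x i j k l = pd i (\<lambda>y. t c y j k l) x
     - (\<Sum>m\<in>UNIV. N c x m i j * t c x m k l) - (\<Sum>m\<in>UNIV. N c x m i k * t c x j m l)
     - (\<Sum>m\<in>UNIV. N c x m i l * t c x j k m)"

definition levi_civita ::
    "('m, 'n::finite) chart set \<Rightarrow> ('m, 'n) field2 \<Rightarrow> ('m, 'n) field3 \<Rightarrow> bool" where
  "levi_civita A g D \<longleftrightarrow> affine_connection A D \<and>
     (\<forall>c\<in>A. \<forall>x\<in>cimg c. \<forall>i j k. D c x k i j = D c x k j i \<and> cov2 D g c x i j k = 0)"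

text \<open>The torsion as a covariant tensor, \<open>T(X,Y,Z) = g(\<nabla>\<^sub>X Y - \<nabla>\<^sub>Y X - [X,Y], Z)\<close>; brackets of
  coordinate fields vanish.\<close>
definition torsion :: "('m, 'n::finite) field2 \<Rightarrow> ('m, 'n) field3 \<Rightarrow> ('m, 'n) field3" where
  "torsion g N c x i j k = (\<Sum>m\<in>UNIV. g c x m k * (N c x m i j - N c x m j i))"

definition preserves3 :: "('m, 'n::finite) chart set \<Rightarrow> ('m, 'n) field3 \<Rightarrow> ('m, 'n) field3 \<Rightarrow> bool" where
  "preserves3 A N t \<longleftrightarrow> (\<forall>c\<in>A. \<forall>x\<in>cimg c. \<forall>i j k l. cov3 N t c x i j k l = 0)"

text \<open>\<^term>\<open>curvature D c x l i j k\<close> is the \<open>l\<close>-th component of \<open>R(X,Y)Z\<close> for the \<open>i\<close>-th, \<open>j\<close>-th and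
  \<open>k\<close>-th coordinate fields \<open>X\<close>, \<open>Y\<close>, \<open>Z\<close>, where
  \<open>R(X,Y) = \<nabla>\<^sub>X \<nabla>\<^sub>Y - \<nabla>\<^sub>Y \<nabla>\<^sub>X - \<nabla>\<^bsub>[X,Y]\<^esub>\<close>; the Ricci tensor is \<open>Ric(Y,Z) = tr(X \<mapsto> R(X,Y)Z)\<close>.\<close>
definition curvature :: "('m, 'n::finite) field3 \<Rightarrow> ('m, 'n) field4" where
  "curvature D c x l i j k =
     pd i (\<lambda>y. D c y l j k) x - pd j (\<lambda>y. D c y l i k) x
     + (\<Sum>m\<in>UNIV. D c x l i m * D c x m j k) - (\<Sum>m\<in>UNIV. D c x l j m * D c x m i k)"

definition ricci :: "('m, 'n::finite) field3 \<Rightarrow> ('m, 'n) field2" where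
  "ricci D c x j k = (\<Sum>i\<in>UNIV. curvature D c x i i j k)"

section \<open>Exterior derivative, codifferential, inner product and Hodge star\<close>

definition ext_deriv3 :: "('m, 'n::finite) field3 \<Rightarrow> ('m, 'n) field4" where
  "ext_deriv3 \<alpha> c x i j k l =
     pd i (\<lambda>y. \<alpha> c y j k l) x - pd j (\<lambda>y. \<alpha> c y i k l) x
     + pd k (\<lambda>y. \<alpha> c y i j l) x - pd l (\<lambda>y. \<alpha> c y i j k) x"

text \<open>\<open>\<delta>\<alpha> = - \<Sum>\<^sub>m e\<^sub>m \<lrcorner> \<nabla>\<^bsub>e\<^sub>m\<^esub> \<alpha>\<close> for an orthonormal frame \<open>e\<close> and the Levi-Civita connection \<^term>\<open>D\<close>.\<close>
definition codiff3 :: "('m, 'n::finite) field2 \<Rightarrow> ('m, 'n) field3 \<Rightarrow> ('m, 'n) field3 \<Rightarrow> ('m, 'n) field2" where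
  "codiff3 g D \<alpha> c x j k = - (\<Sum>a\<in>UNIV. \<Sum>b\<in>UNIV. ginv g c x a b * cov3 D \<alpha> c x a b j k)"

text \<open>The inner product on 4-forms for which the \<open>e\<^sub>i \<and> e\<^sub>j \<and> e\<^sub>k \<and> e\<^sub>l\<close> (\<open>i < j < k < l\<close>) of an
  orthonormal frame are orthonormal; the factor \<open>1 / 4!\<close> accounts for summing over all indices.\<close>
definition form_inner4 ::
    "('m, 'n::finite) field2 \<Rightarrow> ('m, 'n) field4 \<Rightarrow> ('m, 'n) field4 \<Rightarrow> ('m, 'n) chart \<Rightarrow> real^'n \<Rightarrow> real" where
  "form_inner4 g \<alpha> \<beta> c x = (1 / fact 4) *
     (\<Sum>i\<in>UNIV. \<Sum>j\<in>UNIV. \<Sum>k\<in>UNIV. \<Sum>l\<in>UNIV. \<Sum>i'\<in>UNIV. \<Sum>j'\<in>UNIV. \<Sum>k'\<in>UNIV. \<Sum>l'\<in>UNIV.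
        ginv g c x i i' * ginv g c x j j' * ginv g c x k k' * ginv g c x l l' *
        \<alpha> c x i j k l * \<beta> c x i' j' k' l')"

text \<open>In the index type \<^typ>\<open>7\<close> the numerals \<open>1, \<dots>, 7\<close> denote the seven distinct indices (with
  \<open>7 = 0\<close>).  The rows of the matrix are in the order \<open>1, \<dots>, 7\<close>, so this is the permutation symbol with
  \<open>\<epsilon>(1,2,3,4,5,6,7) = 1\<close>.\<close>
definition eps7 :: "7 \<Rightarrow> 7 \<Rightarrow> 7 \<Rightarrow> 7 \<Rightarrow> 7 \<Rightarrow> 7 \<Rightarrow> 7 \<Rightarrow> real" where
  "eps7 a b c i j k l = det (vector
     [axis a 1, axis b 1, axis c 1, axis i 1, axis j 1, axis k 1, axis l 1] :: real^7^7)"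

text \<open>\<open>*(e\<^sub>1 \<and> e\<^sub>2 \<and> e\<^sub>3) = e\<^sub>4 \<and> e\<^sub>5 \<and> e\<^sub>6 \<and> e\<^sub>7\<close> for oriented orthonormal frames.\<close>
definition hodge3 :: "('m, 7) field2 \<Rightarrow> ('m, 7) field3 \<Rightarrow> ('m, 7) field4" where
  "hodge3 g \<alpha> c x i j k l = (1 / fact 3) * sqrt (det (\<chi> a b. g c x a b)) *
     (\<Sum>p\<in>UNIV. \<Sum>q\<in>UNIV. \<Sum>r\<in>UNIV. \<Sum>p'\<in>UNIV. \<Sum>q'\<in>UNIV. \<Sum>r'\<in>UNIV.
        ginv g c x p p' * ginv g c x q q' * ginv g c x r r' * \<alpha> c x p' q' r' * eps7 p q r i j k l)"

section \<open>Nearly parallel \<open>G\<^sub>2\<close>-structures and the string equations\<close>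

definition wedge3 :: "7 \<Rightarrow> 7 \<Rightarrow> 7 \<Rightarrow> real^7 \<Rightarrow> real^7 \<Rightarrow> real^7 \<Rightarrow> real" where
  "wedge3 i j k u v w = det (vector
     [vector [u$i, u$j, u$k], vector [v$i, v$j, v$k], vector [w$i, w$j, w$k]] :: real^3^3)"

definition G2_form :: "real^7 \<Rightarrow> real^7 \<Rightarrow> real^7 \<Rightarrow> real" where
  "G2_form u v w =
     wedge3 1 2 7 u v w + wedge3 1 3 5 u v w - wedge3 1 4 6 u v w - wedge3 2 3 6 u v w
     - wedge3 2 4 5 u v w + wedge3 3 4 7 u v w + wedge3 5 6 7 u v w"

text \<open>\<^term>\<open>e x a\<close> is the \<open>a\<close>-th field of a smooth local frame at the point with coordinates \<^term>\<open>x\<close>.\<close>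
definition G2_structure ::
    "('m, 7) chart set \<Rightarrow> ('m, 7) field2 \<Rightarrow> ('m, 7) field3 \<Rightarrow> bool" where
  "G2_structure A g \<omega> \<longleftrightarrow> three_form A \<omega> \<and>
     (\<forall>c\<in>A. \<forall>x0\<in>cimg c. \<exists>V e. open V \<and> x0 \<in> V \<and> V \<subseteq> cimg c \<and>
        (\<forall>a. smooth_on (\<lambda>x. e x a) V) \<and>
        (\<forall>x\<in>V. orthonormal_frame (g c x) (e x) \<and> det (\<chi> a i. e x a $ i) > 0 \<and>
           (\<forall>i j k. eval3 (\<omega> c x) (e x i) (e x j) (e x k) =
                      G2_form (axis i 1) (axis j 1) (axis k 1))))"

text \<open>\<open>\<nabla>\<^sub>X \<omega> = - (\<lambda> / 4) (X \<lrcorner> *\<omega>)\<close> for all \<open>X\<close>, with \<^term>\<open>D\<close> the Levi-Civita connection and \<open>\<lambda>\<close> an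
  arbitrary function on the manifold.\<close>
definition nearly_parallel ::
    "('m, 7) chart set \<Rightarrow> ('m, 7) field2 \<Rightarrow> ('m, 7) field3 \<Rightarrow> ('m, 7) field3 \<Rightarrow> bool" where
  "nearly_parallel A g D \<omega> \<longleftrightarrow> (\<exists>lam :: 'm \<Rightarrow> real. \<forall>c\<in>A. \<forall>x\<in>cimg c. \<forall>X :: real^7. \<forall>j k l.
     (\<Sum>i\<in>UNIV. X$i * cov3 D \<omega> c x i j k l) =
       - (lam (cinv c x) / 4) * (\<Sum>i\<in>UNIV. X$i * hodge3 g \<omega> c x i j k l))"

text \<open>
  Since \<open>\<omega>\<close> has norm \<open>\<surd>7\<close>, a nearly parallel structure has \<open>(d\<omega>, *\<omega>) = - 7 \<lambda>\<close>.  The skew torsion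
  of the connection preserving \<open>\<omega>\<close> is \<open>T = - (\<lambda> / 6) \<omega>\<close>, that is \<open>(1 / 42) (d\<omega>, *\<omega>) \<omega>\<close>.  The
  formula \<open>T = (1 / 6) (d\<omega>, *\<omega>) \<omega>\<close> is not compatible with this normalisation of the inner product
  unless \<open>\<lambda> = 0\<close>.
\<close>

text \<open>The string equations with constant dilation for a metric \<^term>\<open>g\<close> with Levi-Civita connection
  \<^term>\<open>D\<close> and a 3-form \<^term>\<open>H\<close>; the indices of the first one refer to arbitrary orthonormal
  frames.\<close>
definition string_equations ::
    "('m, 'n::finite) chart set \<Rightarrow> ('m, 'n) field2 \<Rightarrow> ('m, 'n) field3 \<Rightarrow> ('m, 'n) field3 \<Rightarrow> bool" where
  "string_equations A g D H \<longleftrightarrow> (\<forall>c\<in>A. \<forall>x\<in>cimg c.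
     (\<forall>e. orthonormal_frame (g c x) e \<longrightarrow> (\<forall>i j.
        eval2 (ricci D c x) (e i) (e j)
        - (1/4) * (\<Sum>m\<in>UNIV. \<Sum>n\<in>UNIV. eval3 (H c x) (e i) (e m) (e n) * eval3 (H c x) (e j) (e m) (e n))
        = 0)) \<and>
     (\<forall>j k. codiff3 g D H c x j k = 0))"

end

theory Submission
  imports Defs
begin

text \<open>
  In a local oriented orthonormal frame adapted to \<open>\<omega>\<close> all components of \<open>\<omega>\<close> and \<open>*\<omega>\<close> are
  constant, and a connection preserves \<open>\<omega>\<close> iff its connection form \<open>B\<close> annihilates these constants,
  i.e. takes values in the Lie algebra of \<open>G\<^sub>2\<close>.  Everything algebraic follows from the single
  contraction identity \<open>\<phi>\<^sub>i\<^sub>j\<^sub>p \<phi>\<^sub>p\<^sub>k\<^sub>l = \<delta>\<^sub>i\<^sub>k \<delta>\<^sub>j\<^sub>l - \<delta>\<^sub>i\<^sub>l \<delta>\<^sub>j\<^sub>k + \<psi>\<^sub>i\<^sub>j\<^sub>k\<^sub>l\<close>.  If \<open>\<nabla>\<omega> = \<mu> *\<omega>\<close>, the difference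
  of \<open>N\<close> and the Levi-Civita connection \<open>D\<close> is \<open>\<tau> \<omega>\<close> with \<open>\<tau> = \<mu> / 3\<close>, because a totally skew
  tensor with values in the Lie algebra of \<open>G\<^sub>2\<close> vanishes.  Hence the curvature of \<open>D\<close> is the sum of
  a form with values in this Lie algebra and of explicit terms in \<open>\<tau>\<close> and \<open>d\<tau>\<close>.  Contracting with
  \<open>\<phi>\<close> and \<open>\<psi>\<close>, which the Bianchi identity makes vanish on the left-hand side, yields \<open>d\<tau> = 0\<close> and
  \<open>Ric = 54 \<tau>\<^sup>2 g\<close>, while the torsion is \<open>2 \<tau> \<omega>\<close>.
\<close>

section \<open>The index type with seven elements\<close>

text \<open>The factor in the nearly parallel condition is an arbitrary function, yet
  \<open>d\<tau>\<close> has to be formed. Therefore \<open>\<tau>\<close> is read off from one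
  torsion component, which is differentiable because the coefficients of \<open>N\<close> are
  smooth. That the connection form of \<open>N\<close> is skew also comes from \<open>phi\<close>:
  any matrix annihilating \<open>phi\<close> is skew. Together with the skewness of the torsion this
  makes the difference of \<open>N\<close> and \<open>D\<close> totally skew, as the uniqueness
  argument requires.

  While curvature is computed, direction indices remain coordinate indices and only value indices
  refer to the frame. Coordinate derivatives commute, and brackets of frame fields never appear.

  The constant 54 is 48 + 6. The curvature contains the tensor of a space of constant curvature
  \<open>\<tau>\<^sup>2\<close>, with Ricci trace \<open>6 * \<tau>\<^sup>2\<close>; contraction
  with \<open>psi\<close> forces the trace \<open>48 * \<tau>\<^sup>2\<close> on the part with
  values in the Lie algebra. On the other side \<open>H = 6 * \<tau> * \<omega>\<close>, and
  \<open>phi\<close> contracted twice with itself gives 6, so the quadratic term has the factor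
  \<open>36 * 6 / 4 = 54\<close>.\<close>

lemma distinct_7: "distinct [1, 2, 3, 4, 5, 6, 7 :: 7]"
  by simp

lemma UNIV_7: "(UNIV :: 7 set) = {1, 2, 3, 4, 5, 6, 7}"
proof -
  have "card {1, 2, 3, 4, 5, 6, 7 :: 7} = CARD(7)"
    using distinct_card[OF distinct_7] by simp
  then show ?thesis
    by (metis card_subset_eq finite subset_UNIV)
qed

lemma forall_7: "(\<forall>i::7. P i) \<longleftrightarrow> P 1 \<and> P 2 \<and> P 3 \<and> P 4 \<and> P 5 \<and> P 6 \<and> P 7"
proof -
  have "(\<forall>i::7. P i) \<longleftrightarrow> (\<forall>i\<in>{1, 2, 3, 4, 5, 6, 7}. P i)"
    by (simp flip: UNIV_7)
  then show ?thesis by simp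
qed

lemma induct_7:
  fixes i :: 7
  assumes "P 1" "P 2" "P 3" "P 4" "P 5" "P 6" "P 7"
  shows "P i"
  using assms forall_7[of P] by blast

lemma sum_7: "sum f (UNIV :: 7 set) = f 1 + f 2 + f 3 + f 4 + f 5 + f 6 + f 7"
  unfolding UNIV_7 by (simp add: ac_simps)

lemma vector_7 [simp]:
  "(vector [a,b,c,d,e,f,g] :: 'a::zero^7) $ 1 = a"
  "(vector [a,b,c,d,e,f,g] :: 'a::zero^7) $ 2 = b"
  "(vector [a,b,c,d,e,f,g] :: 'a::zero^7) $ 3 = c"
  "(vector [a,b,c,d,e,f,g] :: 'a::zero^7) $ 4 = d"
  "(vector [a,b,c,d,e,f,g] :: 'a::zero^7) $ 5 = e"
  "(vector [a,b,c,d,e,f,g] :: 'a::zero^7) $ 6 = f"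
  "(vector [a,b,c,d,e,f,g] :: 'a::zero^7) $ 7 = g"
  unfolding vector_def by simp_all

text \<open>Adjacent transpositions generate all permutations, so these six rules carry the full
  antisymmetry of \<open>eps7\<close>.\<close>

lemma det_vector_7_swap:
  fixes a b c d e f g :: "real^7"
  shows "det (vector [b,a,c,d,e,f,g] :: real^7^7) = - det (vector [a,b,c,d,e,f,g] :: real^7^7)"
    and "det (vector [a,c,b,d,e,f,g] :: real^7^7) = - det (vector [a,b,c,d,e,f,g] :: real^7^7)"
    and "det (vector [a,b,d,c,e,f,g] :: real^7^7) = - det (vector [a,b,c,d,e,f,g] :: real^7^7)"
    and "det (vector [a,b,c,e,d,f,g] :: real^7^7) = - det (vector [a,b,c,d,e,f,g] :: real^7^7)"
    and "det (vector [a,b,c,d,f,e,g] :: real^7^7) = - det (vector [a,b,c,d,e,f,g] :: real^7^7)"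
    and "det (vector [a,b,c,d,e,g,f] :: real^7^7) = - det (vector [a,b,c,d,e,f,g] :: real^7^7)"
proof -
  have *: "det (\<chi> i. A $ Transposition.transpose p q i) = - det A"
    if "p \<noteq> q" for p q :: 7 and A :: "real^7^7"
    using det_permute_rows[OF permutes_swap_id[of p UNIV q], of A] that by (simp add: sign_swap_id)
  note simps = vec_eq_iff forall_7 transpose_def
  show "det (vector [b,a,c,d,e,f,g] :: real^7^7) = - det (vector [a,b,c,d,e,f,g] :: real^7^7)"
    by (subst *[of 1 2, symmetric], simp, rule arg_cong[of _ _ det]) (simp add: simps)
  show "det (vector [a,c,b,d,e,f,g] :: real^7^7) = - det (vector [a,b,c,d,e,f,g] :: real^7^7)"
    by (subst *[of 2 3, symmetric], simp, rule arg_cong[of _ _ det]) (simp add: simps)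
  show "det (vector [a,b,d,c,e,f,g] :: real^7^7) = - det (vector [a,b,c,d,e,f,g] :: real^7^7)"
    by (subst *[of 3 4, symmetric], simp, rule arg_cong[of _ _ det]) (simp add: simps)
  show "det (vector [a,b,c,e,d,f,g] :: real^7^7) = - det (vector [a,b,c,d,e,f,g] :: real^7^7)"
    by (subst *[of 4 5, symmetric], simp, rule arg_cong[of _ _ det]) (simp add: simps)
  show "det (vector [a,b,c,d,f,e,g] :: real^7^7) = - det (vector [a,b,c,d,e,f,g] :: real^7^7)"
    by (subst *[of 5 6, symmetric], simp, rule arg_cong[of _ _ det]) (simp add: simps)
  show "det (vector [a,b,c,d,e,g,f] :: real^7^7) = - det (vector [a,b,c,d,e,f,g] :: real^7^7)"
    by (subst *[of 6 7, symmetric], simp, rule arg_cong[of _ _ det]) (simp add: simps)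
qed

lemma eps7_swap:
  "eps7 b a c i j k l = - eps7 a b c i j k l"
  "eps7 a c b i j k l = - eps7 a b c i j k l"
  "eps7 a b i c j k l = - eps7 a b c i j k l"
  "eps7 a b c j i k l = - eps7 a b c i j k l"
  "eps7 a b c i k j l = - eps7 a b c i j k l"
  "eps7 a b c i j l k = - eps7 a b c i j k l"
  unfolding eps7_def by (rule det_vector_7_swap)+

lemma eps7_same:
  "eps7 a a c i j k l = 0" "eps7 a b b i j k l = 0" "eps7 a b c c j k l = 0"
  "eps7 a b c i i k l = 0" "eps7 a b c i j j l = 0" "eps7 a b c i j k k = 0"
  using eps7_swap(1)[of a a c i j k l] eps7_swap(2)[of a b b i j k l] eps7_swap(3)[of a b c c j k l]
    eps7_swap(4)[of a b c i i k l] eps7_swap(5)[of a b c i j j l] eps7_swap(6)[of a b c i j k k]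
  by linarith+

lemma eps7_1: "eps7 1 2 3 4 5 6 7 = 1"
proof -
  have "(vector [axis 1 1, axis 2 1, axis 3 1, axis 4 1, axis 5 1, axis 6 1, axis 7 1] :: real^7^7) = mat 1"
    by (simp add: vec_eq_iff forall_7 axis_def mat_def)
  then show ?thesis by (simp add: eps7_def)
qed

text \<open>The following rules let the simplifier sort concrete indices.\<close>

definition rank_7 :: "7 \<Rightarrow> nat" where
  "rank_7 i = (if i = 1 then 1 else if i = 2 then 2 else if i = 3 then 3 else if i = 4 then 4
     else if i = 5 then 5 else if i = 6 then 6 else 7)"

lemma rank_7_simps:
  "rank_7 1 = 1" "rank_7 2 = 2" "rank_7 3 = 3" "rank_7 4 = 4" "rank_7 5 = 5" "rank_7 6 = 6" "rank_7 7 = 7"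
  by (simp_all add: rank_7_def)

text \<open>The rank condition orients the swaps, which would loop as plain rewrite rules. With
  \<open>eps7_same\<close> and \<open>eps7_1\<close>, every symbol at concrete indices becomes 0, 1
  or -1.\<close>

lemma eps7_sort:
  "rank_7 a < rank_7 b \<Longrightarrow> eps7 b a c i j k l = - eps7 a b c i j k l"
  "rank_7 b < rank_7 c \<Longrightarrow> eps7 a c b i j k l = - eps7 a b c i j k l"
  "rank_7 c < rank_7 i \<Longrightarrow> eps7 a b i c j k l = - eps7 a b c i j k l"
  "rank_7 i < rank_7 j \<Longrightarrow> eps7 a b c j i k l = - eps7 a b c i j k l"
  "rank_7 j < rank_7 k \<Longrightarrow> eps7 a b c i k j l = - eps7 a b c i j k l"
  "rank_7 k < rank_7 l \<Longrightarrow> eps7 a b c i j l k = - eps7 a b c i j k l"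
  by (rule eps7_swap)+

section \<open>The Lie algebra of \<open>G\<^sub>2\<close>\<close>

definition phi :: "7 \<Rightarrow> 7 \<Rightarrow> 7 \<Rightarrow> real" where
  "phi i j k = G2_form (axis i 1) (axis j 1) (axis k 1)"

text \<open>These are the components of \<open>*\<omega>\<close> in an adapted oriented frame: the
  formula of \<open>hodge3\<close> for the identity metric, with \<open>1 / 6\<close> for
  \<open>1 / fact 3\<close>. The identification is \<open>hodge3_frame\<close>.\<close>

definition psi :: "7 \<Rightarrow> 7 \<Rightarrow> 7 \<Rightarrow> 7 \<Rightarrow> real" where
  "psi i j k l = (1 / 6) *
     (\<Sum>p\<in>UNIV. \<Sum>q\<in>UNIV. \<Sum>r\<in>UNIV. phi p q r * eps7 p q r i j k l)"

section \<open>Symmetries, values and contractions of phi and psi\<close>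

lemma wedge3_swap:
  "wedge3 i j k v u w = - wedge3 i j k u v w" "wedge3 i j k u w v = - wedge3 i j k u v w"
  by (simp_all add: wedge3_def det_3 algebra_simps)

lemma phi_swap: "phi j i k = - phi i j k" "phi i k j = - phi i j k"
  unfolding phi_def G2_form_def
  using wedge3_swap[of _ _ _ "axis i 1" "axis j 1" "axis k 1"] by (simp_all add: algebra_simps)

lemma phi_same [simp]: "phi i i k = 0" "phi i k k = 0" "phi i k i = 0"
  using phi_swap(1)[of i i k] phi_swap(2)[of i k k] phi_swap(1)[of i k i] phi_swap(2)[of k i i]
  by simp_all

lemma phi_sort:
  "rank_7 i < rank_7 j \<Longrightarrow> phi j i k = - phi i j k"
  "rank_7 j < rank_7 k \<Longrightarrow> phi i k j = - phi i j k"
  by (rule phi_swap)+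

lemma phi_values:
  "phi 1 2 3 = 0" "phi 1 2 4 = 0" "phi 1 2 5 = 0" "phi 1 2 6 = 0" "phi 1 2 7 = 1"
  "phi 1 3 4 = 0" "phi 1 3 5 = 1" "phi 1 3 6 = 0" "phi 1 3 7 = 0" "phi 1 4 5 = 0"
  "phi 1 4 6 = - 1" "phi 1 4 7 = 0" "phi 1 5 6 = 0" "phi 1 5 7 = 0" "phi 1 6 7 = 0"
  "phi 2 3 4 = 0" "phi 2 3 5 = 0" "phi 2 3 6 = - 1" "phi 2 3 7 = 0" "phi 2 4 5 = - 1"
  "phi 2 4 6 = 0" "phi 2 4 7 = 0" "phi 2 5 6 = 0" "phi 2 5 7 = 0" "phi 2 6 7 = 0"
  "phi 3 4 5 = 0" "phi 3 4 6 = 0" "phi 3 4 7 = 1" "phi 3 5 6 = 0" "phi 3 5 7 = 0"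
  "phi 3 6 7 = 0" "phi 4 5 6 = 0" "phi 4 5 7 = 0" "phi 4 6 7 = 0" "phi 5 6 7 = 1"
  by (simp_all add: phi_def G2_form_def wedge3_def det_3 axis_def)

text \<open>The 3 by 3 determinant has one signed term for each permutation of \<open>a\<close>,
  \<open>b\<close>, \<open>c\<close>, and skewness of \<open>f\<close> makes each of them contribute
  \<open>f a b c\<close>.\<close>

lemma sum_wedge3_skew:
  fixes f :: "7 \<Rightarrow> 7 \<Rightarrow> 7 \<Rightarrow> real"
  assumes f: "\<And>p q r. f q p r = - f p q r" "\<And>p q r. f p r q = - f p q r"
  shows "(\<Sum>p\<in>UNIV. \<Sum>q\<in>UNIV. \<Sum>r\<in>UNIV. wedge3 a b c (axis p 1) (axis q 1) (axis r 1) * f p q r)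
    = 6 * f a b c"
proof -
  have "wedge3 a b c (axis p 1) (axis q 1) (axis r 1) * f p q r =
     (if p = a then if q = b then if r = c then f p q r else 0 else 0 else 0)
   - (if p = a then if q = c then if r = b then f p q r else 0 else 0 else 0)
   + (if p = b then if q = c then if r = a then f p q r else 0 else 0 else 0)
   - (if p = b then if q = a then if r = c then f p q r else 0 else 0 else 0)
   + (if p = c then if q = a then if r = b then f p q r else 0 else 0 else 0)
   - (if p = c then if q = b then if r = a then f p q r else 0 else 0 else 0)" for p q r
    by (simp add: wedge3_def det_3 axis_def algebra_simps)
  note * = this
  have **: "(\<Sum>q\<in>UNIV. if P then h q else 0) = (if P then \<Sum>q\<in>UNIV. h q else 0)"
    for P and h :: "7 \<Rightarrow> real"
    by simp
  have "(\<Sum>p\<in>UNIV. \<Sum>q\<in>UNIV. \<Sum>r\<in>UNIV. wedge3 a b c (axis p 1) (axis q 1) (axis r 1) * f p q r)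
    = f a b c - f a c b + f b c a - f b a c + f c a b - f c b a"
    unfolding * by (simp add: sum.distrib sum_subtractf **)
  also have "\<dots> = 6 * f a b c"
    using f(1)[of a b c] f(2)[of a b c] f(1)[of c a b] f(2)[of b c a] f(1)[of a c b] f(2)[of c a b]
      f(1)[of b c a] f(2)[of b a c] by linarith
  finally show ?thesis .
qed

text \<open>Each monomial of \<open>G2_form\<close> contributes 6 times one permutation symbol,
  which cancels the factor \<open>1 / 6\<close>. A sum of 343 terms is thus replaced by seven
  symbols that the sorting rules evaluate.\<close>

lemma psi_eq_eps7:
  "psi i j k l = eps7 1 2 7 i j k l + eps7 1 3 5 i j k l - eps7 1 4 6 i j k l - eps7 2 3 6 i j k l
     - eps7 2 4 5 i j k l + eps7 3 4 7 i j k l + eps7 5 6 7 i j k l"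
proof -
  have *: "(\<Sum>p\<in>UNIV. \<Sum>q\<in>UNIV. \<Sum>r\<in>UNIV.
      wedge3 a b c (axis p 1) (axis q 1) (axis r 1) * eps7 p q r i j k l) = 6 * eps7 a b c i j k l" for a b c
    by (rule sum_wedge3_skew) (rule eps7_swap)+
  show ?thesis
    unfolding psi_def phi_def G2_form_def
    by (simp only: distrib_right left_diff_distrib sum.distrib sum_subtractf *) simp
qed

lemma psi_swap: "psi j i k l = - psi i j k l" "psi i k j l = - psi i j k l" "psi i j l k = - psi i j k l"
  unfolding psi_def
  using eps7_swap(4)[of _ _ _ j i k l] eps7_swap(5)[of _ _ _ i k j l] eps7_swap(6)[of _ _ _ i j l k]
  by (simp_all add: sum_negf)

lemma psi_same: "psi i i k l = 0" "psi i k k l = 0" "psi i k l l = 0"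
  using psi_swap(1)[of i i k l] psi_swap(2)[of i k k l] psi_swap(3)[of i k l l]
  by simp_all

lemma psi_sort:
  "rank_7 i < rank_7 j \<Longrightarrow> psi j i k l = - psi i j k l"
  "rank_7 j < rank_7 k \<Longrightarrow> psi i k j l = - psi i j k l"
  "rank_7 k < rank_7 l \<Longrightarrow> psi i j l k = - psi i j k l"
  by (rule psi_swap)+

lemma psi_values:
  "psi 1 2 3 4 = 1" "psi 1 2 3 5 = 0" "psi 1 2 3 6 = 0" "psi 1 2 3 7 = 0" "psi 1 2 4 5 = 0"
  "psi 1 2 4 6 = 0" "psi 1 2 4 7 = 0" "psi 1 2 5 6 = 1" "psi 1 2 5 7 = 0" "psi 1 2 6 7 = 0"
  "psi 1 3 4 5 = 0" "psi 1 3 4 6 = 0" "psi 1 3 4 7 = 0" "psi 1 3 5 6 = 0" "psi 1 3 5 7 = 0"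
  "psi 1 3 6 7 = 1" "psi 1 4 5 6 = 0" "psi 1 4 5 7 = 1" "psi 1 4 6 7 = 0" "psi 1 5 6 7 = 0"
  "psi 2 3 4 5 = 0" "psi 2 3 4 6 = 0" "psi 2 3 4 7 = 0" "psi 2 3 5 6 = 0" "psi 2 3 5 7 = 1"
  "psi 2 3 6 7 = 0" "psi 2 4 5 6 = 0" "psi 2 4 5 7 = 0" "psi 2 4 6 7 = - 1" "psi 2 5 6 7 = 0"
  "psi 3 4 5 6 = 1" "psi 3 4 5 7 = 0" "psi 3 4 6 7 = 0" "psi 3 5 6 7 = 0" "psi 4 5 6 7 = 0"
  unfolding psi_eq_eps7
  by (simp_all add: eps7_sort eps7_same eps7_1 rank_7_simps)

text \<open>This is the double cross product identity of the imaginary octonions, whose structure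
  constants are \<open>phi\<close>; it is checked by evaluation at all indices. The deltas are
  nested conditionals so that sums over them collapse one index at a time.\<close>

lemma phi_phi:
  "(\<Sum>p\<in>UNIV. phi i j p * phi p k l) =
     (if i = k then if j = l then 1 else 0 else 0) - (if i = l then if j = k then 1 else 0 else 0)
     + psi i j k l"
proof -
  have "\<forall>k l. (\<Sum>p\<in>UNIV. phi i j p * phi p k l) =
     (if i = k then if j = l then 1 else 0 else 0) - (if i = l then if j = k then 1 else 0 else 0)
     + psi i j k l"
    unfolding sum_7 forall_7
    by (rule induct_7[of _ i]; rule induct_7[of _ j];
        simp add: phi_sort phi_values psi_sort psi_same psi_values rank_7_simps)
  then show ?thesis by blast
qed

lemma sum_delta_if:
  fixes f :: "'a \<Rightarrow> real"
  shows "(\<Sum>q\<in>A. if P then f q else 0) = (if P then \<Sum>q\<in>A. f q else 0)"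
  by simp

lemma sum_rotate:
  fixes f :: "'a \<Rightarrow> 'b \<Rightarrow> 'c \<Rightarrow> real"
  shows "(\<Sum>x\<in>A. \<Sum>y\<in>B. \<Sum>z\<in>C. f x y z) = (\<Sum>z\<in>C. \<Sum>x\<in>A. \<Sum>y\<in>B. f x y z)"
proof -
  have "(\<Sum>x\<in>A. \<Sum>y\<in>B. \<Sum>z\<in>C. f x y z) = (\<Sum>x\<in>A. \<Sum>z\<in>C. \<Sum>y\<in>B. f x y z)"
    by (intro sum.cong refl) (rule sum.swap)
  also have "\<dots> = (\<Sum>z\<in>C. \<Sum>x\<in>A. \<Sum>y\<in>B. f x y z)"
    by (rule sum.swap)
  finally show ?thesis .
qed

text \<open>The derivation of 3-forms induced by the matrix \<open>B\<close>, applied to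
  \<open>phi\<close>. Its kernel in gl(7) is the Lie algebra of the stabiliser of
  \<open>phi\<close>.\<close>

definition inf_action :: "(7 \<Rightarrow> 7 \<Rightarrow> real) \<Rightarrow> 7 \<Rightarrow> 7 \<Rightarrow> 7 \<Rightarrow> real" where
  "inf_action B a b c = (\<Sum>d\<in>UNIV. B a d * phi d b c + B b d * phi a d c + B c d * phi a b d)"

lemma phi_cyclic: "phi j k i = phi i j k"
  using phi_swap(1)[of j i k] phi_swap(2)[of j k i] by simp

lemma psi_repeat: "psi a b c b = 0"
  using psi_swap(2)[of a b c b] psi_same(3)[of a c b] by simp

text \<open>In the contraction of \<open>phi_phi\<close> the first delta counts 7, the second
  removes 1, and \<open>psi\<close> vanishes on a repeated index.\<close>

lemma phi_phi_trace: "(\<Sum>c\<in>UNIV. \<Sum>d\<in>UNIV. phi a c d * phi b c d) = (if a = b then 6 else 0)"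
proof -
  have "(\<Sum>c\<in>UNIV. \<Sum>d\<in>UNIV. phi a c d * phi b c d) = (\<Sum>c\<in>UNIV. \<Sum>d\<in>UNIV. phi a c d * phi d b c)"
    by (simp add: phi_cyclic)
  also have "\<dots> = (\<Sum>c\<in>UNIV. (if a = b then 1 else 0) - (if c = a then if c = b then 1 else 0 else 0))"
    unfolding phi_phi
  proof (intro sum.cong refl)
    fix c
    show "(if a = b then if c = c then 1 else 0 else 0) - (if a = c then if c = b then 1 else 0 else 0) + psi a c b c =
       (if a = b then 1 else 0) - (if c = a then if c = b then 1 else 0 else 0)"
      using psi_swap(2)[of a c b c] psi_same(3)[of a b c] by auto
  qed
  also have "\<dots> = (if a = b then 6 else 0)"
    by (simp add: sum_subtractf)
  finally show ?thesis .
qed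

text \<open>Solving \<open>phi_phi\<close> for \<open>psi\<close> leaves 6 from
  \<open>phi_phi_trace\<close> and -1 from each of the two delta terms.\<close>

lemma psi_phi: "(\<Sum>b\<in>UNIV. \<Sum>c\<in>UNIV. psi a e b c * phi d b c) = 4 * phi a e d"
proof -
  have "(\<Sum>b\<in>UNIV. \<Sum>c\<in>UNIV. psi a e b c * phi d b c) =
    (\<Sum>b\<in>UNIV. \<Sum>c\<in>UNIV. (\<Sum>p\<in>UNIV. phi a e p * phi p b c) * phi d b c)
    - (\<Sum>b\<in>UNIV. \<Sum>c\<in>UNIV. if b = a then if c = e then phi d b c else 0 else 0)
    + (\<Sum>b\<in>UNIV. \<Sum>c\<in>UNIV. if c = a then if b = e then phi d b c else 0 else 0)"
    unfolding phi_phi sum.distrib[symmetric] sum_subtractf[symmetric]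
    by (intro sum.cong refl) (auto simp: algebra_simps)
  also have "(\<Sum>b\<in>UNIV. \<Sum>c\<in>UNIV. (\<Sum>p\<in>UNIV. phi a e p * phi p b c) * phi d b c) =
    (\<Sum>p\<in>UNIV. phi a e p * (\<Sum>b\<in>UNIV. \<Sum>c\<in>UNIV. phi p b c * phi d b c))"
    by (simp only: sum_distrib_left sum_distrib_right mult.assoc) (rule sum_rotate)
  also have "\<dots> = 6 * phi a e d"
    unfolding phi_phi_trace by (simp add: mult_delta_right)
  finally have "(\<Sum>b\<in>UNIV. \<Sum>c\<in>UNIV. psi a e b c * phi d b c) = 6 * phi a e d - phi d a e + phi d e a"
    by (simp add: sum_delta_if)
  then show ?thesis
    using phi_cyclic[of e d a] phi_cyclic[of d a e] phi_swap(1)[of d e a] by linarith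
qed

text \<open>One factor \<open>psi\<close> is replaced by means of \<open>phi_phi\<close>. The delta
  terms meet a repeated index of the other factor and vanish; the remaining term gives
  \<open>4 * 6\<close>.\<close>

lemma psi_psi_trace: "(\<Sum>b\<in>UNIV. \<Sum>c\<in>UNIV. \<Sum>d\<in>UNIV. psi a b c d * psi e b c d) = (if a = e then 24 else 0)"
proof -
  have "(\<Sum>b\<in>UNIV. \<Sum>c\<in>UNIV. \<Sum>d\<in>UNIV. psi a b c d * psi e b c d) =
    (\<Sum>b\<in>UNIV. \<Sum>c\<in>UNIV. \<Sum>d\<in>UNIV. psi a b c d * (\<Sum>p\<in>UNIV. phi e b p * phi p c d))
    - (\<Sum>b\<in>UNIV. \<Sum>c\<in>UNIV. \<Sum>d\<in>UNIV. if c = e then if d = b then psi a b c d else 0 else 0)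
    + (\<Sum>b\<in>UNIV. \<Sum>c\<in>UNIV. \<Sum>d\<in>UNIV. if d = e then if c = b then psi a b c d else 0 else 0)"
    unfolding phi_phi sum.distrib[symmetric] sum_subtractf[symmetric]
    by (intro sum.cong refl) (auto simp: algebra_simps)
  also have "(\<Sum>b\<in>UNIV. \<Sum>c\<in>UNIV. \<Sum>d\<in>UNIV. psi a b c d * (\<Sum>p\<in>UNIV. phi e b p * phi p c d)) =
    (\<Sum>b\<in>UNIV. \<Sum>p\<in>UNIV. phi e b p * (\<Sum>c\<in>UNIV. \<Sum>d\<in>UNIV. psi a b c d * phi p c d))"
    apply (rule sum.cong[OF refl])
    apply (simp only: sum_distrib_left sum_distrib_right)
    apply (subst sum_rotate)
    apply (simp add: mult.left_commute)
    done
  also have "\<dots> = 4 * (\<Sum>b\<in>UNIV. \<Sum>p\<in>UNIV. phi a b p * phi e b p)"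
    unfolding psi_phi by (simp add: sum_distrib_left mult_ac)
  finally show ?thesis
    by (simp add: sum_delta_if phi_phi_trace psi_same psi_repeat)
qed

text \<open>\<open>B\<close> is arbitrary, because skewness is to be a consequence. The first slot
  yields \<open>6 * B a e\<close>; each of the other two yields the trace, \<open>- B a e\<close>
  and the \<open>psi\<close> term.\<close>

lemma inf_action_phi:
  "(\<Sum>b\<in>UNIV. \<Sum>c\<in>UNIV. inf_action B a b c * phi e b c) =
     4 * B a e + (if a = e then 2 * (\<Sum>d\<in>UNIV. B d d) else 0)
     + 2 * (\<Sum>b\<in>UNIV. \<Sum>d\<in>UNIV. B b d * psi a d e b)"
proof -
  have 1: "(\<Sum>b\<in>UNIV. \<Sum>c\<in>UNIV. \<Sum>d\<in>UNIV. B a d * phi d b c * phi e b c) = 6 * B a e"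
  proof -
    have "(\<Sum>b\<in>UNIV. \<Sum>c\<in>UNIV. \<Sum>d\<in>UNIV. B a d * phi d b c * phi e b c) =
      (\<Sum>d\<in>UNIV. B a d * (\<Sum>b\<in>UNIV. \<Sum>c\<in>UNIV. phi d b c * phi e b c))"
      by (simp only: sum_distrib_left mult.assoc) (rule sum_rotate)
    also have "\<dots> = 6 * B a e"
      unfolding phi_phi_trace by (simp add: mult_delta_right)
    finally show ?thesis .
  qed
  have 2: "(\<Sum>b\<in>UNIV. \<Sum>c\<in>UNIV. \<Sum>d\<in>UNIV. B b d * phi a d c * phi e b c) =
     (if a = e then \<Sum>d\<in>UNIV. B d d else 0) - B a e + (\<Sum>b\<in>UNIV. \<Sum>d\<in>UNIV. B b d * psi a d e b)"
  proof -
    have "(\<Sum>b\<in>UNIV. \<Sum>c\<in>UNIV. \<Sum>d\<in>UNIV. B b d * phi a d c * phi e b c) =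
      (\<Sum>b\<in>UNIV. \<Sum>d\<in>UNIV. B b d * (\<Sum>c\<in>UNIV. phi a d c * phi c e b))"
      by (rule sum.cong[OF refl], subst sum.swap) (simp add: sum_distrib_left mult.assoc phi_cyclic[of e _ b for b, symmetric])
    also have "\<dots> = (\<Sum>b\<in>UNIV. \<Sum>d\<in>UNIV. if a = e then if d = b then B b d else 0 else 0)
      - (\<Sum>b\<in>UNIV. \<Sum>d\<in>UNIV. if b = a then if d = e then B b d else 0 else 0)
      + (\<Sum>b\<in>UNIV. \<Sum>d\<in>UNIV. B b d * psi a d e b)"
      unfolding phi_phi sum.distrib[symmetric] sum_subtractf[symmetric]
      by (intro sum.cong refl) (auto simp: algebra_simps)
    finally show ?thesis by (simp add: sum_delta_if)
  qed
  have 3: "(\<Sum>b\<in>UNIV. \<Sum>c\<in>UNIV. \<Sum>d\<in>UNIV. B c d * phi a b d * phi e b c) =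
    (\<Sum>b\<in>UNIV. \<Sum>c\<in>UNIV. \<Sum>d\<in>UNIV. B b d * phi a d c * phi e b c)"
  proof -
    have *: "B b d * phi a c d * phi e c b = B b d * phi a d c * phi e b c" for b c d
      using phi_swap(2)[of a c d] phi_swap(2)[of e c b] by simp
    then have "(\<Sum>c\<in>UNIV. \<Sum>b\<in>UNIV. \<Sum>d\<in>UNIV. B c d * phi a b d * phi e b c) =
      (\<Sum>b\<in>UNIV. \<Sum>c\<in>UNIV. \<Sum>d\<in>UNIV. B b d * phi a d c * phi e b c)"
      by (intro sum.cong refl *)
    then show ?thesis
      by (subst sum.swap)
  qed
  show ?thesis
    unfolding inf_action_def using 1 2 3
    by (simp add: sum_distrib_right distrib_right sum.distrib)
qed

text \<open>The stabiliser algebra consists of skew matrices and lies in the eigenspace with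
  eigenvalue -2 of contraction with \<open>psi\<close>. The matrices \<open>phi e\<close> have
  eigenvalue 4, which is why they are orthogonal to it.\<close>

lemma inf_action_eq_0:
  assumes B: "\<And>a b c. inf_action B a b c = 0"
  shows inf_action_eq_0_skew: "B e a = - B a e"
    and inf_action_eq_0_psi: "(\<Sum>b\<in>UNIV. \<Sum>d\<in>UNIV. B b d * psi a d e b) = - 2 * B a e"
    and inf_action_eq_0_phi: "(\<Sum>b\<in>UNIV. \<Sum>c\<in>UNIV. B b c * phi e b c) = 0"
proof -
  define t where "t = (\<Sum>d\<in>UNIV. B d d)"
  define S where "S a e = (\<Sum>b\<in>UNIV. \<Sum>d\<in>UNIV. B b d * psi a d e b)" for a e
  have *: "4 * B a e + (if a = e then 2 * t else 0) + 2 * S a e = 0" for a e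
    using inf_action_phi[of B a e] unfolding t_def S_def by (simp add: B)
  have S: "S e a = - S a e" for a e
  proof -
    have "psi e d a b = - psi a d e b" for b d
      using psi_swap(1)[of d e a b] psi_swap(2)[of d a e b] psi_swap(1)[of a d e b] by linarith
    then show ?thesis
      unfolding S_def by (simp add: sum_negf)
  qed
  have "B d d = - (1/2) * t" for d
    using *[of d d] S[of d d] by simp
  \<comment> \<open>Summing over seven indices gives \<open>t = - (7/2) * t\<close>, hence
    \<open>t = 0\<close>.\<close>
  then have "(\<Sum>d\<in>UNIV. B d d) = (\<Sum>d\<in>(UNIV :: 7 set). - (1/2) * t)"
    by (intro sum.cong refl)
  then have t: "t = 0" by (simp flip: t_def)
  show skew: "B e a = - B a e" for a e
    using *[of a e] *[of e a] S[of a e] t by (cases "a = e") auto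
  have S': "S a e = - 2 * B a e" for a e
    using *[of a e] t by (cases "a = e") auto
  then show "(\<Sum>b\<in>UNIV. \<Sum>d\<in>UNIV. B b d * psi a d e b) = - 2 * B a e" for a e
    unfolding S_def by simp
  \<comment> \<open>Moving the contraction with \<open>psi\<close> from \<open>B\<close> to
    \<open>phi e\<close> produces the eigenvalue 4, whereas \<open>S'\<close> produces -2; the
    pairing must vanish.\<close>
  have "(\<Sum>a\<in>UNIV. \<Sum>c\<in>UNIV. S a c * phi e a c) = 4 * (\<Sum>b\<in>UNIV. \<Sum>d\<in>UNIV. B b d * phi e b d)"
  proof -
    have "S a c * phi e a c =
      - (\<Sum>b\<in>UNIV. \<Sum>d\<in>UNIV. B b d * (psi d b a c * phi e a c))" for a c
    proof -
      have "psi a d c b = - psi d b a c" for b d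
        using psi_swap(1)[of d a c b] psi_swap(3)[of d a b c] psi_swap(2)[of d b a c] by linarith
      then show ?thesis
        by (simp add: S_def sum_distrib_right sum_negf mult.assoc)
    qed
    then have "(\<Sum>a\<in>UNIV. \<Sum>c\<in>UNIV. S a c * phi e a c) =
      - (\<Sum>a\<in>UNIV. \<Sum>c\<in>UNIV. \<Sum>b\<in>UNIV. \<Sum>d\<in>UNIV. B b d * (psi d b a c * phi e a c))"
      by (simp add: sum_negf)
    also have "(\<Sum>a\<in>UNIV. \<Sum>c\<in>UNIV. \<Sum>b\<in>UNIV. \<Sum>d\<in>UNIV. B b d * (psi d b a c * phi e a c)) =
      (\<Sum>b\<in>UNIV. \<Sum>d\<in>UNIV. \<Sum>a\<in>UNIV. \<Sum>c\<in>UNIV. B b d * (psi d b a c * phi e a c))"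
      by (subst sum_rotate, rule sum.cong[OF refl], rule sum_rotate)
    also have "\<dots> = (\<Sum>b\<in>UNIV. \<Sum>d\<in>UNIV. B b d * (4 * phi d b e))"
      by (simp add: psi_phi flip: sum_distrib_left)
    also have "\<dots> = - 4 * (\<Sum>b\<in>UNIV. \<Sum>d\<in>UNIV. B b d * phi e b d)"
    proof -
      have "phi d b e = - phi e b d" for b d
        using phi_cyclic[of b e d] phi_swap(1)[of b e d] by simp
      then show ?thesis by (simp add: sum_distrib_left mult_ac sum_negf)
    qed
    finally show ?thesis by simp
  qed
  moreover have "(\<Sum>a\<in>UNIV. \<Sum>c\<in>UNIV. S a c * phi e a c) =
      - 2 * (\<Sum>b\<in>UNIV. \<Sum>d\<in>UNIV. B b d * phi e b d)"
    unfolding S' by (simp add: sum_distrib_left mult_ac)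
  ultimately show "(\<Sum>b\<in>UNIV. \<Sum>c\<in>UNIV. B b c * phi e b c) = 0" by simp
qed

text \<open>Since \<open>C\<close> annihilates \<open>phi\<close>, the action of the product of
  \<open>B\<close> and \<open>C\<close> can be rewritten so that \<open>B\<close> and
  \<open>C\<close> act on different slots. The result is symmetric in the two matrices and cancels
  in the commutator.\<close>

lemma inf_action_commutator:
  assumes B: "\<And>a b c. inf_action B a b c = 0" and C: "\<And>a b c. inf_action C a b c = 0"
  shows "inf_action (\<lambda>a c. \<Sum>b\<in>UNIV. B a b * C b c - C a b * B b c) a b c = 0"
proof -
  have *: "inf_action (\<lambda>a c. \<Sum>b\<in>UNIV. B a b * C b c) a b c =
    - (\<Sum>m\<in>UNIV. \<Sum>d\<in>UNIV. B a m * C b d * phi m d c + C a m * B b d * phi m d c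
       + B a m * C c d * phi m b d + C a m * B c d * phi m b d
       + B b m * C c d * phi a m d + C b m * B c d * phi a m d)"
    if C: "\<And>a b c. inf_action C a b c = 0" for B C
  proof -
    have C1: "(\<Sum>d\<in>UNIV. C m d * phi d b c) = - (\<Sum>d\<in>UNIV. C b d * phi m d c + C c d * phi m b d)"
      and C2: "(\<Sum>d\<in>UNIV. C m d * phi a d c) = - (\<Sum>d\<in>UNIV. C a d * phi d m c + C c d * phi a m d)"
      and C3: "(\<Sum>d\<in>UNIV. C m d * phi a b d) = - (\<Sum>d\<in>UNIV. C a d * phi d b m + C b d * phi a d m)" for m
      using C[of m b c] C[of a m c] C[of a b m] unfolding inf_action_def sum.distrib by linarith+
    have "inf_action (\<lambda>a c. \<Sum>b\<in>UNIV. B a b * C b c) a b c =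
      (\<Sum>d\<in>UNIV. \<Sum>m\<in>UNIV. B a m * (C m d * phi d b c) + B b m * (C m d * phi a d c)
         + B c m * (C m d * phi a b d))"
      unfolding inf_action_def by (simp add: sum_distrib_right sum.distrib mult.assoc)
    also have "\<dots> = (\<Sum>m\<in>UNIV. B a m * (\<Sum>d\<in>UNIV. C m d * phi d b c)
         + B b m * (\<Sum>d\<in>UNIV. C m d * phi a d c) + B c m * (\<Sum>d\<in>UNIV. C m d * phi a b d))"
      by (subst sum.swap) (simp add: sum_distrib_left sum.distrib)
    also have "\<dots> = - ((\<Sum>m\<in>UNIV. \<Sum>d\<in>UNIV. B a m * C b d * phi m d c)
       + (\<Sum>m\<in>UNIV. \<Sum>d\<in>UNIV. B a m * C c d * phi m b d)
       + (\<Sum>m\<in>UNIV. \<Sum>d\<in>UNIV. B b m * C a d * phi d m c)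
       + (\<Sum>m\<in>UNIV. \<Sum>d\<in>UNIV. B b m * C c d * phi a m d)
       + (\<Sum>m\<in>UNIV. \<Sum>d\<in>UNIV. B c m * C a d * phi d b m)
       + (\<Sum>m\<in>UNIV. \<Sum>d\<in>UNIV. B c m * C b d * phi a d m))"
      unfolding C1 C2 C3
      by (simp add: sum_distrib_left sum.distrib sum_negf sum_subtractf algebra_simps)
    also have "(\<Sum>m\<in>UNIV. \<Sum>d\<in>UNIV. B b m * C a d * phi d m c) =
        (\<Sum>m\<in>UNIV. \<Sum>d\<in>UNIV. C a m * B b d * phi m d c)"
      by (subst sum.swap) (simp add: mult_ac)
    also have "(\<Sum>m\<in>UNIV. \<Sum>d\<in>UNIV. B c m * C a d * phi d b m) =
        (\<Sum>m\<in>UNIV. \<Sum>d\<in>UNIV. C a m * B c d * phi m b d)"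
      by (subst sum.swap) (simp add: mult_ac)
    also have "(\<Sum>m\<in>UNIV. \<Sum>d\<in>UNIV. B c m * C b d * phi a d m) =
        (\<Sum>m\<in>UNIV. \<Sum>d\<in>UNIV. C b m * B c d * phi a m d)"
      by (subst sum.swap) (simp add: mult_ac)
    finally show ?thesis by (simp add: sum.distrib)
  qed
  have "inf_action (\<lambda>a c. \<Sum>b\<in>UNIV. B a b * C b c - C a b * B b c) a b c =
     inf_action (\<lambda>a c. \<Sum>b\<in>UNIV. B a b * C b c) a b c - inf_action (\<lambda>a c. \<Sum>b\<in>UNIV. C a b * B b c) a b c"
    unfolding inf_action_def by (simp add: sum_subtractf algebra_simps sum.distrib)
  also have "\<dots> = 0"
    unfolding *[OF B] *[OF C] by (simp add: algebra_simps)
  finally show ?thesis .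
qed

section \<open>Algebraic curvature identities and their consequences for phi\<close>

lemma pair_symmetric:
  fixes R :: "'a \<Rightarrow> 'a \<Rightarrow> 'a \<Rightarrow> 'a \<Rightarrow> real"
  assumes "\<And>i j k l. R j i k l = - R i j k l" "\<And>i j k l. R i j l k = - R i j k l"
    and "\<And>i j k l. R i j k l + R j k i l + R k i j l = 0"
  shows "R i j k l = R k l i j"
proof -
  \<comment> \<open>These are the cyclic identities for the four rotations of
    \<open>(i, j, k, l)\<close>; modulo skewness, pair symmetry is a linear combination of
    them.\<close>
  have "R i j k l + R j k i l + R k i j l = 0" "R j k l i + R k l j i + R l j k i = 0"
    "R k l i j + R l i k j + R i k l j = 0" "R l i j k + R i j l k + R j l i k = 0"
    using assms(3) by blast+
  moreover have "R j k l i = - R j k i l" "R k l j i = - R k l i j" "R l j k i = R j l i k"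
    "R l i k j = - R l i j k" "R i k l j = R k i j l" "R i j l k = - R i j k l"
    using assms(1,2) by (metis minus_minus)+
  ultimately show ?thesis by linarith
qed

text \<open>Pair symmetry moves the index that stays fixed from the last place to the first.\<close>

lemma bianchi_last:
  fixes R :: "'a \<Rightarrow> 'a \<Rightarrow> 'a \<Rightarrow> 'a \<Rightarrow> real"
  assumes "\<And>i j k l. R j i k l = - R i j k l" "\<And>i j k l. R i j l k = - R i j k l"
    and "\<And>i j k l. R i j k l + R j k i l + R k i j l = 0"
  shows "R i j k l + R i k l j + R i l j k = 0"
proof -
  have "R i j k l = R k l i j" "R i k l j = R l j i k" "R i l j k = R j k i l"
    by (rule pair_symmetric[of R]; fact)+
  moreover have "R j k l i + R k l j i + R l j k i = 0"
    by fact
  ultimately show ?thesis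
    using assms(2)[of j k l i] assms(2)[of k l j i] assms(2)[of l j k i] by linarith
qed

text \<open>Reversing the order of all four indices turns a cyclic identity in the last three into
  one in the first three, so \<open>pair_symmetric\<close> applies.\<close>

lemma bianchi_first:
  fixes R :: "'a \<Rightarrow> 'a \<Rightarrow> 'a \<Rightarrow> 'a \<Rightarrow> real"
  assumes skew: "\<And>i j k l. R j i k l = - R i j k l" "\<And>i j k l. R i j l k = - R i j k l"
    and cyc: "\<And>i j k l. R i j k l + R i k l j + R i l j k = 0"
  shows "R i j k l = R k l i j"
proof -
  have "R l k j i + R l i k j + R l j i k = 0" for i j k l
    using cyc[of l k j i] by linarith
  then show ?thesis
    using pair_symmetric[of "\<lambda>i j k l. R l k j i" l k j i] skew by blast
qed

text \<open>The deltas of \<open>phi_phi\<close> cancel in the cyclic sum, and three equal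
  \<open>psi\<close> terms remain. Hence a multiple of \<open>phi p\<close> absorbs any action
  proportional to \<open>psi p\<close>.\<close>

lemma inf_action_phi_3psi: "inf_action (phi p) a b c = 3 * psi p a b c"
proof -
  have "phi a d c = phi d c a" "phi a b d = phi d a b" for d
    using phi_cyclic[of a b d] phi_cyclic[of d c a] phi_cyclic[of c a d] phi_cyclic[of d a b] by linarith+
  then have "inf_action (phi p) a b c =
    (\<Sum>d\<in>UNIV. phi p a d * phi d b c) + (\<Sum>d\<in>UNIV. phi p b d * phi d c a)
    + (\<Sum>d\<in>UNIV. phi p c d * phi d a b)"
    unfolding inf_action_def by (simp add: sum.distrib)
  also have "\<dots> = psi p a b c + psi p b c a + psi p c a b"
    unfolding phi_phi by auto
  also have "\<dots> = 3 * psi p a b c"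
    using psi_swap(2)[of p b c a] psi_swap(3)[of p b a c] psi_swap(2)[of p b a c]
      psi_swap(2)[of p c a b] psi_swap(3)[of p a c b] psi_swap(3)[of p b c a] by linarith
  finally show ?thesis .
qed

lemma inf_action_diff_scaled:
  "inf_action (\<lambda>a b. B a b - k * C a b) a b c = inf_action B a b c - k * inf_action C a b c"
  unfolding inf_action_def by (simp add: sum_subtractf sum_distrib_left algebra_simps sum.distrib)

text \<open>The product \<open>S\<close> of \<open>T\<close> and \<open>phi\<close> has the
  symmetries of a curvature tensor: skew in each pair because \<open>T\<close> and
  \<open>phi\<close> are, and cyclic because \<open>T p\<close> annihilates \<open>phi\<close>.
  Contracting its last pair with \<open>phi\<close> gives \<open>6 * T p a b\<close>; contracting
  the first pair instead gives 0 by \<open>inf_action_eq_0_phi\<close>. Pair symmetry equates the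
  two.\<close>

lemma skew_inf_action_eq_0:
  assumes skew: "\<And>p a b. T a p b = - T p a b" "\<And>p a b. T p b a = - T p a b"
    and T: "\<And>p a b c. inf_action (T p) a b c = 0"
  shows "T p a b = 0"
proof -
  define S where "S p a b c = (\<Sum>d\<in>UNIV. T p a d * phi d b c)" for p a b c
  have S1: "S a p b c = - S p a b c" for p a b c
    unfolding S_def by (simp add: skew(1)[of a p] sum_negf)
  have S2: "S p a c b = - S p a b c" for p a b c
    unfolding S_def by (simp add: phi_swap(2)[of _ b c] sum_negf)
  have S3: "S p a b c + S p b c a + S p c a b = 0" for p a b c
  proof -
    have "phi a d c = phi d c a" "phi a b d = phi d a b" for d
      using phi_cyclic[of a b d] phi_cyclic[of d c a] phi_cyclic[of c a d] phi_cyclic[of d a b] by linarith+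
    then show ?thesis
      using T[of p a b c] unfolding inf_action_def S_def by (simp add: sum.distrib)
  qed
  have "S p a b c = S b c p a" for b c
    by (rule bianchi_first) (fact S1 S2 S3)+
  then have "(\<Sum>b'\<in>UNIV. \<Sum>c\<in>UNIV. S p a b' c * phi b b' c) = (\<Sum>b'\<in>UNIV. \<Sum>c\<in>UNIV. S b' c p a * phi b b' c)"
    by simp
  moreover have "(\<Sum>b'\<in>UNIV. \<Sum>c\<in>UNIV. S p a b' c * phi b b' c) = 6 * T p a b"
  proof -
    have "(\<Sum>b'\<in>UNIV. \<Sum>c\<in>UNIV. S p a b' c * phi b b' c) =
      (\<Sum>b'\<in>UNIV. \<Sum>c\<in>UNIV. \<Sum>d\<in>UNIV. T p a d * (phi d b' c * phi b b' c))"
      unfolding S_def by (simp add: sum_distrib_right mult.assoc)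
    also have "\<dots> = (\<Sum>d\<in>UNIV. T p a d * (\<Sum>b'\<in>UNIV. \<Sum>c\<in>UNIV. phi d b' c * phi b b' c))"
      by (simp only: sum_distrib_left) (rule sum_rotate)
    also have "\<dots> = 6 * T p a b"
      unfolding phi_phi_trace by (simp add: mult_delta_right)
    finally show ?thesis .
  qed
  moreover have "(\<Sum>b'\<in>UNIV. \<Sum>c\<in>UNIV. S b' c p a * phi b b' c) = 0"
  proof -
    have "S b' c p a * phi b b' c = (\<Sum>d\<in>UNIV. phi d p a * (T d b' c * phi b b' c))" for b' c
    proof -
      have "T b' c d = T d b' c" for d
        using skew(1)[of b' d c] skew(2)[of b' d c] by linarith
      then show ?thesis
        unfolding S_def by (simp add: sum_distrib_left mult_ac)
    qed
    then have "(\<Sum>b'\<in>UNIV. \<Sum>c\<in>UNIV. S b' c p a * phi b b' c) =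
      (\<Sum>b'\<in>UNIV. \<Sum>c\<in>UNIV. \<Sum>d\<in>UNIV. phi d p a * (T d b' c * phi b b' c))"
      by simp
    also have "\<dots> = (\<Sum>d\<in>UNIV. phi d p a * (\<Sum>b'\<in>UNIV. \<Sum>c\<in>UNIV. T d b' c * phi b b' c))"
      by (simp only: sum_distrib_left) (rule sum_rotate)
    finally show ?thesis
      by (simp add: inf_action_eq_0_phi[OF T])
  qed
  ultimately show ?thesis by simp
qed

text \<open>One solution is \<open>t * phi\<close>, by \<open>inf_action_phi_3psi\<close>;
  \<open>skew_inf_action_eq_0\<close> excludes any other.\<close>

lemma skew_inf_action_psi:
  assumes "\<And>p a b. T a p b = - T p a b" "\<And>p a b. T p b a = - T p a b"
    and "\<And>p a b c. inf_action (T p) a b c = 3 * t * psi p a b c"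
  shows "T p a b = t * phi p a b"
proof -
  have "(\<lambda>p a b. T p a b - t * phi p a b) p a b = 0"
  proof (rule skew_inf_action_eq_0)
    show "T a p b - t * phi a p b = - (T p a b - t * phi p a b)" for p a b
      using assms(1)[of a p b] phi_swap(1)[of a p b] by simp
    show "T p b a - t * phi p b a = - (T p a b - t * phi p a b)" for p a b
      using assms(2)[of p b a] phi_swap(2)[of p b a] by simp
    show "inf_action (\<lambda>a b. T p a b - t * phi p a b) a b c = 0" for p a b c
      unfolding inf_action_diff_scaled inf_action_phi_3psi assms(3) by simp
  qed
  then show ?thesis by simp
qed

text \<open>Rotating the summation indices does not change the sum, so three times it contains the
  cyclic sum of \<open>r\<close>, which is 0.\<close>

lemma sum_skew_cyclic:
  fixes r f :: "'a::finite \<Rightarrow> 'a \<Rightarrow> 'a \<Rightarrow> real"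
  assumes "\<And>i j k. r i j k + r j k i + r k i j = 0" and "\<And>i j k. f j k i = f i j k"
  shows "(\<Sum>i\<in>UNIV. \<Sum>j\<in>UNIV. \<Sum>k\<in>UNIV. r i j k * f i j k) = 0"
proof -
  let ?X = "\<Sum>i\<in>UNIV. \<Sum>j\<in>UNIV. \<Sum>k\<in>UNIV. r i j k * f i j k"
  have 1: "(\<Sum>i\<in>UNIV. \<Sum>j\<in>UNIV. \<Sum>k\<in>UNIV. r j k i * f i j k) = ?X"
  proof -
    have "(\<Sum>i\<in>UNIV. \<Sum>j\<in>UNIV. \<Sum>k\<in>UNIV. r j k i * f i j k) = (\<Sum>i\<in>UNIV. \<Sum>j\<in>UNIV. \<Sum>k\<in>UNIV. r j k i * f j k i)"
      by (intro sum.cong refl) (metis assms(2))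
    also have "\<dots> = ?X"
      using sum_rotate[of "\<lambda>j k i. r j k i * f j k i" UNIV UNIV UNIV] by simp
    finally show ?thesis .
  qed
  have 2: "(\<Sum>i\<in>UNIV. \<Sum>j\<in>UNIV. \<Sum>k\<in>UNIV. r k i j * f i j k) = ?X"
  proof -
    have "(\<Sum>i\<in>UNIV. \<Sum>j\<in>UNIV. \<Sum>k\<in>UNIV. r k i j * f i j k) = (\<Sum>i\<in>UNIV. \<Sum>j\<in>UNIV. \<Sum>k\<in>UNIV. r k i j * f k i j)"
      by (intro sum.cong refl) (metis assms(2))
    also have "\<dots> = ?X"
      by (rule sum_rotate)
    finally show ?thesis .
  qed
  have "?X + ?X + ?X = (\<Sum>i\<in>UNIV. \<Sum>j\<in>UNIV. \<Sum>k\<in>UNIV. (r i j k + r j k i + r k i j) * f i j k)"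
    using 1 2 by (simp add: distrib_right sum.distrib)
  then show ?thesis by (simp add: assms(1))
qed

lemma psi_cyclic: "psi a c d b = psi a b c d"
  using psi_swap(2)[of a c b d] psi_swap(3)[of a c d b] by linarith

text \<open>In the application \<open>R\<close> is the curvature of \<open>D\<close> in the frame,
  \<open>G\<close> that of \<open>N\<close>, \<open>s\<close> is \<open>\<tau>\<close> at the point
  and \<open>t\<close> its derivative along the frame. Contraction with \<open>phi\<close> isolates
  \<open>t\<close>; contraction with \<open>psi\<close> determines the trace of
  \<open>G\<close>.\<close>

lemma curvature_algebra:
  fixes R G :: "7 \<Rightarrow> 7 \<Rightarrow> 7 \<Rightarrow> 7 \<Rightarrow> real"
  assumes R: "\<And>p q a c. R p q a c = G p q a c - (t p * phi q a c - t q * phi p a c)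
      - 2 * s\<^sup>2 * (\<Sum>m\<in>UNIV. phi p q m * phi m a c)
      + s\<^sup>2 * (\<Sum>b\<in>UNIV. phi q a b * phi p b c - phi p a b * phi q b c)"
    and G: "\<And>p q a b c. inf_action (G p q) a b c = 0"
    and skew: "\<And>p q a c. R q p a c = - R p q a c"
    and cyc: "\<And>p q a c. R p q a c + R q a p c + R a p q c = 0"
  shows "t p = 0" and "(\<Sum>p\<in>UNIV. R p q a p) = (if q = a then 54 * s\<^sup>2 else 0)"
proof -
  \<comment> \<open>By \<open>phi_phi\<close> the quadratic terms combine to the tensor of constant
    curvature \<open>s\<^sup>2\<close> and a multiple of \<open>psi\<close>.\<close>
  have R': "R p q a c = G p q a c - (t p * phi q a c - t q * phi p a c)
      - (if p = a then if q = c then s\<^sup>2 else 0 else 0)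
      + (if p = c then if q = a then s\<^sup>2 else 0 else 0) - 4 * s\<^sup>2 * psi p q a c" for p q a c
  proof -
    have *: "(\<Sum>b\<in>UNIV. phi x a b * phi y b c) = (if x = c then if a = y then 1 else 0 else 0)
      - (if x = y then if a = c then 1 else 0 else 0) + psi x a c y" for x y
      using phi_phi[of x a c y] by (simp add: phi_cyclic[of _ c y])
    have psi: "psi q a c p = - psi p q a c" "psi p a c q = psi p q a c"
      using psi_cyclic[of q a c p] psi_cyclic[of p a c q] psi_swap(1)[of q p a c] by linarith+
    show ?thesis
      unfolding R phi_phi sum_subtractf * psi by (auto simp: algebra_simps)
  qed
  note G_skew = inf_action_eq_0_skew[OF G] and G_psi = inf_action_eq_0_psi[OF G]
    and G_phi = inf_action_eq_0_phi[OF G]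
  have skew': "R p q c a = - R p q a c" for p q a c
    using G_skew[of p q c a] psi_swap(3)[of p q c a] phi_swap(2)[of p c a] phi_swap(2)[of q c a]
    unfolding R' by (auto simp: algebra_simps)
  note cyc' = bianchi_last[of R, OF skew skew' cyc]
  show t0: "t p = 0" for p
  proof -
    have "(\<Sum>q\<in>UNIV. \<Sum>a\<in>UNIV. \<Sum>c\<in>UNIV. R p q a c * phi q a c) = 0"
      by (rule sum_skew_cyclic[OF cyc' phi_cyclic])
    also have "(\<Sum>q\<in>UNIV. \<Sum>a\<in>UNIV. \<Sum>c\<in>UNIV. R p q a c * phi q a c) =
      (\<Sum>q\<in>UNIV. \<Sum>a\<in>UNIV. \<Sum>c\<in>UNIV. G p q a c * phi q a c)
      - t p * (\<Sum>q\<in>UNIV. \<Sum>a\<in>UNIV. \<Sum>c\<in>UNIV. phi q a c * phi q a c)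
      + (\<Sum>q\<in>UNIV. t q * (\<Sum>a\<in>UNIV. \<Sum>c\<in>UNIV. phi p a c * phi q a c))
      - 4 * s\<^sup>2 * (\<Sum>q\<in>UNIV. \<Sum>a\<in>UNIV. \<Sum>c\<in>UNIV. psi p q a c * phi q a c)"
      unfolding sum_distrib_left sum.distrib[symmetric] sum_subtractf[symmetric] R'
      by (intro sum.cong refl) (auto simp: algebra_simps)
    \<comment> \<open>\<open>- 7 * 6 + 6 = - 36\<close>: the trace 6 is summed over all
      \<open>q\<close> in one term and picks out \<open>q = p\<close> in the other.\<close>
    also have "\<dots> = - 36 * t p"
      unfolding G_phi phi_phi_trace psi_phi by (simp add: mult_delta_right)
    finally show ?thesis by simp
  qed
  \<comment> \<open>\<open>G_psi\<close> turns the Ricci trace of \<open>G\<close> into a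
    contraction with \<open>psi\<close>. There \<open>G\<close> is expressed through
    \<open>R\<close>, whose contraction vanishes by the Bianchi identity.\<close>
  have "- 2 * (\<Sum>p\<in>UNIV. G p q a p) = (\<Sum>p\<in>UNIV. \<Sum>b\<in>UNIV. \<Sum>d\<in>UNIV. G p q b d * psi a d p b)"
    unfolding G_psi by (simp add: sum_distrib_left)
  also have "\<dots> = - (\<Sum>p\<in>UNIV. \<Sum>b\<in>UNIV. \<Sum>d\<in>UNIV. R q p b d * psi a p b d)
      - 4 * s\<^sup>2 * (\<Sum>p\<in>UNIV. \<Sum>b\<in>UNIV. \<Sum>d\<in>UNIV. psi q p b d * psi a p b d)"
    unfolding sum_distrib_left sum_subtractf[symmetric] sum_negf[symmetric]
  proof (intro sum.cong refl)
    fix p b d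
    \<comment> \<open>The first pair is exchanged to put the fixed index \<open>q\<close> in front,
      as \<open>cyc'\<close> requires. The delta terms meet a repeated index of
      \<open>psi a\<close>.\<close>
    have G: "G p q b d = - R q p b d + (if p = b then if q = d then s\<^sup>2 else 0 else 0)
      - (if p = d then if q = b then s\<^sup>2 else 0 else 0) + 4 * s\<^sup>2 * psi p q b d"
      using R'[of p q b d] skew[of p q b d] by (simp add: t0)
    have "psi a d p b = psi a p b d"
      using psi_cyclic[of a p b d] psi_cyclic[of a b d p] by linarith
    then show "G p q b d * psi a d p b = - (R q p b d * psi a p b d) - 4 * s\<^sup>2 * (psi q p b d * psi a p b d)"
      using psi_repeat[of a b d]
      by (auto simp: G psi_swap(1)[of p q b d] psi_same algebra_simps)
  qed
  also have "\<dots> = (if q = a then - 96 * s\<^sup>2 else 0)"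
    using sum_skew_cyclic[of "R q" "psi a", OF cyc' psi_cyclic] unfolding psi_psi_trace by simp
  finally have G': "(\<Sum>p\<in>UNIV. G p q a p) = (if q = a then 48 * s\<^sup>2 else 0)"
    by (cases "q = a") auto
  have "R p q a p = G p q a p - (if p = a then if q = a then s\<^sup>2 else 0 else 0) + (if q = a then s\<^sup>2 else 0)" for p
    unfolding R' t0 using psi_cyclic[of p q a p] psi_same(1)[of p q a] by auto
  \<comment> \<open>The constant curvature part adds \<open>7 - 1 = 6\<close> to the 48 of
    \<open>G'\<close>, which is half of \<open>4 * 24\<close>.\<close>
  then show "(\<Sum>p\<in>UNIV. R p q a p) = (if q = a then 54 * s\<^sup>2 else 0)"
    by (simp add: sum.distrib sum_subtractf G')
qed

section \<open>Curvature of a connection shifted by a multiple of phi\<close>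

lemma inf_action_sum:
  fixes S :: "'b set"
  shows "inf_action (\<lambda>a b. \<Sum>i\<in>S. r i * B i a b) a b c = (\<Sum>i\<in>S. r i * inf_action (B i) a b c)"
proof -
  have *: "(\<Sum>d\<in>UNIV. \<Sum>i\<in>S. f d i) = (\<Sum>i\<in>S. \<Sum>d\<in>UNIV. f d i)" for f :: "7 \<Rightarrow> 'b \<Rightarrow> real"
    by (rule sum.swap)
  show ?thesis
    unfolding inf_action_def
    by (simp add: sum_distrib_right sum_distrib_left sum.distrib distrib_left mult.assoc *)
qed

text \<open>The derivatives of the coframe \<open>\<theta>\<close> enter through \<open>d\<theta>\<close> only, whose skew part is
  determined by \<open>A\<close> because \<open>A\<close> is torsion-free; all terms mixing \<open>B\<close> and \<open>\<phi>\<close> then cancel.\<close>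

lemma skew_torsion_curvature_algebra:
  fixes \<theta> :: "'i \<Rightarrow> 7 \<Rightarrow> real" and B :: "'i \<Rightarrow> 7 \<Rightarrow> 7 \<Rightarrow> real"
  assumes B: "\<And>i a b c. inf_action (B i) a b c = 0"
    and P: "\<And>i a b. P i a b = (\<Sum>m\<in>UNIV. \<theta> i m * phi m a b)"
    and A: "\<And>i a b. A i a b = B i a b - s * P i a b"
    and d\<theta>: "\<And>m. d\<theta> i j m - d\<theta> j i m = - (\<Sum>n\<in>UNIV. \<theta> j n * A i n m - \<theta> i n * A j n m)"
  shows "- s * (\<Sum>m\<in>UNIV. (d\<theta> i j m - d\<theta> j i m) * phi m a d)
      + (\<Sum>b\<in>UNIV. A j a b * A i b d - A i a b * A j b d) =
    (\<Sum>b\<in>UNIV. B j a b * B i b d - B i a b * B j b d)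
    - 2 * s\<^sup>2 * (\<Sum>p\<in>UNIV. \<Sum>q\<in>UNIV. \<theta> i p * \<theta> j q * (\<Sum>m\<in>UNIV. phi p q m * phi m a d))
    + s\<^sup>2 * (\<Sum>b\<in>UNIV. P j a b * P i b d - P i a b * P j b d)"
proof -
  define Z where "Z i j = (\<Sum>p\<in>UNIV. \<Sum>q\<in>UNIV. \<theta> i p * \<theta> j q * (\<Sum>m\<in>UNIV. phi p q m * phi m a d))" for i j
  define K where "K i j = (\<Sum>m\<in>UNIV. (\<Sum>n\<in>UNIV. \<theta> j n * A i n m) * phi m a d)" for i j
  define BP where "BP i j = (\<Sum>m\<in>UNIV. B i a m * P j m d)" for i j
  define PB where "PB i j = (\<Sum>m\<in>UNIV. P i a m * B j m d)" for i j
  have Z_skew: "Z j i = - Z i j" for i j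
  proof -
    have "Z j i = (\<Sum>p\<in>UNIV. \<Sum>q\<in>UNIV. \<theta> j q * \<theta> i p * (\<Sum>m\<in>UNIV. phi q p m * phi m a d))"
      unfolding Z_def by (rule sum.swap)
    also have "\<dots> = - Z i j"
      unfolding Z_def sum_negf[symmetric]
    proof (intro sum.cong refl)
      fix p q
      show "\<theta> j q * \<theta> i p * (\<Sum>m\<in>UNIV. phi q p m * phi m a d) = - (\<theta> i p * \<theta> j q * (\<Sum>m\<in>UNIV. phi p q m * phi m a d))"
        by (simp add: phi_swap(1)[of q p] sum_negf)
    qed
    finally show ?thesis .
  qed
  \<comment> \<open>Invariance of \<open>phi\<close> under \<open>B i\<close> moves
    \<open>B i\<close> from the contracted index to \<open>a\<close> and \<open>d\<close>, where the
    mixed terms of the commutator carry it.\<close>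
  have K: "K i j = - BP i j + PB j i - s * Z i j" for i j
  proof -
    have K_eq: "K i j = (\<Sum>n\<in>UNIV. \<theta> j n * (\<Sum>m\<in>UNIV. A i n m * phi m a d))"
      unfolding K_def sum_distrib_left sum_distrib_right mult.assoc by (rule sum.swap)
    have A_sum: "(\<Sum>m\<in>UNIV. A i n m * phi m a d) =
      - (\<Sum>m\<in>UNIV. B i a m * phi n m d) + (\<Sum>m\<in>UNIV. phi n a m * B i m d) - s * (\<Sum>m\<in>UNIV. P i n m * phi m a d)" for n
    proof -
      have "(\<Sum>m\<in>UNIV. phi n a m * B i m d) = - (\<Sum>m\<in>UNIV. B i d m * phi n a m)"
        unfolding sum_negf[symmetric]
        by (intro sum.cong refl) (simp add: inf_action_eq_0_skew[OF B, of i _ d])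
      then show ?thesis
        using B[of i n a d] unfolding A inf_action_def
        by (simp add: left_diff_distrib sum_subtractf sum.distrib sum_distrib_left mult.assoc)
    qed
    have "K i j = - (\<Sum>n\<in>UNIV. \<theta> j n * (\<Sum>m\<in>UNIV. B i a m * phi n m d))
      + (\<Sum>n\<in>UNIV. \<theta> j n * (\<Sum>m\<in>UNIV. phi n a m * B i m d)) - s * (\<Sum>n\<in>UNIV. \<theta> j n * (\<Sum>m\<in>UNIV. P i n m * phi m a d))"
      unfolding K_eq A_sum
      by (simp add: right_diff_distrib distrib_left sum.distrib sum_subtractf sum_negf mult.left_commute[of _ s]
          flip: sum_distrib_left[of s])
    moreover have "(\<Sum>n\<in>UNIV. \<theta> j n * (\<Sum>m\<in>UNIV. B i a m * phi n m d)) = BP i j"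
      unfolding BP_def P sum_distrib_left by (subst sum.swap) (simp add: mult_ac)
    moreover have "(\<Sum>n\<in>UNIV. \<theta> j n * (\<Sum>m\<in>UNIV. phi n a m * B i m d)) = PB j i"
      unfolding PB_def P sum_distrib_left sum_distrib_right by (subst sum.swap) (simp add: mult_ac)
    moreover have "(\<Sum>n\<in>UNIV. \<theta> j n * (\<Sum>m\<in>UNIV. P i n m * phi m a d)) = Z i j"
    proof -
      have "\<theta> j n * (\<Sum>m\<in>UNIV. P i n m * phi m a d) =
        (\<Sum>p\<in>UNIV. \<theta> i p * \<theta> j n * (\<Sum>m\<in>UNIV. phi p n m * phi m a d))" for n
        unfolding P sum_distrib_left sum_distrib_right by (subst sum.swap) (simp add: mult_ac)
      then show ?thesis
        unfolding Z_def by (subst sum.swap) simp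
    qed
    ultimately show ?thesis by simp
  qed
  have "- s * (\<Sum>m\<in>UNIV. (d\<theta> i j m - d\<theta> j i m) * phi m a d) = s * (K i j - K j i)"
    unfolding d\<theta> K_def by (simp add: sum_subtractf left_diff_distrib sum_negf right_diff_distrib)
  moreover have "(\<Sum>b\<in>UNIV. A j a b * A i b d - A i a b * A j b d) =
     (\<Sum>b\<in>UNIV. B j a b * B i b d - B i a b * B j b d) - s * (BP j i + PB j i - BP i j - PB i j)
     + s\<^sup>2 * (\<Sum>b\<in>UNIV. P j a b * P i b d - P i a b * P j b d)"
    unfolding A BP_def PB_def
    by (simp add: algebra_simps sum.distrib sum_subtractf sum_distrib_left power2_eq_square)
  \<comment> \<open>The mixed products cancel between the two sums, and \<open>Z\<close> occurs
    twice by skewness; this is the factor 2 of the result.\<close>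
  ultimately show ?thesis
    unfolding K Z_skew[of j i] Z_def[symmetric] by (simp add: algebra_simps power2_eq_square)
qed

section \<open>Partial derivatives\<close>

text \<open>Functions that agree near \<open>x\<close> have the same derivatives in the sense of
  \<open>has_derivative\<close>, so the choice made by \<open>frechet_derivative\<close> is the
  same, even where there is no derivative.\<close>

lemma pd_cong:
  fixes f h :: "real^'n \<Rightarrow> real"
  assumes "open S" "x \<in> S" "\<And>y. y \<in> S \<Longrightarrow> f y = h y"
  shows "pd i f x = pd i h x"
proof -
  have *: "(h has_derivative D) (at x)"
    if "(f has_derivative D) (at x)" "\<And>y. y \<in> S \<Longrightarrow> f y = h y" for f h :: "real^'n \<Rightarrow> real" and D
    using has_derivative_transform_within_open[OF that(1) assms(1,2) that(2)] .
  have "(f has_derivative D) (at x) \<longleftrightarrow> (h has_derivative D) (at x)" for D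
    using *[of f D h] *[of h D f] assms(3) by metis
  then show ?thesis
    unfolding pd_def frechet_derivative_def by simp
qed

lemma pd_has_derivative: "f differentiable (at x) \<Longrightarrow> (f has_derivative frechet_derivative f (at x)) (at x)"
  by (simp add: frechet_derivative_works)

lemma pd_eqI: "(f has_derivative f') (at x) \<Longrightarrow> pd i f x = f' (axis i 1)"
  unfolding pd_def using frechet_derivative_at by metis

lemma pd_const [simp]: "pd i (\<lambda>y. k) x = 0"
  by (simp add: pd_def)

lemma pd_add:
  assumes "f differentiable (at x)" "h differentiable (at x)"
  shows "pd i (\<lambda>y. f y + h y) x = pd i f x + pd i h x"
  using pd_eqI[OF has_derivative_add[OF assms[THEN pd_has_derivative]]] by (simp add: pd_def)

lemma pd_diff:
  assumes "f differentiable (at x)" "h differentiable (at x)"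
  shows "pd i (\<lambda>y. f y - h y) x = pd i f x - pd i h x"
  using pd_eqI[OF has_derivative_diff[OF assms[THEN pd_has_derivative]]] by (simp add: pd_def)

lemma pd_mult:
  assumes "f differentiable (at x)" "h differentiable (at x)"
  shows "pd i (\<lambda>y. f y * h y) x = pd i f x * h x + f x * pd i h x"
  using pd_eqI[OF has_derivative_mult[OF assms[THEN pd_has_derivative]]] by (simp add: pd_def)

lemma pd_sum:
  assumes "\<And>k. k \<in> I \<Longrightarrow> f k differentiable (at x)"
  shows "pd i (\<lambda>y. \<Sum>k\<in>I. f k y) x = (\<Sum>k\<in>I. pd i (f k) x)"
  using pd_eqI[OF has_derivative_sum[where f = f, OF assms[THEN pd_has_derivative]]] by (simp add: pd_def)

lemma differentiable_sum_fun:
  assumes "\<And>k. k \<in> I \<Longrightarrow> f k differentiable (at x)"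
  shows "(\<lambda>y. \<Sum>k\<in>I. f k y) differentiable (at x)"
  using has_derivative_sum[where f = f, OF assms[THEN pd_has_derivative]] unfolding differentiable_def by blast

section \<open>Consequences of smoothness\<close>

lemma Ck_on_cong:
  assumes "open S" "\<And>x. x \<in> S \<Longrightarrow> f x = h x" "Ck_on k f S"
  shows "Ck_on k h S"
  using assms(2,3)
proof (induction k arbitrary: f h)
  case 0
  then show ?case using continuous_on_cong[of S S f h] by simp
next
  case (Suc k)
  have diff: "h differentiable (at x)" and eq: "frechet_derivative f (at x) = frechet_derivative h (at x)" if "x \<in> S" for x
  proof -
    have f: "(f has_derivative frechet_derivative f (at x)) (at x)"
      using Suc.prems(2) that by (simp add: frechet_derivative_works)
    then have "(h has_derivative frechet_derivative f (at x)) (at x)"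
      using has_derivative_transform_within_open[OF f \<open>open S\<close> that] Suc.prems(1) by blast
    then show "h differentiable (at x)" "frechet_derivative f (at x) = frechet_derivative h (at x)"
      by (auto simp: differentiable_def intro: frechet_derivative_at)
  qed
  show ?case
    using Suc.prems(2) diff Suc.IH[of "\<lambda>x. frechet_derivative f (at x) v" "\<lambda>x. frechet_derivative h (at x) v" for v] eq
    by auto
qed

lemma smooth_on_subset:
  assumes "smooth_on f S" "T \<subseteq> S"
  shows "smooth_on f T"
proof -
  have "Ck_on k f S \<Longrightarrow> Ck_on k f T" for k
    using assms(2) by (induction k arbitrary: f) (auto intro: continuous_on_subset)
  with assms(1) show ?thesis by (auto simp: smooth_on_def)
qed

lemma smooth_on_component:
  fixes f :: "'a::real_normed_vector \<Rightarrow> real^'n"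
  assumes "open S" "smooth_on f S"
  shows "smooth_on (\<lambda>x. f x $ k) S"
proof -
  have "Ck_on n f S \<Longrightarrow> Ck_on n (\<lambda>x. f x $ k) S" for n
  proof (induction n arbitrary: f)
    case 0
    then show ?case by (simp add: continuous_on_component)
  next
    case (Suc n)
    have *: "((\<lambda>x. f x $ k) has_derivative (\<lambda>v. frechet_derivative f (at x) v $ k)) (at x)" if "x \<in> S" for x
      using Suc.prems that by (intro bounded_linear.has_derivative[OF bounded_linear_vec_nth])
        (simp add: frechet_derivative_works)
    have "Ck_on n (\<lambda>x. frechet_derivative (\<lambda>x. f x $ k) (at x) v) S" for v
      by (rule Ck_on_cong[OF \<open>open S\<close> _ Suc.IH[of "\<lambda>x. frechet_derivative f (at x) v"]])
        (use Suc.prems frechet_derivative_at[OF *] in \<open>auto dest: fun_cong\<close>)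
    with * show ?case by (auto simp: differentiable_def)
  qed
  with assms(2) show ?thesis by (auto simp: smooth_on_def)
qed

lemma smooth_on_differentiable: "smooth_on f S \<Longrightarrow> x \<in> S \<Longrightarrow> f differentiable (at x)"
  unfolding smooth_on_def by (metis Ck_on.simps(2))

lemma smooth_on_pd:
  assumes "smooth_on f S" shows "smooth_on (pd i f) S"
  using assms unfolding smooth_on_def pd_def by (metis Ck_on.simps(2))

lemma smooth_on_continuous_on: "smooth_on f S \<Longrightarrow> continuous_on S f"
  unfolding smooth_on_def by (metis Ck_on.simps(1))

section \<open>Symmetry of second partial derivatives\<close>

lemma has_real_derivative_pd:
  assumes "f differentiable (at (x + t *\<^sub>R axis i 1))"
  shows "((\<lambda>s. f (x + s *\<^sub>R axis i 1)) has_real_derivative pd i f (x + t *\<^sub>R axis i 1)) (at t)"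
proof -
  let ?y = "x + t *\<^sub>R axis i 1"
  have f: "(f has_derivative frechet_derivative f (at ?y)) (at ?y)"
    using assms by (simp add: frechet_derivative_works)
  have "((\<lambda>s. x + s *\<^sub>R axis i 1) has_derivative (\<lambda>s. s *\<^sub>R axis i 1)) (at t)"
    by (auto intro!: derivative_eq_intros)
  from has_derivative_compose[OF this f]
  have "((\<lambda>s. f (x + s *\<^sub>R axis i 1)) has_derivative (\<lambda>s. frechet_derivative f (at ?y) (s *\<^sub>R axis i 1))) (at t)" .
  moreover have "frechet_derivative f (at ?y) (s *\<^sub>R axis i 1) = pd i f ?y * s" for s
    unfolding pd_def using linear_frechet_derivative[OF assms] by (simp add: linear_scale)
  ultimately show ?thesis
    by (simp add: has_field_derivative_def)
qed

text \<open>The mean value theorem is applied along \<open>i\<close> to the difference over two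
  parallel edges of a square, then along \<open>j\<close>. The second difference itself is symmetric
  in \<open>i\<close> and \<open>j\<close>, which forces the mixed derivatives to agree.\<close>

lemma second_difference:
  fixes f :: "real^'n \<Rightarrow> real"
  assumes "smooth_on f S" and "t > 0"
    and box: "\<And>a b. \<lbrakk>0 \<le> a; a \<le> t; 0 \<le> b; b \<le> t\<rbrakk> \<Longrightarrow> x + a *\<^sub>R axis i 1 + b *\<^sub>R axis j 1 \<in> S"
  obtains a b where "0 < a" "a < t" "0 < b" "b < t"
    and "f (x + t *\<^sub>R axis i 1 + t *\<^sub>R axis j 1) - f (x + t *\<^sub>R axis i 1) - f (x + t *\<^sub>R axis j 1) + f x
       = t * t * pd j (pd i f) (x + a *\<^sub>R axis i 1 + b *\<^sub>R axis j 1)"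
proof -
  let ?p = "\<lambda>a b. x + a *\<^sub>R axis i 1 + b *\<^sub>R axis j 1"
  have d1: "((\<lambda>s. f (?p s b)) has_real_derivative pd i f (?p a b)) (at a)"
    if "0 \<le> a" "a \<le> t" "0 \<le> b" "b \<le> t" for a b
    using has_real_derivative_pd[of f "x + b *\<^sub>R axis j 1" a i]
      smooth_on_differentiable[OF assms(1) box[OF that]] by (simp add: add_ac)
  have d2: "((\<lambda>s. pd i f (?p a s)) has_real_derivative pd j (pd i f) (?p a b)) (at b)"
    if "0 \<le> a" "a \<le> t" "0 \<le> b" "b \<le> t" for a b
    using has_real_derivative_pd[of "pd i f" "x + a *\<^sub>R axis i 1" b j]
      smooth_on_differentiable[OF smooth_on_pd[OF assms(1)] box[OF that]] by simp
  have "((\<lambda>s. f (?p s t) - f (?p s 0)) has_real_derivative pd i f (?p a t) - pd i f (?p a 0)) (at a)"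
    if "0 \<le> a" "a \<le> t" for a
    using that \<open>t > 0\<close> by (intro DERIV_diff d1) auto
  from MVT2[OF \<open>t > 0\<close> this] obtain a where a: "0 < a" "a < t"
    "(f (?p t t) - f (?p t 0)) - (f (?p 0 t) - f (?p 0 0)) = t * (pd i f (?p a t) - pd i f (?p a 0))"
    by auto
  have "((\<lambda>s. pd i f (?p a s)) has_real_derivative pd j (pd i f) (?p a b)) (at b)"
    if "0 \<le> b" "b \<le> t" for b
    using a that by (intro d2) auto
  from MVT2[OF \<open>t > 0\<close> this] obtain b where "0 < b" "b < t"
    "pd i f (?p a t) - pd i f (?p a 0) = t * pd j (pd i f) (?p a b)"
    by auto
  with a show ?thesis by (intro that[of a b]) (auto simp: algebra_simps)
qed

lemma pd_pd_commute:
  fixes f :: "real^'n \<Rightarrow> real"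
  assumes "open S" "smooth_on f S" "x \<in> S"
  shows "pd i (pd j f) x = pd j (pd i f) x"
proof (rule ccontr)
  assume neq: "pd i (pd j f) x \<noteq> pd j (pd i f) x"
  \<comment> \<open>Half the gap: two equal values, each closer than \<open>\<epsilon>\<close> to
    one of the mixed derivatives at \<open>x\<close>, contradict it.\<close>
  define \<epsilon> where "\<epsilon> = \<bar>pd i (pd j f) x - pd j (pd i f) x\<bar> / 2"
  have "\<epsilon> > 0" using neq by (simp add: \<epsilon>_def)
  have "\<exists>d>0. \<forall>y. dist y x < d \<longrightarrow> y \<in> S \<and> \<bar>pd k (pd l f) y - pd k (pd l f) x\<bar> < \<epsilon>" for k l
  proof -
    have "continuous_on S (pd k (pd l f))"
      by (intro smooth_on_continuous_on smooth_on_pd assms)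
    then have "isCont (pd k (pd l f)) x"
      using assms continuous_on_eq_continuous_at by blast
    then obtain d where "d > 0" "\<forall>y. dist y x < d \<longrightarrow> \<bar>pd k (pd l f) y - pd k (pd l f) x\<bar> < \<epsilon>"
      using \<open>\<epsilon> > 0\<close> unfolding continuous_at_eps_delta by (metis dist_real_def)
    moreover obtain d' where "d' > 0" "\<forall>y. dist y x < d' \<longrightarrow> y \<in> S"
      using assms(1,3) unfolding open_dist by blast
    ultimately show ?thesis by (intro exI[of _ "min d d'"]) auto
  qed
  from this[of i j] this[of j i] obtain d1 d2 where "d1 > 0" "d2 > 0"
    and d1: "\<And>y. dist y x < d1 \<Longrightarrow> y \<in> S \<and> \<bar>pd i (pd j f) y - pd i (pd j f) x\<bar> < \<epsilon>"
    and d2: "\<And>y. dist y x < d2 \<Longrightarrow> y \<in> S \<and> \<bar>pd j (pd i f) y - pd j (pd i f) x\<bar> < \<epsilon>"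
    by blast
  \<comment> \<open>Points of the square with side \<open>t\<close> have distance at most
    \<open>2 * t\<close> from \<open>x\<close>, below both radii.\<close>
  define t where "t = min d1 d2 / 3"
  have "t > 0" using \<open>d1 > 0\<close> \<open>d2 > 0\<close> by (simp add: t_def)
  have close: "dist (x + a *\<^sub>R axis k 1 + b *\<^sub>R axis l 1) x < d1" "dist (x + a *\<^sub>R axis k 1 + b *\<^sub>R axis l 1) x < d2"
    if "0 \<le> a" "a \<le> t" "0 \<le> b" "b \<le> t" for a b and k l :: 'n
  proof -
    have "norm (a *\<^sub>R axis k 1 + b *\<^sub>R axis l 1 :: real^'n) \<le> a + b"
      using norm_triangle_ineq[of "a *\<^sub>R axis k 1 :: real^'n" "b *\<^sub>R axis l 1"] that by simp
    then have "dist (x + a *\<^sub>R axis k 1 + b *\<^sub>R axis l 1) x \<le> 2 * t"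
      using that by (simp add: dist_norm add.assoc)
    then show "dist (x + a *\<^sub>R axis k 1 + b *\<^sub>R axis l 1) x < d1" "dist (x + a *\<^sub>R axis k 1 + b *\<^sub>R axis l 1) x < d2"
      using \<open>d1 > 0\<close> \<open>d2 > 0\<close> by (auto simp: t_def min_def split: if_splits)
  qed
  have box: "x + a *\<^sub>R axis k 1 + b *\<^sub>R axis l 1 \<in> S"
    if "0 \<le> a" "a \<le> t" "0 \<le> b" "b \<le> t" for a b and k l :: 'n
    using d1 close(1)[OF that] by blast
  obtain a b where ab: "0 < a" "a < t" "0 < b" "b < t"
    "f (x + t *\<^sub>R axis i 1 + t *\<^sub>R axis j 1) - f (x + t *\<^sub>R axis i 1) - f (x + t *\<^sub>R axis j 1) + f x
       = t * t * pd j (pd i f) (x + a *\<^sub>R axis i 1 + b *\<^sub>R axis j 1)"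
    using second_difference[OF assms(2) \<open>t > 0\<close> box] .
  obtain a' b' where ab': "0 < a'" "a' < t" "0 < b'" "b' < t"
    "f (x + t *\<^sub>R axis j 1 + t *\<^sub>R axis i 1) - f (x + t *\<^sub>R axis j 1) - f (x + t *\<^sub>R axis i 1) + f x
       = t * t * pd i (pd j f) (x + a' *\<^sub>R axis j 1 + b' *\<^sub>R axis i 1)"
    using second_difference[OF assms(2) \<open>t > 0\<close> box] .
  have "t * t * pd j (pd i f) (x + a *\<^sub>R axis i 1 + b *\<^sub>R axis j 1) =
     t * t * pd i (pd j f) (x + a' *\<^sub>R axis j 1 + b' *\<^sub>R axis i 1)"
  proof -
    have "f (x + t *\<^sub>R axis i 1 + t *\<^sub>R axis j 1) = f (x + t *\<^sub>R axis j 1 + t *\<^sub>R axis i 1)"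
      by (rule arg_cong[of _ _ f]) simp
    then show ?thesis using ab(5) ab'(5) by linarith
  qed
  then have "pd j (pd i f) (x + a *\<^sub>R axis i 1 + b *\<^sub>R axis j 1) =
      pd i (pd j f) (x + a' *\<^sub>R axis j 1 + b' *\<^sub>R axis i 1)"
    using \<open>t > 0\<close> by simp
  moreover have "\<bar>pd j (pd i f) (x + a *\<^sub>R axis i 1 + b *\<^sub>R axis j 1) - pd j (pd i f) x\<bar> < \<epsilon>"
    using d2 close(2)[of a b i j] ab by auto
  moreover have "\<bar>pd i (pd j f) (x + a' *\<^sub>R axis j 1 + b' *\<^sub>R axis i 1) - pd i (pd j f) x\<bar> < \<epsilon>"
    using d1 close(1)[of a' b' j i] ab' by auto
  ultimately show False
    unfolding \<epsilon>_def by (auto simp: abs_if field_simps split: if_splits)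
qed

section \<open>Tensors in an orthonormal frame\<close>

text \<open>The index of \<open>e a\<close> is lowered with \<open>h\<close>; for an orthonormal
  frame this is the dual coframe, obtained without inverting a matrix.\<close>

definition coframe :: "('n::finite \<Rightarrow> 'n \<Rightarrow> real) \<Rightarrow> ('n \<Rightarrow> real^'n) \<Rightarrow> 'n \<Rightarrow> 'n \<Rightarrow> real" where
  "coframe h e i a = (\<Sum>j\<in>UNIV. h i j * e a $ j)"

lemma frame_coframe:
  assumes "orthonormal_frame h e"
  shows "(\<Sum>i\<in>UNIV. e a $ i * coframe h e i b) = (if a = b then 1 else 0)"
  using assms unfolding orthonormal_frame_def eval2_def coframe_def
  by (simp add: sum_distrib_left mult_ac)

text \<open>The matrices are square, so the one-sided inverse from \<open>frame_coframe\<close> is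
  two-sided.\<close>

lemma coframe_frame:
  assumes "orthonormal_frame h e"
  shows "(\<Sum>a\<in>UNIV. coframe h e i a * e a $ j) = (if i = j then 1 else 0)"
proof -
  have "(\<chi> a i. e a $ i) ** (\<chi> i b. coframe h e i b) = mat 1"
    by (simp add: matrix_matrix_mult_def mat_def vec_eq_iff frame_coframe[OF assms])
  then have "(\<chi> i b. coframe h e i b) ** (\<chi> a i. e a $ i) = mat 1"
    by (simp add: matrix_left_right_inverse)
  then show ?thesis
    by (simp add: matrix_matrix_mult_def mat_def vec_eq_iff)
qed

lemma ginv_frame:
  assumes "orthonormal_frame (g c x) e"
  shows "ginv g c x i j = (\<Sum>a\<in>UNIV. e a $ i * e a $ j)"
proof -
  let ?H = "\<chi> a b. g c x a b" and ?P = "\<chi> i j. \<Sum>a\<in>UNIV. e a $ i * e a $ j"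
  have "(\<Sum>j\<in>UNIV. g c x i j * (\<Sum>a\<in>UNIV. e a $ j * e a $ k)) = (if i = k then 1 else 0)" for i k
  proof -
    have "(\<Sum>j\<in>UNIV. g c x i j * (\<Sum>a\<in>UNIV. e a $ j * e a $ k)) = (\<Sum>a\<in>UNIV. coframe (g c x) e i a * e a $ k)"
      unfolding coframe_def sum_distrib_left sum_distrib_right mult.assoc by (rule sum.swap)
    then show ?thesis by (simp add: coframe_frame[OF assms])
  qed
  then have HP: "?H ** ?P = mat 1"
    by (simp add: matrix_matrix_mult_def mat_def vec_eq_iff)
  then have PH: "?P ** ?H = mat 1"
    by (simp add: matrix_left_right_inverse)
  then have "\<exists>Q. ?H ** Q = mat 1 \<and> Q ** ?H = mat 1"
    using HP by blast
  then have "?H ** matrix_inv ?H = mat 1"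
    unfolding matrix_inv_def by (rule someI2_ex) simp
  then have "matrix_inv ?H = ?P"
    using matrix_mul_assoc[of ?P ?H "matrix_inv ?H"] unfolding PH by simp
  then show ?thesis unfolding ginv_def by simp
qed

text \<open>With \<open>E\<close> the frame and \<open>H\<close> the metric, \<open>E H E^T\<close>
  is the identity matrix. The positive determinant selects the root, so orientation fixes the sign
  of the Hodge star here.\<close>

lemma sqrt_det_metric_frame:
  assumes "orthonormal_frame h e" "det (\<chi> a i. e a $ i) > 0"
  shows "sqrt (det (\<chi> a b. h a b)) * det (\<chi> a i. e a $ i) = 1"
proof -
  let ?H = "\<chi> a b. h a b" and ?E = "\<chi> a i. e a $ i"
  have "?H ** transpose ?E = (\<chi> i b. coframe h e i b)"
    by (simp add: matrix_matrix_mult_def transpose_def coframe_def vec_eq_iff)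
  then have "?E ** (?H ** transpose ?E) = mat 1"
    by (simp add: matrix_matrix_mult_def mat_def vec_eq_iff frame_coframe[OF assms(1)])
  then have "det ?E * (det ?H * det ?E) = 1"
    by (metis det_I det_mul det_transpose)
  then have "det ?H * (det ?E)\<^sup>2 = 1"
    by (simp add: power2_eq_square mult_ac)
  then have "sqrt (det ?H * (det ?E)\<^sup>2) = 1"
    by simp
  then show ?thesis
    using assms(2) by (simp add: real_sqrt_mult)
qed

definition eval4 :: "('n::finite \<Rightarrow> 'n \<Rightarrow> 'n \<Rightarrow> 'n \<Rightarrow> real) \<Rightarrow> real^'n \<Rightarrow> real^'n \<Rightarrow> real^'n \<Rightarrow> real^'n \<Rightarrow> real" where
  "eval4 t u v w z = (\<Sum>i\<in>UNIV. \<Sum>j\<in>UNIV. \<Sum>k\<in>UNIV. \<Sum>l\<in>UNIV. t i j k l * u$i * v$j * w$k * z$l)"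

lemma eval4_sum: "eval4 (\<lambda>i j k l. \<Sum>s\<in>S. t s i j k l) u v w z = (\<Sum>s\<in>S. eval4 (t s) u v w z)"
proof -
  have *: "(\<Sum>i\<in>UNIV. \<Sum>s\<in>S. f i s) = (\<Sum>s\<in>S. \<Sum>i\<in>UNIV. f i s)" for f :: "'a::finite \<Rightarrow> 'b \<Rightarrow> real"
    by (rule sum.swap)
  show ?thesis
    unfolding eval4_def by (simp add: sum_distrib_right *)
qed

lemma eval4_scale: "eval4 (\<lambda>i j k l. r * t i j k l) u v w z = r * eval4 t u v w z"
  unfolding eval4_def by (simp add: sum_distrib_left mult.assoc)

section \<open>Contractions with a Gram matrix\<close>

lemma sum_UNIV_prod:
  fixes f :: "'a::finite \<times> 'b::finite \<Rightarrow> real"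
  shows "sum f UNIV = (\<Sum>x\<in>UNIV. \<Sum>y\<in>UNIV. f (x, y))"
  by (simp add: sum.cartesian_product flip: UNIV_Times_UNIV)

definition gram :: "('i \<Rightarrow> 'i \<Rightarrow> real) \<Rightarrow> ('a::finite \<Rightarrow> 'i \<Rightarrow> real) \<Rightarrow> bool" where
  "gram G E \<longleftrightarrow> (\<forall>i j. G i j = (\<Sum>a\<in>UNIV. E a i * E a j))"

lemma gram_contraction:
  fixes G :: "'i::finite \<Rightarrow> 'i \<Rightarrow> real" and E :: "'a::finite \<Rightarrow> 'i \<Rightarrow> real"
  assumes "gram G E"
  shows "(\<Sum>i\<in>UNIV. \<Sum>j\<in>UNIV. G i j * X i * Y j) =
    (\<Sum>a\<in>UNIV. (\<Sum>i\<in>UNIV. X i * E a i) * (\<Sum>j\<in>UNIV. Y j * E a j))"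
proof -
  have "(\<Sum>i\<in>UNIV. \<Sum>j\<in>UNIV. G i j * X i * Y j) =
    (\<Sum>i\<in>UNIV. \<Sum>j\<in>UNIV. \<Sum>a\<in>UNIV. X i * E a i * (Y j * E a j))"
    using assms unfolding gram_def by (simp add: sum_distrib_left mult_ac)
  also have "\<dots> = (\<Sum>a\<in>UNIV. \<Sum>i\<in>UNIV. \<Sum>j\<in>UNIV. X i * E a i * (Y j * E a j))"
    by (rule sum_rotate)
  finally show ?thesis
    by (simp add: sum_product)
qed

text \<open>Pairs of indices form one index of product type, so contractions over several indices
  are instances of \<open>gram_contraction\<close>.\<close>

lemma gram_prod:
  fixes G :: "'i \<Rightarrow> 'i \<Rightarrow> real" and E :: "'a::finite \<Rightarrow> 'i \<Rightarrow> real"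
    and G' :: "'j \<Rightarrow> 'j \<Rightarrow> real" and E' :: "'b::finite \<Rightarrow> 'j \<Rightarrow> real"
  assumes "gram G E" and "gram G' E'"
  shows "gram (\<lambda>(i, i') (j, j'). G i j * G' i' j') (\<lambda>(a, b) (i, i'). E a i * E' b i')"
  using assms unfolding gram_def
  by (simp add: sum_UNIV_prod sum_product) (simp add: mult_ac)

lemma gram_contraction2:
  fixes G :: "'n::finite \<Rightarrow> 'n \<Rightarrow> real" and E :: "'a::finite \<Rightarrow> 'n \<Rightarrow> real"
  assumes G: "gram G E"
  shows "(\<Sum>p\<in>UNIV. \<Sum>q\<in>UNIV. \<Sum>p'\<in>UNIV. \<Sum>q'\<in>UNIV. G p p' * G q q' * X p q * Y p' q') =
    (\<Sum>a\<in>UNIV. \<Sum>b\<in>UNIV. (\<Sum>p\<in>UNIV. \<Sum>q\<in>UNIV. X p q * E a p * E b q) *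
       (\<Sum>p\<in>UNIV. \<Sum>q\<in>UNIV. Y p q * E a p * E b q))"
  using gram_contraction[OF gram_prod[OF G G], of "case_prod X" "case_prod Y"]
  by (simp add: sum_UNIV_prod mult.assoc)

lemma gram_contraction3:
  fixes G :: "'n::finite \<Rightarrow> 'n \<Rightarrow> real" and E :: "'a::finite \<Rightarrow> 'n \<Rightarrow> real"
  assumes G: "gram G E"
  shows "(\<Sum>p\<in>UNIV. \<Sum>q\<in>UNIV. \<Sum>r\<in>UNIV. \<Sum>p'\<in>UNIV. \<Sum>q'\<in>UNIV. \<Sum>r'\<in>UNIV.
      G p p' * G q q' * G r r' * X p q r * Y p' q' r') =
    (\<Sum>a\<in>UNIV. \<Sum>b\<in>UNIV. \<Sum>c\<in>UNIV. (\<Sum>p\<in>UNIV. \<Sum>q\<in>UNIV. \<Sum>r\<in>UNIV. X p q r * E a p * E b q * E c r) *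
       (\<Sum>p\<in>UNIV. \<Sum>q\<in>UNIV. \<Sum>r\<in>UNIV. Y p q r * E a p * E b q * E c r))"
  using gram_contraction[OF gram_prod[OF G gram_prod[OF G G]], of "\<lambda>(p, q, r). X p q r" "\<lambda>(p, q, r). Y p q r"]
  by (simp add: sum_UNIV_prod mult.assoc)

lemma gram_contraction4:
  fixes G :: "'n::finite \<Rightarrow> 'n \<Rightarrow> real" and E :: "'a::finite \<Rightarrow> 'n \<Rightarrow> real"
  assumes G: "gram G E"
  shows "(\<Sum>p\<in>UNIV. \<Sum>q\<in>UNIV. \<Sum>r\<in>UNIV. \<Sum>s\<in>UNIV. \<Sum>p'\<in>UNIV. \<Sum>q'\<in>UNIV. \<Sum>r'\<in>UNIV. \<Sum>s'\<in>UNIV.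
      G p p' * G q q' * G r r' * G s s' * X p q r s * Y p' q' r' s') =
    (\<Sum>a\<in>UNIV. \<Sum>b\<in>UNIV. \<Sum>c\<in>UNIV. \<Sum>d\<in>UNIV.
       (\<Sum>p\<in>UNIV. \<Sum>q\<in>UNIV. \<Sum>r\<in>UNIV. \<Sum>s\<in>UNIV. X p q r s * E a p * E b q * E c r * E d s) *
       (\<Sum>p\<in>UNIV. \<Sum>q\<in>UNIV. \<Sum>r\<in>UNIV. \<Sum>s\<in>UNIV. Y p q r s * E a p * E b q * E c r * E d s))"
  using gram_contraction[OF gram_prod[OF G gram_prod[OF G gram_prod[OF G G]]], of "\<lambda>(p, q, r, s). X p q r s" "\<lambda>(p, q, r, s). Y p q r s"]
  by (simp add: sum_UNIV_prod mult.assoc)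

section \<open>The Hodge star in an oriented orthonormal frame\<close>

lemma det_vector_7_row1:
  fixes u b c d e f g :: "real^7"
  shows "det (vector [u,b,c,d,e,f,g] :: real^7^7) = (\<Sum>p\<in>UNIV. u$p * det (vector [axis p 1,b,c,d,e,f,g] :: real^7^7))"
proof -
  have *: "(vector [v,b,c,d,e,f,g] :: real^7^7) = (\<chi> i. if i = 1 then v else vector [0,b,c,d,e,f,g] $ i)" for v
    by (simp add: vec_eq_iff[where 'b = 7] forall_7)
  have "det (vector [u,b,c,d,e,f,g] :: real^7^7) =
    det ((\<chi> i. if i = 1 then (\<Sum>p\<in>UNIV. u$p *s axis p 1) else vector [0,b,c,d,e,f,g] $ i) :: real^7^7)"
    by (simp only: basis_expansion *[of u])
  also have "\<dots> = (\<Sum>p\<in>UNIV. u$p * det (vector [axis p 1,b,c,d,e,f,g] :: real^7^7))"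
    by (subst det_linear_row_sum) (simp_all add: det_row_mul *[of "axis _ 1"])
  finally show ?thesis .
qed

lemma det_vector_7_expand:
  fixes u v w a b c d :: "real^7"
  shows "det (vector [u,v,w,a,b,c,d] :: real^7^7) =
    (\<Sum>i\<in>UNIV. \<Sum>j\<in>UNIV. \<Sum>k\<in>UNIV. \<Sum>l\<in>UNIV. \<Sum>p\<in>UNIV. \<Sum>q\<in>UNIV. \<Sum>r\<in>UNIV.
      eps7 p q r i j k l * u$p * v$q * w$r * a$i * b$j * c$k * d$l)"
proof -
  let ?D = "\<lambda>u v w a b c d. det (vector [u,v,w,a,b,c,d] :: real^7^7)"
  note swap = det_vector_7_swap
  have 1: "?D u v w a b c d = (\<Sum>p\<in>UNIV. u$p * ?D (axis p 1) v w a b c d)" for u v w a b c d :: "real^7"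
    by (rule det_vector_7_row1)
  \<comment> \<open>Linearity in the first row is carried down one row at a time by an adjacent swap
    before and after.\<close>
  have 2: "?D u v w a b c d = (\<Sum>p\<in>UNIV. v$p * ?D u (axis p 1) w a b c d)" for u v w a b c d :: "real^7"
    using 1[of v u w a b c d] by (simp only: swap(1)[of _ u] mult_minus_right sum_negf neg_equal_iff_equal)
  have 3: "?D u v w a b c d = (\<Sum>p\<in>UNIV. w$p * ?D u v (axis p 1) a b c d)" for u v w a b c d :: "real^7"
    using 2[of u w v a b c d] by (simp only: swap(2)[of _ _ v] mult_minus_right sum_negf neg_equal_iff_equal)
  have 4: "?D u v w a b c d = (\<Sum>p\<in>UNIV. a$p * ?D u v w (axis p 1) b c d)" for u v w a b c d :: "real^7"
    using 3[of u v a w b c d] by (simp only: swap(3)[of _ _ _ w] mult_minus_right sum_negf neg_equal_iff_equal)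
  have 5: "?D u v w a b c d = (\<Sum>p\<in>UNIV. b$p * ?D u v w a (axis p 1) c d)" for u v w a b c d :: "real^7"
    using 4[of u v w b a c d] by (simp only: swap(4)[of _ _ _ _ a] mult_minus_right sum_negf neg_equal_iff_equal)
  have 6: "?D u v w a b c d = (\<Sum>p\<in>UNIV. c$p * ?D u v w a b (axis p 1) d)" for u v w a b c d :: "real^7"
    using 5[of u v w a c b d] by (simp only: swap(5)[of _ _ _ _ _ b] mult_minus_right sum_negf neg_equal_iff_equal)
  have 7: "?D u v w a b c d = (\<Sum>p\<in>UNIV. d$p * ?D u v w a b c (axis p 1))" for u v w a b c d :: "real^7"
    using 6[of u v w a b d c] by (simp only: swap(6)[of _ _ _ _ _ _ c] mult_minus_right sum_negf neg_equal_iff_equal)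
  have "?D u v w a b c d = (\<Sum>i\<in>UNIV. a$i * (\<Sum>j\<in>UNIV. b$j * (\<Sum>k\<in>UNIV. c$k * (\<Sum>l\<in>UNIV. d$l *
      (\<Sum>p\<in>UNIV. u$p * (\<Sum>q\<in>UNIV. v$q * (\<Sum>r\<in>UNIV. w$r * eps7 p q r i j k l)))))))"
    unfolding eps7_def
    by (subst 4, subst 5, subst 6, subst 7, subst 1, subst 2, subst 3) (rule refl)
  then show ?thesis
    by (simp add: sum_distrib_left mult_ac)
qed

text \<open>The matrix of frame vectors is the product of a matrix of unit rows and the frame
  matrix, so multiplicativity of the determinant applies.\<close>

lemma eps7_frame:
  "eval4 (\<lambda>i j k l. \<Sum>p\<in>UNIV. \<Sum>q\<in>UNIV. \<Sum>r\<in>UNIV. eps7 p q r i j k l * e s $ p * e t $ q * e u $ r)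
      (e a) (e b) (e c) (e d) = det (\<chi> a i. e a $ i) * eps7 s t u a b c d"
proof -
  let ?E = "\<chi> a i. e a $ i"
  have row: "(\<Sum>k\<in>UNIV. axis s 1 $ k * e k $ i) = e s $ i" for s i
    by (simp add: axis_def mult_delta_left)
  have "(vector [axis s 1, axis t 1, axis u 1, axis a 1, axis b 1, axis c 1, axis d 1] :: real^7^7) ** ?E =
    vector [e s, e t, e u, e a, e b, e c, e d]"
    by (simp add: matrix_matrix_mult_def vec_eq_iff[where 'b = 7] forall_7 row)
  then have "det (vector [e s, e t, e u, e a, e b, e c, e d] :: real^7^7) = eps7 s t u a b c d * det ?E"
    unfolding eps7_def by (metis det_mul)
  then show ?thesis
    unfolding det_vector_7_expand eval4_def by (simp add: sum_distrib_left mult_ac)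
qed

lemma gram_ginv:
  assumes "orthonormal_frame (g c x) e"
  shows "gram (ginv g c x) (\<lambda>a i. e a $ i)"
  using ginv_frame[of g c x e] assms by (simp add: gram_def)

text \<open>The inverse metric is the Gram matrix of the frame, so the contraction becomes one over
  frame indices. The frame determinant from \<open>eps7_frame\<close> cancels the volume
  factor.\<close>

lemma hodge3_frame:
  assumes "orthonormal_frame (g c x) e" "det (\<chi> a i. e a $ i) > 0"
    and phi: "\<And>i j k. eval3 (\<omega> c x) (e i) (e j) (e k) = phi i j k"
  shows "eval4 (hodge3 g \<omega> c x) (e a) (e b) (e c') (e d) = psi a b c' d"
proof -
  let ?W = "\<lambda>s t u i j k l. \<Sum>p\<in>UNIV. \<Sum>q\<in>UNIV. \<Sum>r\<in>UNIV. eps7 p q r i j k l * e s $ p * e t $ q * e u $ r"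
  let ?r = "sqrt (det (\<chi> a b. g c x a b))"
  have "hodge3 g \<omega> c x i j k l =
    (1 / 6) * ?r * (\<Sum>s\<in>UNIV. \<Sum>t\<in>UNIV. \<Sum>u\<in>UNIV. phi s t u * ?W s t u i j k l)" for i j k l
  proof -
    have "hodge3 g \<omega> c x i j k l = (1 / 6) * ?r *
      (\<Sum>p\<in>UNIV. \<Sum>q\<in>UNIV. \<Sum>r\<in>UNIV. \<Sum>p'\<in>UNIV. \<Sum>q'\<in>UNIV. \<Sum>r'\<in>UNIV.
        ginv g c x p p' * ginv g c x q q' * ginv g c x r r' * eps7 p q r i j k l * \<omega> c x p' q' r')"
      unfolding hodge3_def by (simp add: fact_numeral mult_ac)
    also have "\<dots> = (1 / 6) * ?r * (\<Sum>s\<in>UNIV. \<Sum>t\<in>UNIV. \<Sum>u\<in>UNIV. ?W s t u i j k l * phi s t u)"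
      unfolding gram_contraction3[OF gram_ginv[of g c x e, OF assms(1)]] phi[symmetric] eval3_def by simp
    finally show ?thesis by (simp add: mult.commute)
  qed
  then have "hodge3 g \<omega> c x = (\<lambda>i j k l. (1 / 6) * ?r * (\<Sum>s\<in>UNIV. \<Sum>t\<in>UNIV. \<Sum>u\<in>UNIV. phi s t u * ?W s t u i j k l))"
    by blast
  then have "eval4 (hodge3 g \<omega> c x) (e a) (e b) (e c') (e d) =
     (1 / 6) * ?r * (\<Sum>s\<in>UNIV. \<Sum>t\<in>UNIV. \<Sum>u\<in>UNIV. phi s t u *
       eval4 (\<lambda>i j k l. ?W s t u i j k l) (e a) (e b) (e c') (e d))"
    by (simp only: eval4_sum eval4_scale)
  also have "\<dots> = (?r * det (\<chi> a i. e a $ i)) * psi a b c' d"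
    unfolding eps7_frame psi_def by (simp add: sum_distrib_left mult_ac)
  finally show ?thesis
    using sqrt_det_metric_frame[OF assms(1,2)] by simp
qed

section \<open>Multilinear evaluation and expansion in a frame\<close>

lemma eval3_add:
  "eval3 t (u + u') v w = eval3 t u v w + eval3 t u' v w"
  "eval3 t u (v + v') w = eval3 t u v w + eval3 t u v' w"
  "eval3 t u v (w + w') = eval3 t u v w + eval3 t u v w'"
  unfolding eval3_def by (simp_all add: algebra_simps sum.distrib)

lemma eval3_scaleR:
  "eval3 t (r *\<^sub>R u) v w = r * eval3 t u v w"
  "eval3 t u (r *\<^sub>R v) w = r * eval3 t u v w"
  "eval3 t u v (r *\<^sub>R w) = r * eval3 t u v w"
  unfolding eval3_def by (simp_all add: sum_distrib_left mult_ac)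

lemma eval3_zero [simp]: "eval3 t 0 v w = 0" "eval3 t u 0 w = 0" "eval3 t u v 0 = 0"
  unfolding eval3_def by simp_all

lemma eval3_sum:
  "eval3 t (\<Sum>s\<in>S. f s) v w = (\<Sum>s\<in>S. eval3 t (f s) v w)"
  "eval3 t u (\<Sum>s\<in>S. f s) w = (\<Sum>s\<in>S. eval3 t u (f s) w)"
  "eval3 t u v (\<Sum>s\<in>S. f s) = (\<Sum>s\<in>S. eval3 t u v (f s))"
  by (induction S rule: infinite_finite_induct) (simp_all add: eval3_add)

lemma eval3_diff_tensor:
  "eval3 (\<lambda>i j k. t i j k - t' i j k) u v w = eval3 t u v w - eval3 t' u v w"
  unfolding eval3_def by (simp add: algebra_simps sum_subtractf)

lemma eval3_sum_tensor: "eval3 (\<lambda>i j k. \<Sum>s\<in>S. t s i j k) u v w = (\<Sum>s\<in>S. eval3 (t s) u v w)"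
proof -
  have *: "(\<Sum>i\<in>UNIV. \<Sum>s\<in>S. f i s) = (\<Sum>s\<in>S. \<Sum>i\<in>UNIV. f i s)" for f :: "'a::finite \<Rightarrow> 'b \<Rightarrow> real"
    by (rule sum.swap)
  show ?thesis
    unfolding eval3_def by (simp add: sum_distrib_right *)
qed

lemma eval3_flip:
  "eval3 (\<lambda>i j k. t j i k) u v w = eval3 t v u w"
  "eval3 (\<lambda>i j k. t i k j) u v w = eval3 t u w v"
proof -
  show "eval3 (\<lambda>i j k. t j i k) u v w = eval3 t v u w"
    unfolding eval3_def by (subst sum.swap) (simp add: mult_ac)
  have "(\<Sum>j\<in>UNIV. \<Sum>k\<in>UNIV. t i k j * u $ i * v $ j * w $ k) =
    (\<Sum>j\<in>UNIV. \<Sum>k\<in>UNIV. t i j k * u $ i * w $ j * v $ k)" for i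
    by (subst sum.swap) (simp add: mult_ac)
  then show "eval3 (\<lambda>i j k. t i k j) u v w = eval3 t u w v"
    unfolding eval3_def by simp
qed

text \<open>A matrix on a tensor index is moved to the argument; this lets the coefficient terms of
  \<open>cov3\<close> join the derivatives of the frame vectors.\<close>

lemma eval3_slot1:
  "eval3 (\<lambda>j k l. \<Sum>m\<in>UNIV. M m j * t m k l) u v w = eval3 t (\<chi> j. \<Sum>m\<in>UNIV. M j m * u $ m) v w"
proof -
  have "eval3 (\<lambda>j k l. M m j * t m k l) u v w =
    (\<Sum>j\<in>UNIV. M m j * u $ j) * (\<Sum>k\<in>UNIV. \<Sum>l\<in>UNIV. t m k l * v $ k * w $ l)" for m
    unfolding eval3_def sum_distrib_right by (simp add: sum_distrib_left mult_ac)
  then have "eval3 (\<lambda>j k l. \<Sum>m\<in>UNIV. M m j * t m k l) u v w =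
    (\<Sum>m\<in>UNIV. (\<Sum>j\<in>UNIV. M m j * u $ j) * (\<Sum>k\<in>UNIV. \<Sum>l\<in>UNIV. t m k l * v $ k * w $ l))"
    unfolding eval3_sum_tensor by simp
  also have "\<dots> = eval3 t (\<chi> j. \<Sum>m\<in>UNIV. M j m * u $ m) v w"
    unfolding eval3_def by (simp add: sum_distrib_left mult_ac)
  finally show ?thesis .
qed

lemma eval3_slot2:
  "eval3 (\<lambda>j k l. \<Sum>m\<in>UNIV. M m k * t j m l) u v w = eval3 t u (\<chi> j. \<Sum>m\<in>UNIV. M j m * v $ m) w"
  using eval3_slot1[of M "\<lambda>j k l. t k j l" v u w] eval3_flip(1)[of "\<lambda>k j l. \<Sum>m\<in>UNIV. M m k * t j m l" u v w]
  by (simp add: eval3_flip(1)[of t])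

lemma eval3_slot3:
  "eval3 (\<lambda>j k l. \<Sum>m\<in>UNIV. M m l * t j k m) u v w = eval3 t u v (\<chi> j. \<Sum>m\<in>UNIV. M j m * w $ m)"
  using eval3_slot2[of M "\<lambda>j k l. t j l k" u w v] eval3_flip(2)[of "\<lambda>j l k. \<Sum>m\<in>UNIV. M m l * t j k m" u v w]
  by (simp add: eval3_flip(2)[of t])

lemma pd_eval3:
  assumes "\<And>j k l. (\<lambda>y. t y j k l) differentiable (at x)" "\<And>j. (\<lambda>y. u y $ j) differentiable (at x)"
    "\<And>j. (\<lambda>y. v y $ j) differentiable (at x)" "\<And>j. (\<lambda>y. w y $ j) differentiable (at x)"
  shows "pd i (\<lambda>y. eval3 (t y) (u y) (v y) (w y)) x =
    eval3 (\<lambda>j k l. pd i (\<lambda>y. t y j k l) x) (u x) (v x) (w x)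
    + eval3 (t x) (\<chi> j. pd i (\<lambda>y. u y $ j) x) (v x) (w x)
    + eval3 (t x) (u x) (\<chi> j. pd i (\<lambda>y. v y $ j) x) (w x)
    + eval3 (t x) (u x) (v x) (\<chi> j. pd i (\<lambda>y. w y $ j) x)"
  unfolding eval3_def
  by (simp add: assms pd_sum pd_mult differentiable_sum_fun sum.distrib algebra_simps)

lemma sum_coframe_frame_scaleR:
  assumes "orthonormal_frame h e"
  shows "(\<Sum>a\<in>UNIV. coframe h e i a *\<^sub>R e a) = axis i 1"
  by (simp add: vec_eq_iff coframe_frame[OF assms] axis_def)

lemma eval3_axis: "eval3 t (axis i 1) (axis j 1) (axis k 1) = t i j k"
proof -
  have "eval3 t (axis i 1) (axis j 1) (axis k 1) =
    (\<Sum>p\<in>UNIV. \<Sum>q\<in>UNIV. \<Sum>r\<in>UNIV. if p = i then if q = j then if r = k then t p q r else 0 else 0 else 0)"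
    unfolding eval3_def by (intro sum.cong refl) (simp add: axis_def)
  then show ?thesis by (simp add: sum_delta_if)
qed

lemma eval3_eqI:
  assumes "orthonormal_frame h e"
    and "\<And>a b d. eval3 t (e a) (e b) (e d) = eval3 t' (e a) (e b) (e d)"
  shows "t i j k = t' i j k"
proof -
  have "t i j k = eval3 t (\<Sum>a\<in>UNIV. coframe h e i a *\<^sub>R e a) (\<Sum>a\<in>UNIV. coframe h e j a *\<^sub>R e a)
      (\<Sum>a\<in>UNIV. coframe h e k a *\<^sub>R e a)" for t
    unfolding sum_coframe_frame_scaleR[OF assms(1)] eval3_axis ..
  from this[of t] this[of t'] show ?thesis
    by (simp add: eval3_sum eval3_scaleR assms(2))
qed

lemma eval4_eval3: "eval4 t u v w z = (\<Sum>i\<in>UNIV. u $ i * eval3 (t i) v w z)"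
  unfolding eval4_def eval3_def by (simp add: sum_distrib_left mult_ac)

lemma eval3_scale_tensor: "eval3 (\<lambda>i j k. r * t i j k) u v w = r * eval3 t u v w"
  unfolding eval3_def by (simp add: sum_distrib_left mult_ac)

lemma eval3_skew:
  assumes "\<And>i j k. t i j k = - t j i k" "\<And>i j k. t i j k = - t i k j"
  shows "eval3 t v u w = - eval3 t u v w" "eval3 t u w v = - eval3 t u v w"
proof -
  have "t j i k = - 1 * t i j k" "t i k j = - 1 * t i j k" for i j k
    using assms(1)[of i j k] assms(2)[of i j k] by linarith+
  then have "(\<lambda>i j k. t j i k) = (\<lambda>i j k. - 1 * t i j k)" "(\<lambda>i j k. t i k j) = (\<lambda>i j k. - 1 * t i j k)"
    by blast+
  then have "eval3 t v u w = eval3 (\<lambda>i j k. - 1 * t i j k) u v w" "eval3 t u w v = eval3 (\<lambda>i j k. - 1 * t i j k) u v w"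
    using eval3_flip(1)[of t u v w] eval3_flip(2)[of t u v w] by (simp_all only:)
  then show "eval3 t v u w = - eval3 t u v w" "eval3 t u w v = - eval3 t u v w"
    unfolding eval3_scale_tensor by simp_all
qed

lemma eval3_add_tensor:
  "eval3 (\<lambda>i j k. t i j k + t' i j k) u v w = eval3 t u v w + eval3 t' u v w"
  unfolding eval3_def by (simp add: algebra_simps sum.distrib)

lemma eval3_cyclic: "eval3 (\<lambda>i j k. t j k i) u v w = eval3 t v w u"
  unfolding eval3_def by (subst (2) sum_rotate) (simp add: mult_ac)

lemma eval3_axis1: "eval3 t (axis l 1) v w = (\<Sum>j\<in>UNIV. \<Sum>k\<in>UNIV. t l j k * v $ j * w $ k)"
proof -
  have "eval3 t (axis l 1) v w =
    (\<Sum>i\<in>UNIV. if i = l then \<Sum>j\<in>UNIV. \<Sum>k\<in>UNIV. t i j k * v $ j * w $ k else 0)"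
    unfolding eval3_def by (intro sum.cong refl) (auto simp: axis_def)
  then show ?thesis by simp
qed

lemma eval2_expand:
  "eval2 t (\<Sum>a\<in>UNIV. r a *\<^sub>R f a) (\<Sum>b\<in>UNIV. s b *\<^sub>R h b) =
    (\<Sum>a\<in>UNIV. \<Sum>b\<in>UNIV. r a * s b * eval2 t (f a) (h b))"
proof -
  have 1: "eval2 t (\<Sum>a\<in>A. r a *\<^sub>R f a) v = (\<Sum>a\<in>A. r a * eval2 t (f a) v)" for A v
    by (induction A rule: infinite_finite_induct)
      (simp_all add: eval2_def algebra_simps sum.distrib sum_distrib_left)
  have 2: "eval2 t u (\<Sum>b\<in>A. s b *\<^sub>R h b) = (\<Sum>b\<in>A. s b * eval2 t u (h b))" for A u
    by (induction A rule: infinite_finite_induct)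
      (simp_all add: eval2_def algebra_simps sum.distrib sum_distrib_left)
  show ?thesis
    unfolding 1 unfolding 2 by (simp add: sum_distrib_left mult.assoc)
qed

lemma vector_frame_expansion:
  assumes "orthonormal_frame h e"
  shows "(\<Sum>a\<in>UNIV. (\<Sum>i\<in>UNIV. u $ i * coframe h e i a) *\<^sub>R e a) = u"
proof -
  have "(\<Sum>a\<in>UNIV. (\<Sum>i\<in>UNIV. u $ i * coframe h e i a) * e a $ j) =
    (\<Sum>i\<in>UNIV. u $ i * (\<Sum>a\<in>UNIV. coframe h e i a * e a $ j))" for j
    unfolding sum_distrib_left sum_distrib_right mult.assoc by (rule sum.swap)
  then show ?thesis
    by (simp add: vec_eq_iff coframe_frame[OF assms] mult_delta_right)
qed

lemma inf_action_add: "inf_action (\<lambda>a b. B a b + C a b) a b c = inf_action B a b c + inf_action C a b c"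
  unfolding inf_action_def by (simp add: sum.distrib algebra_simps)

lemma inf_action_diff: "inf_action (\<lambda>a b. B a b - C a b) a b c = inf_action B a b c - inf_action C a b c"
  using inf_action_diff_scaled[of B 1 C] by simp

lemma hodge3_skew:
  "hodge3 g \<alpha> c x j i k l = - hodge3 g \<alpha> c x i j k l"
  "hodge3 g \<alpha> c x i k j l = - hodge3 g \<alpha> c x i j k l"
  "hodge3 g \<alpha> c x i j l k = - hodge3 g \<alpha> c x i j k l"
  unfolding hodge3_def
  by (simp_all add: eps7_swap(4)[of _ _ _ j i k l] eps7_swap(5)[of _ _ _ i k j l] eps7_swap(6)[of _ _ _ i j l k] sum_negf)

section \<open>Connections in a smooth orthonormal frame\<close>

locale smooth_frame =
  fixes g :: "('m, 'n::finite) field2" and c :: "('m, 'n) chart" and V :: "(real^'n) set"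
    and e :: "real^'n \<Rightarrow> 'n \<Rightarrow> real^'n"
  assumes open_V: "open V"
    and smooth_g: "\<And>i j. smooth_on (\<lambda>y. g c y i j) V"
    and smooth_e: "\<And>a. smooth_on (\<lambda>y. e y a) V"
    and orthonormal: "\<And>y. y \<in> V \<Longrightarrow> orthonormal_frame (g c y) (e y)"
begin

abbreviation "\<theta> y \<equiv> coframe (g c y) (e y)"

text \<open>The components of the covariant derivatives of the frame fields with respect to the frame.\<close>
definition conn :: "('m, 'n) field3 \<Rightarrow> real^'n \<Rightarrow> 'n \<Rightarrow> 'n \<Rightarrow> 'n \<Rightarrow> real" where
  "conn N y i a b = (\<Sum>k\<in>UNIV. (pd i (\<lambda>z. e z a $ k) y + (\<Sum>j\<in>UNIV. N c y k i j * e y a $ j)) * \<theta> y k b)"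

lemma smooth_e_component: "smooth_on (\<lambda>y. e y a $ k) V"
  by (rule smooth_on_component[OF open_V smooth_e])

lemma differentiable_e: "x \<in> V \<Longrightarrow> (\<lambda>y. e y a $ k) differentiable (at x)"
  by (rule smooth_on_differentiable[OF smooth_e_component])

lemma differentiable_pd_e: "x \<in> V \<Longrightarrow> (\<lambda>y. pd i (\<lambda>z. e z a $ k) y) differentiable (at x)"
  by (rule smooth_on_differentiable[OF smooth_on_pd[OF smooth_e_component]])

lemma differentiable_coframe: "x \<in> V \<Longrightarrow> (\<lambda>y. \<theta> y i a) differentiable (at x)"
  unfolding coframe_def
  by (intro differentiable_sum_fun differentiable_mult differentiable_e smooth_on_differentiable[OF smooth_g])

lemma differentiable_conn:
  assumes "\<And>k i j. smooth_on (\<lambda>y. N c y k i j) V" "x \<in> V"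
  shows "(\<lambda>y. conn N y i a b) differentiable (at x)"
  unfolding conn_def
  by (intro differentiable_sum_fun differentiable_mult differentiable_add differentiable_pd_e differentiable_e
      differentiable_coframe smooth_on_differentiable[OF assms(1)] assms(2))

lemma conn_frame:
  assumes "x \<in> V"
  shows "(\<Sum>b\<in>UNIV. conn N x i a b * e x b $ k) = pd i (\<lambda>z. e z a $ k) x + (\<Sum>j\<in>UNIV. N c x k i j * e x a $ j)"
proof -
  have "(\<Sum>b\<in>UNIV. conn N x i a b * e x b $ k) =
    (\<Sum>l\<in>UNIV. (pd i (\<lambda>z. e z a $ l) x + (\<Sum>j\<in>UNIV. N c x l i j * e x a $ j)) * (\<Sum>b\<in>UNIV. \<theta> x l b * e x b $ k))"
    unfolding conn_def sum_distrib_left sum_distrib_right mult.assoc by (rule sum.swap)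
  then show ?thesis
    by (simp add: coframe_frame[OF orthonormal[OF assms]] mult_delta_right)
qed

lemma conn_frame_vec:
  assumes "x \<in> V"
  shows "(\<Sum>b\<in>UNIV. conn N x i a b *\<^sub>R e x b) =
    (\<chi> k. pd i (\<lambda>z. e z a $ k) x) + (\<chi> k. \<Sum>j\<in>UNIV. N c x k i j * e x a $ j)"
  by (simp add: vec_eq_iff conn_frame[OF assms])

text \<open>By the product rule, derivatives of the frame vectors appear; together with the
  coefficients of \<open>N\<close> they make up \<open>conn\<close>.\<close>

lemma cov3_frame:
  assumes "x \<in> V" and "\<And>j k l. (\<lambda>y. t c y j k l) differentiable (at x)"
  shows "eval3 (cov3 N t c x i) (e x a) (e x b) (e x d) =
    pd i (\<lambda>y. eval3 (t c y) (e y a) (e y b) (e y d)) x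
    - (\<Sum>m\<in>UNIV. conn N x i a m * eval3 (t c x) (e x m) (e x b) (e x d)
        + conn N x i b m * eval3 (t c x) (e x a) (e x m) (e x d)
        + conn N x i d m * eval3 (t c x) (e x a) (e x b) (e x m))"
proof -
  have "cov3 N t c x i = (\<lambda>j k l. pd i (\<lambda>y. t c y j k l) x
     - (\<Sum>m\<in>UNIV. N c x m i j * t c x m k l) - (\<Sum>m\<in>UNIV. N c x m i k * t c x j m l)
     - (\<Sum>m\<in>UNIV. N c x m i l * t c x j k m))"
    by (simp add: cov3_def fun_eq_iff)
  moreover have "(\<Sum>m\<in>UNIV. conn N x i a m * eval3 (t c x) (e x m) (e x b) (e x d)
        + conn N x i b m * eval3 (t c x) (e x a) (e x m) (e x d)
        + conn N x i d m * eval3 (t c x) (e x a) (e x b) (e x m)) =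
    eval3 (t c x) (\<Sum>m\<in>UNIV. conn N x i a m *\<^sub>R e x m) (e x b) (e x d)
    + eval3 (t c x) (e x a) (\<Sum>m\<in>UNIV. conn N x i b m *\<^sub>R e x m) (e x d)
    + eval3 (t c x) (e x a) (e x b) (\<Sum>m\<in>UNIV. conn N x i d m *\<^sub>R e x m)"
    by (simp add: eval3_sum eval3_scaleR sum.distrib)
  ultimately show ?thesis
    unfolding conn_frame_vec[OF assms(1)] eval3_add
    by (simp add: eval3_diff_tensor eval3_slot1 eval3_slot2 eval3_slot3
        pd_eval3 assms(2) differentiable_e[OF assms(1)])
qed

text \<open>Differentiating the duality of frame and coframe gives this. Antisymmetrised in
  \<open>i\<close> and \<open>j\<close> it is the first structure equation; symmetric coefficients
  then drop out.\<close>

lemma pd_coframe: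
  assumes "x \<in> V"
  shows "pd i (\<lambda>y. \<theta> y j b) x = (\<Sum>k\<in>UNIV. N c x k i j * \<theta> x k b) - (\<Sum>m\<in>UNIV. \<theta> x j m * conn N x i m b)"
proof -
  have 0: "(\<Sum>m\<in>UNIV. pd i (\<lambda>y. \<theta> y j m) x * e x m $ k + \<theta> x j m * pd i (\<lambda>y. e y m $ k) x) = 0" for k
  proof -
    have "pd i (\<lambda>y. \<Sum>m\<in>UNIV. \<theta> y j m * e y m $ k) x = pd i (\<lambda>y. if j = k then 1 else 0) x"
      by (rule pd_cong[OF open_V assms]) (rule coframe_frame[OF orthonormal])
    then show ?thesis
      by (simp add: pd_sum pd_mult differentiable_coframe[OF assms] differentiable_e[OF assms])
  qed
  have "pd i (\<lambda>y. \<theta> y j b) x = (\<Sum>m\<in>UNIV. pd i (\<lambda>y. \<theta> y j m) x * (\<Sum>k\<in>UNIV. e x m $ k * \<theta> x k b))"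
    by (simp add: frame_coframe[OF orthonormal[OF assms]] mult_delta_right)
  also have "\<dots> = (\<Sum>k\<in>UNIV. (\<Sum>m\<in>UNIV. pd i (\<lambda>y. \<theta> y j m) x * e x m $ k) * \<theta> x k b)"
    unfolding sum_distrib_left sum_distrib_right mult.assoc by (rule sum.swap)
  also have "\<dots> = - (\<Sum>k\<in>UNIV. (\<Sum>m\<in>UNIV. \<theta> x j m * pd i (\<lambda>y. e y m $ k) x) * \<theta> x k b)"
  proof -
    have "(\<Sum>m\<in>UNIV. pd i (\<lambda>y. \<theta> y j m) x * e x m $ k) = - (\<Sum>m\<in>UNIV. \<theta> x j m * pd i (\<lambda>y. e y m $ k) x)" for k
      using 0[of k] unfolding sum.distrib by linarith
    then show ?thesis by (simp add: sum_negf)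
  qed
  finally have 1: "pd i (\<lambda>y. \<theta> y j b) x = - (\<Sum>k\<in>UNIV. (\<Sum>m\<in>UNIV. \<theta> x j m * pd i (\<lambda>y. e y m $ k) x) * \<theta> x k b)" .
  have "(\<Sum>m\<in>UNIV. \<theta> x j m * conn N x i m b) =
    (\<Sum>k\<in>UNIV. (\<Sum>m\<in>UNIV. \<theta> x j m * (pd i (\<lambda>y. e y m $ k) x + (\<Sum>l\<in>UNIV. N c x k i l * e x m $ l))) * \<theta> x k b)"
    unfolding conn_def sum_distrib_left sum_distrib_right mult.assoc by (rule sum.swap)
  also have "\<dots> = (\<Sum>k\<in>UNIV. (\<Sum>m\<in>UNIV. \<theta> x j m * pd i (\<lambda>y. e y m $ k) x) * \<theta> x k b)
      + (\<Sum>k\<in>UNIV. (\<Sum>m\<in>UNIV. \<theta> x j m * (\<Sum>l\<in>UNIV. N c x k i l * e x m $ l)) * \<theta> x k b)"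
    by (simp add: algebra_simps sum.distrib)
  finally have 2: "(\<Sum>m\<in>UNIV. \<theta> x j m * conn N x i m b) =
      (\<Sum>k\<in>UNIV. (\<Sum>m\<in>UNIV. \<theta> x j m * pd i (\<lambda>y. e y m $ k) x) * \<theta> x k b)
      + (\<Sum>k\<in>UNIV. (\<Sum>m\<in>UNIV. \<theta> x j m * (\<Sum>l\<in>UNIV. N c x k i l * e x m $ l)) * \<theta> x k b)" .
  have "(\<Sum>m\<in>UNIV. \<theta> x j m * (\<Sum>l\<in>UNIV. N c x k i l * e x m $ l)) = N c x k i j" for k
  proof -
    have "(\<Sum>m\<in>UNIV. \<theta> x j m * (\<Sum>l\<in>UNIV. N c x k i l * e x m $ l)) =
      (\<Sum>l\<in>UNIV. N c x k i l * (\<Sum>m\<in>UNIV. \<theta> x j m * e x m $ l))"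
      unfolding sum_distrib_left by (subst sum.swap) (simp add: mult_ac)
    then show ?thesis
      by (simp add: coframe_frame[OF orthonormal[OF assms]] mult_delta_right)
  qed
  then show ?thesis using 1 2 by simp
qed

text \<open>The covariant derivatives of the frame fields are differentiated once more; second derivatives
  of the frame cancel.\<close>

lemma curvature_frame:
  assumes smooth: "\<And>k i j. smooth_on (\<lambda>y. N c y k i j) V" and "x \<in> V"
  shows "(\<Sum>l\<in>UNIV. \<Sum>k\<in>UNIV. curvature N c x l i j k * e x a $ k * \<theta> x l d) =
    pd i (\<lambda>y. conn N y j a d) x - pd j (\<lambda>y. conn N y i a d) x
    + (\<Sum>b\<in>UNIV. conn N x j a b * conn N x i b d - conn N x i a b * conn N x j b d)"
proof -
  note diff = differentiable_conn[of N x, OF smooth \<open>x \<in> V\<close>] differentiable_e[OF \<open>x \<in> V\<close>]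
    differentiable_pd_e[OF \<open>x \<in> V\<close>] smooth_on_differentiable[OF smooth \<open>x \<in> V\<close>]
  let ?F = "\<lambda>i j a d. pd i (\<lambda>y. conn N y j a d) x - pd j (\<lambda>y. conn N y i a d) x
    + (\<Sum>b\<in>UNIV. conn N x j a b * conn N x i b d - conn N x i a b * conn N x j b d)"
  have *: "(\<Sum>d\<in>UNIV. ?F i j a d * e x d $ k) = (\<Sum>m\<in>UNIV. curvature N c x k i j m * e x a $ m)" for k
  proof -
    define P where "P i j = (\<Sum>b\<in>UNIV. pd i (\<lambda>y. conn N y j a b) x * e x b $ k)" for i j
    define Q where "Q i j = (\<Sum>d\<in>UNIV. \<Sum>b\<in>UNIV. conn N x j a b * conn N x i b d * e x d $ k)" for i j
    define M where "M i j = (\<Sum>b\<in>UNIV. \<Sum>m\<in>UNIV. conn N x j a b * (N c x k i m * e x b $ m))" for i j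
    define X where "X i j = (\<Sum>m\<in>UNIV. pd i (\<lambda>y. N c y k j m) x * e x a $ m)" for i j
    define Y where "Y i j = (\<Sum>l\<in>UNIV. \<Sum>m\<in>UNIV. N c x k j m * N c x m i l * e x a $ l)" for i j
    have pd_e: "pd i (\<lambda>y. e y b $ k) x = (\<Sum>d\<in>UNIV. conn N x i b d * e x d $ k) - (\<Sum>m\<in>UNIV. N c x k i m * e x b $ m)"
      for i b k
      using conn_frame[OF \<open>x \<in> V\<close>, of N i b k] by simp
    \<comment> \<open>This is \<open>conn_frame\<close> differentiated. Exchanging \<open>i\<close>
      and \<open>j\<close> and subtracting removes the \<open>M\<close> terms as well as the second
      derivatives.\<close>
    have eq: "P i j + Q i j - M i j = pd i (pd j (\<lambda>z. e z a $ k)) x + X i j + M j i - Y i j" for i j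
    proof -
      have "pd i (\<lambda>y. \<Sum>b\<in>UNIV. conn N y j a b * e y b $ k) x =
        pd i (\<lambda>y. pd j (\<lambda>z. e z a $ k) y + (\<Sum>m\<in>UNIV. N c y k j m * e y a $ m)) x"
        by (rule pd_cong[OF open_V \<open>x \<in> V\<close>]) (rule conn_frame)
      then have "(\<Sum>b\<in>UNIV. pd i (\<lambda>y. conn N y j a b) x * e x b $ k + conn N x j a b * pd i (\<lambda>y. e y b $ k) x) =
        pd i (pd j (\<lambda>z. e z a $ k)) x
        + (\<Sum>m\<in>UNIV. pd i (\<lambda>y. N c y k j m) x * e x a $ m + N c x k j m * pd i (\<lambda>y. e y a $ m) x)"
        by (simp add: pd_add pd_sum pd_mult diff differentiable_sum_fun)
      moreover have "(\<Sum>b\<in>UNIV. conn N x j a b * pd i (\<lambda>y. e y b $ k) x) = Q i j - M i j"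
      proof -
        have "(\<Sum>b\<in>UNIV. conn N x j a b * pd i (\<lambda>y. e y b $ k) x) =
          (\<Sum>b\<in>UNIV. \<Sum>d\<in>UNIV. conn N x j a b * conn N x i b d * e x d $ k) - M i j"
          unfolding pd_e M_def by (simp add: right_diff_distrib sum_subtractf sum_distrib_left mult.assoc)
        also have "(\<Sum>b\<in>UNIV. \<Sum>d\<in>UNIV. conn N x j a b * conn N x i b d * e x d $ k) = Q i j"
          unfolding Q_def by (rule sum.swap)
        finally show ?thesis .
      qed
      moreover have "(\<Sum>m\<in>UNIV. N c x k j m * pd i (\<lambda>y. e y a $ m) x) = M j i - Y i j"
      proof -
        have "(\<Sum>m\<in>UNIV. N c x k j m * pd i (\<lambda>y. e y a $ m) x) =
          (\<Sum>m\<in>UNIV. \<Sum>d\<in>UNIV. conn N x i a d * (N c x k j m * e x d $ m))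
          - (\<Sum>m\<in>UNIV. \<Sum>l\<in>UNIV. N c x k j m * N c x m i l * e x a $ l)"
          unfolding pd_e by (simp add: right_diff_distrib sum_subtractf sum_distrib_left mult_ac)
        also have "(\<Sum>m\<in>UNIV. \<Sum>d\<in>UNIV. conn N x i a d * (N c x k j m * e x d $ m)) = M j i"
          unfolding M_def by (rule sum.swap)
        also have "(\<Sum>m\<in>UNIV. \<Sum>l\<in>UNIV. N c x k j m * N c x m i l * e x a $ l) = Y i j"
          unfolding Y_def by (rule sum.swap)
        finally show ?thesis .
      qed
      ultimately show ?thesis
        unfolding P_def X_def sum.distrib by linarith
    qed
    have "(\<Sum>d\<in>UNIV. ?F i j a d * e x d $ k) = P i j - P j i + Q i j - Q j i"
      unfolding P_def Q_def
      by (simp add: distrib_right left_diff_distrib sum.distrib sum_subtractf sum_distrib_right)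
    also have "\<dots> = X i j - X j i + Y j i - Y i j"
      using eq[of i j] eq[of j i] pd_pd_commute[OF open_V smooth_e_component \<open>x \<in> V\<close>, of i j a k] by linarith
    also have "\<dots> = (\<Sum>m\<in>UNIV. curvature N c x k i j m * e x a $ m)"
      unfolding X_def Y_def curvature_def
      by (simp add: distrib_right left_diff_distrib sum.distrib sum_subtractf sum_distrib_right)
    finally show ?thesis .
  qed
  have "(\<Sum>l\<in>UNIV. \<Sum>k\<in>UNIV. curvature N c x l i j k * e x a $ k * \<theta> x l d) =
    (\<Sum>l\<in>UNIV. (\<Sum>b\<in>UNIV. ?F i j a b * e x b $ l) * \<theta> x l d)"
    unfolding * by (simp add: sum_distrib_right)
  also have "\<dots> = (\<Sum>b\<in>UNIV. ?F i j a b * (\<Sum>l\<in>UNIV. e x b $ l * \<theta> x l d))"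
    unfolding sum_distrib_left sum_distrib_right mult.assoc by (rule sum.swap)
  also have "\<dots> = ?F i j a d"
    by (simp only: frame_coframe[OF orthonormal[OF \<open>x \<in> V\<close>]]) (simp add: mult_delta_right)
  finally show ?thesis .
qed

end

section \<open>Frames adapted to a nearly parallel structure\<close>

text \<open>Here \<open>\<mu>\<close> stands for \<open>- \<lambda> / 4\<close> in chart
  coordinates, with no regularity imposed.\<close>

locale nearly_parallel_frame = smooth_frame g c V e
  for g :: "('m, 7) field2" and c :: "('m, 7) chart" and V and e +
  fixes \<omega> D N :: "('m, 7) field3" and \<mu> :: "real^7 \<Rightarrow> real"
  assumes det_pos: "\<And>y. y \<in> V \<Longrightarrow> det (\<chi> a i. e y a $ i) > 0"
    and phi: "\<And>y i j k. y \<in> V \<Longrightarrow> eval3 (\<omega> c y) (e y i) (e y j) (e y k) = phi i j k"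
    and smooth_\<omega>: "\<And>i j k. smooth_on (\<lambda>y. \<omega> c y i j k) V"
    and smooth_D: "\<And>k i j. smooth_on (\<lambda>y. D c y k i j) V"
    and smooth_N: "\<And>k i j. smooth_on (\<lambda>y. N c y k i j) V"
    and D_symmetric: "\<And>y i j k. y \<in> V \<Longrightarrow> D c y k i j = D c y k j i"
    and D_\<omega>: "\<And>y i j k l. y \<in> V \<Longrightarrow> cov3 D \<omega> c y i j k l = \<mu> y * hodge3 g \<omega> c y i j k l"
    and N_\<omega>: "\<And>y i j k l. y \<in> V \<Longrightarrow> cov3 N \<omega> c y i j k l = 0"
    and torsion_skew: "\<And>y i j k. y \<in> V \<Longrightarrow> torsion g N c y i j k = - torsion g N c y j i k"
      "\<And>y i j k. y \<in> V \<Longrightarrow> torsion g N c y i j k = - torsion g N c y i k j"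
begin

text \<open>The frame components of \<open>\<omega>\<close> are constant, so only the connection
  terms of the covariant derivative survive.\<close>

lemma inf_action_conn:
  assumes "x \<in> V"
  shows "inf_action (conn C x i) a b d = - eval3 (cov3 C \<omega> c x i) (e x a) (e x b) (e x d)"
proof -
  have "pd i (\<lambda>y. eval3 (\<omega> c y) (e y a) (e y b) (e y d)) x = pd i (\<lambda>y. phi a b d) x"
    by (rule pd_cong[OF open_V assms]) (rule phi)
  then show ?thesis
    using cov3_frame[where t = \<omega> and N = C and i = i and a = a and b = b and d = d, OF assms smooth_on_differentiable[OF smooth_\<omega> assms]]
    by (simp add: inf_action_def phi[OF assms])
qed

lemma inf_action_conn_N: "x \<in> V \<Longrightarrow> inf_action (conn N x i) a b d = 0"
  by (simp add: inf_action_conn N_\<omega> eval3_def)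

lemma inf_action_conn_D:
  assumes "x \<in> V"
  shows "(\<Sum>i\<in>UNIV. e x p $ i * inf_action (conn D x i) a b d) = - \<mu> x * psi p a b d"
proof -
  have "cov3 D \<omega> c x i = (\<lambda>j k l. \<mu> x * hodge3 g \<omega> c x i j k l)" for i
    by (simp add: fun_eq_iff D_\<omega>[OF assms])
  then show ?thesis
    using hodge3_frame[where g = g and c = c and x = x and e = "e x" and \<omega> = \<omega>, OF orthonormal[OF assms] det_pos[OF assms] phi[OF assms],
        of p a b d]
    unfolding inf_action_conn[OF assms] eval4_eval3
    by (simp add: eval3_scale_tensor sum_negf mult.left_commute[of _ "\<mu> x"] flip: sum_distrib_left[of "\<mu> x"])
qed

text \<open>Derivatives of the frame cancel in the difference, and \<open>D\<close> is torsion-free: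
  the torsion of \<open>N\<close> is the antisymmetrised difference.\<close>

lemma conn_difference_torsion:
  assumes "x \<in> V"
  shows "eval3 (torsion g N c x) (e x p) (e x a) (e x b) =
    (\<Sum>i\<in>UNIV. e x p $ i * (conn N x i a b - conn D x i a b))
    - (\<Sum>i\<in>UNIV. e x a $ i * (conn N x i p b - conn D x i p b))"
proof -
  define C where "C k i j = N c x k i j - D c x k i j" for k i j
  have C: "N c x k i j - N c x k j i = C k i j - C k j i" for i j k
    using D_symmetric[OF assms, of k i j] by (simp add: C_def)
  have 1: "conn N x i a b - conn D x i a b = (\<Sum>k\<in>UNIV. (\<Sum>j\<in>UNIV. C k i j * e x a $ j) * \<theta> x k b)" for i a
    unfolding conn_def C_def by (simp add: algebra_simps sum.distrib sum_subtractf)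
  have 2: "(\<Sum>i\<in>UNIV. e x p $ i * (conn N x i a b - conn D x i a b)) =
      (\<Sum>i\<in>UNIV. \<Sum>j\<in>UNIV. (\<Sum>k\<in>UNIV. C k i j * \<theta> x k b) * e x p $ i * e x a $ j)" for p a
  proof -
    have "(\<Sum>k\<in>UNIV. (\<Sum>j\<in>UNIV. C k i j * e x a $ j) * \<theta> x k b) = (\<Sum>j\<in>UNIV. (\<Sum>k\<in>UNIV. C k i j * \<theta> x k b) * e x a $ j)" for i
      unfolding sum_distrib_right by (subst sum.swap) (simp add: mult_ac)
    then show ?thesis
      unfolding 1 by (simp add: sum_distrib_left mult_ac)
  qed
  have "eval3 (torsion g N c x) (e x p) (e x a) (e x b) =
    (\<Sum>i\<in>UNIV. \<Sum>j\<in>UNIV. (\<Sum>k\<in>UNIV. (C k i j - C k j i) * \<theta> x k b) * e x p $ i * e x a $ j)"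
  proof -
    have "(\<Sum>k\<in>UNIV. (\<Sum>m\<in>UNIV. g c x m k * (C m i j - C m j i)) * e x b $ k) =
      (\<Sum>m\<in>UNIV. (C m i j - C m j i) * (\<Sum>k\<in>UNIV. g c x m k * e x b $ k))" for i j
      unfolding sum_distrib_left sum_distrib_right by (subst sum.swap) (simp add: mult_ac)
    then have "(\<Sum>k\<in>UNIV. torsion g N c x i j k * e x b $ k) = (\<Sum>m\<in>UNIV. (C m i j - C m j i) * \<theta> x m b)" for i j
      unfolding torsion_def C coframe_def .
    moreover have "(\<Sum>k\<in>UNIV. torsion g N c x i j k * e x p $ i * e x a $ j * e x b $ k) =
       (\<Sum>k\<in>UNIV. torsion g N c x i j k * e x b $ k) * e x p $ i * e x a $ j" for i j
      by (simp add: sum_distrib_left mult_ac)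
    ultimately have "(\<Sum>k\<in>UNIV. torsion g N c x i j k * e x p $ i * e x a $ j * e x b $ k) =
       (\<Sum>m\<in>UNIV. (C m i j - C m j i) * \<theta> x m b) * e x p $ i * e x a $ j" for i j
      by simp
    then show ?thesis
      unfolding eval3_def by simp
  qed
  also have "\<dots> = (\<Sum>i\<in>UNIV. \<Sum>j\<in>UNIV. (\<Sum>k\<in>UNIV. C k i j * \<theta> x k b) * e x p $ i * e x a $ j)
    - (\<Sum>i\<in>UNIV. \<Sum>j\<in>UNIV. (\<Sum>k\<in>UNIV. C k j i * \<theta> x k b) * e x p $ i * e x a $ j)"
    by (simp add: left_diff_distrib sum_subtractf)
  also have "(\<Sum>i\<in>UNIV. \<Sum>j\<in>UNIV. (\<Sum>k\<in>UNIV. C k j i * \<theta> x k b) * e x p $ i * e x a $ j) =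
     (\<Sum>i\<in>UNIV. \<Sum>j\<in>UNIV. (\<Sum>k\<in>UNIV. C k i j * \<theta> x k b) * e x a $ i * e x p $ j)"
    by (subst sum.swap) (simp add: mult_ac)
  finally show ?thesis unfolding 2 .
qed

lemma conn_difference:
  assumes "x \<in> V"
  shows "(\<Sum>i\<in>UNIV. e x p $ i * (conn N x i a b - conn D x i a b)) = \<mu> x / 3 * phi p a b"
proof -
  define C where "C p a b = (\<Sum>i\<in>UNIV. e x p $ i * (conn N x i a b - conn D x i a b))" for p a b
  define T where "T p a b = eval3 (torsion g N c x) (e x p) (e x a) (e x b)" for p a b
  have T: "T p a b = C p a b - C a p b" for p a b
    unfolding T_def C_def by (rule conn_difference_torsion[OF assms])
  have T_skew: "T a p b = - T p a b" "T p b a = - T p a b" for p a b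
    unfolding T_def by (rule eval3_skew; rule torsion_skew[OF assms])+
  have inf: "inf_action (C p) a b d = 3 * (\<mu> x / 3) * psi p a b d" for p a b d
  proof -
    have "inf_action (\<lambda>a b. conn N x i a b - 1 * conn D x i a b) a b d = - inf_action (conn D x i) a b d" for i
      unfolding inf_action_diff_scaled inf_action_conn_N[OF assms] by simp
    then have "inf_action (C p) a b d = - (\<Sum>i\<in>UNIV. e x p $ i * inf_action (conn D x i) a b d)"
      unfolding C_def inf_action_sum by (simp add: sum_negf)
    then show ?thesis
      unfolding inf_action_conn_D[OF assms] by simp
  qed
  \<comment> \<open>\<open>C p\<close> itself need not annihilate \<open>phi\<close>; the correction
    by \<open>phi p\<close> does, and as both it and \<open>phi p\<close> are skew, so is
    \<open>C p\<close>.\<close>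
  have "inf_action (\<lambda>a b. C p a b - \<mu> x / 3 * phi p a b) a b d = 0" for p a b d
    unfolding inf_action_diff_scaled inf inf_action_phi_3psi by simp
  from inf_action_eq_0_skew[OF this] have C_skew: "C p b a = - C p a b" for p a b
    using phi_swap(2)[of p b a] by (smt (verit) mult_minus_right)
  \<comment> \<open>A tensor skew in its last two indices is determined by its antisymmetrisation in
    the first two, as a metric connection is by its torsion.\<close>
  have C_T: "C p a b = T p a b / 2" for p a b
    using T[of p a b] T[of a b p] T[of b p a] T_skew(1)[of a p b] T_skew(2)[of a b p] T_skew(1)[of b p a]
      T_skew(2)[of p a b] C_skew[of p b a] C_skew[of a p b] C_skew[of b a p] C_skew[of a b p] C_skew[of p a b] C_skew[of b p a]
      T_skew(2)[of a p b] T_skew(1)[of b a p] T_skew(2)[of b p a]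
    by linarith
  have "C a p b = - C p a b" for p a b
    using C_T[of p a b] C_T[of a p b] T_skew(1)[of a p b] by linarith
  from skew_inf_action_psi[of C, OF this C_skew inf] show ?thesis
    unfolding C_def .
qed

text \<open>As \<open>phi 1 2 7 = 1\<close>, this equals \<open>\<mu> / 3\<close> on
  \<open>V\<close>; unlike \<open>\<mu>\<close>, it is visibly differentiable.\<close>

definition \<tau> :: "real^7 \<Rightarrow> real" where
  "\<tau> y = eval3 (torsion g N c y) (e y 1) (e y 2) (e y 7) / 2"

lemma torsion_frame:
  assumes "x \<in> V"
  shows "eval3 (torsion g N c x) (e x p) (e x a) (e x b) = 2 * (\<mu> x / 3) * phi p a b"
  using conn_difference[OF assms] phi_swap(1)[of a p b] unfolding conn_difference_torsion[OF assms] by simp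

lemma \<tau>_eq: "x \<in> V \<Longrightarrow> \<tau> x = \<mu> x / 3"
  unfolding \<tau>_def by (simp add: torsion_frame phi_values)

lemma torsion_eq:
  assumes "x \<in> V"
  shows "torsion g N c x i j k = 2 * \<tau> x * \<omega> c x i j k"
proof (rule eval3_eqI[OF orthonormal[OF assms]])
  fix a b d
  show "eval3 (torsion g N c x) (e x a) (e x b) (e x d) =
    eval3 (\<lambda>i j k. 2 * \<tau> x * \<omega> c x i j k) (e x a) (e x b) (e x d)"
    unfolding torsion_frame[OF assms] eval3_scale_tensor phi[OF assms] \<tau>_eq[OF assms] ..
qed

lemma conn_D_eq:
  assumes "x \<in> V"
  shows "conn D x i a b = conn N x i a b - \<tau> x * (\<Sum>m\<in>UNIV. \<theta> x i m * phi m a b)"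
proof -
  have "conn N x i a b - conn D x i a b = (\<Sum>j\<in>UNIV. (\<Sum>p\<in>UNIV. \<theta> x i p * e x p $ j) * (conn N x j a b - conn D x j a b))"
    by (simp add: coframe_frame[OF orthonormal[OF assms]] mult_delta_left)
  also have "\<dots> = (\<Sum>p\<in>UNIV. \<theta> x i p * (\<Sum>j\<in>UNIV. e x p $ j * (conn N x j a b - conn D x j a b)))"
    unfolding sum_distrib_left sum_distrib_right mult.assoc by (rule sum.swap)
  also have "\<dots> = \<tau> x * (\<Sum>m\<in>UNIV. \<theta> x i m * phi m a b)"
    unfolding conn_difference[OF assms] \<tau>_eq[OF assms] by (simp add: sum_distrib_left mult_ac)
  finally show ?thesis by simp
qed

lemma differentiable_\<tau>: "x \<in> V \<Longrightarrow> \<tau> differentiable (at x)"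
  unfolding \<tau>_def eval3_def torsion_def
  by (intro differentiable_divide differentiable_sum_fun differentiable_mult differentiable_diff differentiable_const
      differentiable_e smooth_on_differentiable[OF smooth_g] smooth_on_differentiable[OF smooth_N]) auto

section \<open>Curvature in the adapted frame\<close>

definition frame_curvature :: "real^7 \<Rightarrow> 7 \<Rightarrow> 7 \<Rightarrow> 7 \<Rightarrow> 7 \<Rightarrow> real" where
  "frame_curvature x p q a d = (\<Sum>l\<in>UNIV. eval3 (curvature D c x l) (e x p) (e x q) (e x a) * \<theta> x l d)"

lemma frame_curvature_skew: "frame_curvature x q p a d = - frame_curvature x p q a d"
proof -
  have "eval3 (curvature D c x l) (e x q) (e x p) (e x a) = - eval3 (curvature D c x l) (e x p) (e x q) (e x a)" for l
  proof -
    have "curvature D c x l j i k = - 1 * curvature D c x l i j k" for i j k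
      by (simp add: curvature_def)
    then have "(\<lambda>i j k. curvature D c x l j i k) = (\<lambda>i j k. - 1 * curvature D c x l i j k)"
      by blast
    then have "eval3 (curvature D c x l) (e x q) (e x p) (e x a) =
      eval3 (\<lambda>i j k. - 1 * curvature D c x l i j k) (e x p) (e x q) (e x a)"
      using eval3_flip(1)[of "curvature D c x l" "e x p" "e x q" "e x a"] by (simp only:)
    then show ?thesis
      unfolding eval3_scale_tensor by simp
  qed
  then show ?thesis
    unfolding frame_curvature_def by (simp add: sum_negf)
qed

lemma curvature_bianchi:
  assumes "x \<in> V"
  shows "curvature D c x l i j k + curvature D c x l j k i + curvature D c x l k i j = 0"
proof -
  have "pd i (\<lambda>y. D c y l j k) x = pd i (\<lambda>y. D c y l k j) x" for i j k
    by (rule pd_cong[OF open_V assms]) (rule D_symmetric)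
  from this[of i j k] this[of j k i] this[of k i j] show ?thesis
    unfolding curvature_def
    by (simp add: D_symmetric[OF assms, of _ j i] D_symmetric[OF assms, of _ k i] D_symmetric[OF assms, of _ k j])
qed

lemma frame_curvature_bianchi:
  assumes "x \<in> V"
  shows "frame_curvature x p q a d + frame_curvature x q a p d + frame_curvature x a p q d = 0"
proof -
  have "eval3 (curvature D c x l) (e x p) (e x q) (e x a) + eval3 (curvature D c x l) (e x q) (e x a) (e x p)
    + eval3 (curvature D c x l) (e x a) (e x p) (e x q) = 0" for l
  proof -
    have "eval3 (curvature D c x l) (e x p) (e x q) (e x a) + eval3 (curvature D c x l) (e x q) (e x a) (e x p)
      + eval3 (curvature D c x l) (e x a) (e x p) (e x q) =
      eval3 (\<lambda>i j k. curvature D c x l i j k + curvature D c x l j k i + curvature D c x l k i j) (e x p) (e x q) (e x a)"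
      unfolding eval3_add_tensor eval3_cyclic[of "curvature D c x l"]
        eval3_cyclic[of "\<lambda>i j k. curvature D c x l j k i"] ..
    then show ?thesis
      unfolding curvature_bianchi[OF assms] by (simp add: eval3_def)
  qed
  then show ?thesis
    unfolding frame_curvature_def sum.distrib[symmetric] distrib_right[symmetric] by simp
qed

lemma ricci_frame:
  assumes "x \<in> V"
  shows "eval2 (ricci D c x) (e x q) (e x a) = (\<Sum>p\<in>UNIV. frame_curvature x p q a p)"
proof -
  have "(\<Sum>p\<in>UNIV. frame_curvature x p q a p) =
    (\<Sum>l\<in>UNIV. \<Sum>p\<in>UNIV. \<theta> x l p * eval3 (curvature D c x l) (e x p) (e x q) (e x a))"
    unfolding frame_curvature_def by (subst sum.swap) (simp add: mult.commute)
  also have "\<dots> = (\<Sum>l\<in>UNIV. eval3 (curvature D c x l) (\<Sum>p\<in>UNIV. \<theta> x l p *\<^sub>R e x p) (e x q) (e x a))"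
    by (simp add: eval3_sum eval3_scaleR)
  also have "\<dots> = (\<Sum>l\<in>UNIV. \<Sum>j\<in>UNIV. \<Sum>k\<in>UNIV. curvature D c x l l j k * e x q $ j * e x a $ k)"
    unfolding sum_coframe_frame_scaleR[OF orthonormal[OF assms]] eval3_axis1 ..
  also have "\<dots> = eval2 (ricci D c x) (e x q) (e x a)"
    unfolding eval2_def ricci_def
    by (subst sum_rotate[symmetric]) (simp add: sum_distrib_right)
  finally show ?thesis ..
qed

abbreviation "P x i a b \<equiv> (\<Sum>m\<in>UNIV. \<theta> x i m * phi m a b)"

text \<open>The second structure equation for \<open>N\<close>, with coordinate directions
  \<open>i\<close>, \<open>j\<close> and frame values \<open>a\<close>, \<open>d\<close>.\<close>

definition N_curvature :: "real^7 \<Rightarrow> 7 \<Rightarrow> 7 \<Rightarrow> 7 \<Rightarrow> 7 \<Rightarrow> real" where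
  "N_curvature x i j a d = pd i (\<lambda>y. conn N y j a d) x - pd j (\<lambda>y. conn N y i a d) x
     + (\<Sum>b\<in>UNIV. conn N x j a b * conn N x i b d - conn N x i a b * conn N x j b d)"

text \<open>The derivative terms satisfy the differentiated linear constraint on
  \<open>conn N\<close>; the quadratic terms are a commutator.\<close>

lemma inf_action_N_curvature:
  assumes "x \<in> V"
  shows "inf_action (N_curvature x i j) a b d = 0"
proof -
  have "inf_action (\<lambda>a d. pd i (\<lambda>y. conn N y j a d) x) a b d = 0" for i j
  proof -
    have "pd i (\<lambda>y. inf_action (conn N y j) a b d) x = pd i (\<lambda>y. 0) x"
      by (rule pd_cong[OF open_V assms]) (rule inf_action_conn_N)
    then show ?thesis
      unfolding inf_action_def
      by (simp add: pd_sum pd_add pd_mult differentiable_sum_fun differentiable_conn[of N x, OF smooth_N assms])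
  qed
  then show ?thesis
    unfolding N_curvature_def inf_action_add inf_action_diff
    using inf_action_commutator[OF inf_action_conn_N[OF assms] inf_action_conn_N[OF assms]] by simp
qed

text \<open>The structure equation for \<open>D\<close> is evaluated on \<open>conn_D_eq\<close>:
  the product rule yields the derivatives of \<open>\<tau>\<close>, and the first structure equation
  removes those of the coframe.\<close>

lemma curvature_D_eq:
  assumes "x \<in> V"
  shows "(\<Sum>l\<in>UNIV. \<Sum>k\<in>UNIV. curvature D c x l i j k * e x a $ k * \<theta> x l d) =
    N_curvature x i j a d - (pd i \<tau> x * P x j a d - pd j \<tau> x * P x i a d)
    - 2 * (\<tau> x)\<^sup>2 * (\<Sum>p\<in>UNIV. \<Sum>q\<in>UNIV. \<theta> x i p * \<theta> x j q * (\<Sum>m\<in>UNIV. phi p q m * phi m a d))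
    + (\<tau> x)\<^sup>2 * (\<Sum>b\<in>UNIV. P x j a b * P x i b d - P x i a b * P x j b d)"
proof -
  have pd_conn: "pd i (\<lambda>y. conn D y j a d) x = pd i (\<lambda>y. conn N y j a d) x - pd i \<tau> x * P x j a d
    - \<tau> x * (\<Sum>m\<in>UNIV. pd i (\<lambda>y. \<theta> y j m) x * phi m a d)" for i j
  proof -
    have "pd i (\<lambda>y. conn D y j a d) x = pd i (\<lambda>y. conn N y j a d - \<tau> y * P y j a d) x"
      by (rule pd_cong[OF open_V assms]) (rule conn_D_eq)
    then show ?thesis
      by (simp add: pd_diff pd_mult pd_sum differentiable_sum_fun differentiable_conn[of N x, OF smooth_N assms]
          differentiable_\<tau>[OF assms] differentiable_coframe[OF assms])
  qed
  have d\<theta>: "pd i (\<lambda>y. \<theta> y j m) x - pd j (\<lambda>y. \<theta> y i m) x =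
    - (\<Sum>n\<in>UNIV. \<theta> x j n * conn D x i n m - \<theta> x i n * conn D x j n m)" for m
    using pd_coframe[OF assms, of i j m D] pd_coframe[OF assms, of j i m D] D_symmetric[OF assms, of _ i j]
    by (simp add: sum_subtractf)
  show ?thesis
    using skew_torsion_curvature_algebra[of "conn N x" "P x" "\<theta> x" "conn D x" "\<tau> x"
        "\<lambda>i j m. pd i (\<lambda>y. \<theta> y j m) x" i j a d,
        OF inf_action_conn_N[OF assms] refl conn_D_eq[OF assms] d\<theta>]
    unfolding curvature_frame[of D, OF smooth_D assms] pd_conn N_curvature_def
    by (simp add: algebra_simps sum_subtractf)
qed

lemma frame_curvature_eq:
  assumes "x \<in> V"
  defines "G \<equiv> \<lambda>p q a d. \<Sum>i\<in>UNIV. e x p $ i * (\<Sum>j\<in>UNIV. e x q $ j * N_curvature x i j a d)"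
    and "t \<equiv> \<lambda>p. \<Sum>i\<in>UNIV. e x p $ i * pd i \<tau> x"
  shows "frame_curvature x p q a d = G p q a d - (t p * phi q a d - t q * phi p a d)
      - 2 * (\<tau> x)\<^sup>2 * (\<Sum>m\<in>UNIV. phi p q m * phi m a d)
      + (\<tau> x)\<^sup>2 * (\<Sum>b\<in>UNIV. phi q a b * phi p b d - phi p a b * phi q b d)"
proof -
  \<comment> \<open>\<open>C\<close> inserts \<open>e x p\<close> and \<open>e x q\<close> for the
    two coordinate directions; it turns \<open>P\<close> into \<open>phi\<close>.\<close>
  define C where "C F = (\<Sum>i\<in>UNIV. e x p $ i * (\<Sum>j\<in>UNIV. e x q $ j * F i j))" for F :: "7 \<Rightarrow> 7 \<Rightarrow> real"
  have C_add: "C (\<lambda>i j. F i j + F' i j) = C F + C F'" and C_diff: "C (\<lambda>i j. F i j - F' i j) = C F - C F'"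
    and C_scale: "C (\<lambda>i j. r * F i j) = r * C F" for F F' r
    unfolding C_def by (simp_all add: algebra_simps sum.distrib sum_subtractf sum_distrib_left)
  have C_sum: "C (\<lambda>i j. \<Sum>b\<in>UNIV. F b i j) = (\<Sum>b\<in>UNIV. C (F b))" for F :: "7 \<Rightarrow> 7 \<Rightarrow> 7 \<Rightarrow> real"
    unfolding C_def sum_distrib_left by (rule sum_rotate)
  have C_prod: "C (\<lambda>i j. f i * h j) = (\<Sum>i\<in>UNIV. e x p $ i * f i) * (\<Sum>j\<in>UNIV. e x q $ j * h j)" for f h
    unfolding C_def sum_product by (simp add: sum_distrib_left mult_ac)
  have C_prod': "C (\<lambda>i j. f j * h i) = (\<Sum>i\<in>UNIV. e x p $ i * h i) * (\<Sum>j\<in>UNIV. e x q $ j * f j)" for f h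
    using C_prod[of h f] by (simp add: mult.commute)
  have P: "(\<Sum>i\<in>UNIV. e x p $ i * P x i a b) = phi p a b" for p a b
  proof -
    have "(\<Sum>i\<in>UNIV. e x p $ i * P x i a b) = (\<Sum>m\<in>UNIV. (\<Sum>i\<in>UNIV. e x p $ i * \<theta> x i m) * phi m a b)"
      unfolding sum_distrib_left sum_distrib_right mult.assoc by (rule sum.swap)
    then show ?thesis
      by (simp add: frame_coframe[OF orthonormal[OF assms(1)]] mult_delta_left)
  qed
  have "frame_curvature x p q a d = C (\<lambda>i j. \<Sum>l\<in>UNIV. \<Sum>k\<in>UNIV. curvature D c x l i j k * e x a $ k * \<theta> x l d)"
  proof -
    have "frame_curvature x p q a d = (\<Sum>l\<in>UNIV. \<Sum>i\<in>UNIV. \<Sum>j\<in>UNIV. \<Sum>k\<in>UNIV.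
      curvature D c x l i j k * e x p $ i * e x q $ j * e x a $ k * \<theta> x l d)"
      unfolding frame_curvature_def eval3_def by (simp add: sum_distrib_right)
    also have "\<dots> = (\<Sum>i\<in>UNIV. \<Sum>j\<in>UNIV. \<Sum>l\<in>UNIV. \<Sum>k\<in>UNIV.
      curvature D c x l i j k * e x p $ i * e x q $ j * e x a $ k * \<theta> x l d)"
      by (rule sum_rotate[symmetric])
    finally show ?thesis
      unfolding C_def by (simp add: sum_distrib_left mult_ac)
  qed
  also have "\<dots> = C (\<lambda>i j. N_curvature x i j a d) - (t p * phi q a d - t q * phi p a d)
      - 2 * (\<tau> x)\<^sup>2 * C (\<lambda>i j. \<Sum>p\<in>UNIV. \<Sum>q\<in>UNIV. \<theta> x i p * \<theta> x j q * (\<Sum>m\<in>UNIV. phi p q m * phi m a d))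
      + (\<tau> x)\<^sup>2 * (\<Sum>b\<in>UNIV. phi q a b * phi p b d - phi p a b * phi q b d)"
    unfolding curvature_D_eq[OF assms(1)] C_add C_diff C_scale C_sum
    unfolding C_prod C_prod' P t_def
    by (simp add: mult.commute)
  also have "C (\<lambda>i j. N_curvature x i j a d) = G p q a d"
    unfolding C_def G_def ..
  also have "C (\<lambda>i j. \<Sum>p\<in>UNIV. \<Sum>q\<in>UNIV. \<theta> x i p * \<theta> x j q * (\<Sum>m\<in>UNIV. phi p q m * phi m a d)) =
    (\<Sum>m\<in>UNIV. phi p q m * phi m a d)"
  proof -
    have "C (\<lambda>i j. \<theta> x i p' * \<theta> x j q' * Z) = (if p = p' then if q = q' then Z else 0 else 0)" for p' q' Z
      using C_scale[of Z "\<lambda>i j. \<theta> x i p' * \<theta> x j q'"]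
      by (simp add: C_prod frame_coframe[OF orthonormal[OF assms(1)]] mult.commute)
    then show ?thesis
      unfolding C_sum by (simp add: sum_delta_if)
  qed
  finally show ?thesis .
qed

lemma pd_\<tau>_and_ricci:
  assumes "x \<in> V"
  shows pd_\<tau>: "pd i \<tau> x = 0"
    and ricci_eq: "eval2 (ricci D c x) (e x q) (e x a) = (if q = a then 54 * (\<tau> x)\<^sup>2 else 0)"
proof -
  let ?G = "\<lambda>p q a d. \<Sum>i\<in>UNIV. e x p $ i * (\<Sum>j\<in>UNIV. e x q $ j * N_curvature x i j a d)"
  have G: "inf_action (?G p q) a b d = 0" for p q a b d
    unfolding inf_action_sum by (simp add: inf_action_N_curvature[OF assms])
  note algebra = curvature_algebra[OF frame_curvature_eq[OF assms] G frame_curvature_skew frame_curvature_bianchi[OF assms]]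
  have "pd i \<tau> x = (\<Sum>j\<in>UNIV. (\<Sum>p\<in>UNIV. \<theta> x i p * e x p $ j) * pd j \<tau> x)"
    by (simp add: coframe_frame[OF orthonormal[OF assms]] mult_delta_left)
  also have "\<dots> = (\<Sum>p\<in>UNIV. \<theta> x i p * (\<Sum>j\<in>UNIV. e x p $ j * pd j \<tau> x))"
    unfolding sum_distrib_left sum_distrib_right mult.assoc by (rule sum.swap)
  finally show "pd i \<tau> x = 0"
    using algebra(1) by simp
  show "eval2 (ricci D c x) (e x q) (e x a) = (if q = a then 54 * (\<tau> x)\<^sup>2 else 0)"
    unfolding ricci_frame[OF assms] by (rule algebra(2))
qed

end

section \<open>Exterior derivative, codifferential and the string equations\<close>

context nearly_parallel_frame
begin

text \<open>For a torsion-free connection \<open>d\<omega>\<close> is the alternating sum of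
  covariant derivatives. Skewness of \<open>hodge3\<close> makes the four terms equal.\<close>

lemma ext_deriv3_eq:
  assumes "x \<in> V" and skew: "\<And>y i j k. y \<in> V \<Longrightarrow> \<omega> c y i j k = - \<omega> c y j i k"
    "\<And>y i j k. y \<in> V \<Longrightarrow> \<omega> c y i j k = - \<omega> c y i k j"
  shows "ext_deriv3 \<omega> c x i j k l = 4 * \<mu> x * hodge3 g \<omega> c x i j k l"
proof -
  define S where "S a b p q = (\<Sum>m\<in>UNIV. D c x m a b * \<omega> c x m p q)" for a b p q
  have S_sym: "S b a p q = S a b p q" for a b p q
    unfolding S_def by (simp add: D_symmetric[OF assms(1), of _ b a])
  have cov: "cov3 D \<omega> c x i j k l = pd i (\<lambda>y. \<omega> c y j k l) x - S i j k l + S i k j l - S i l j k" for i j k l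
  proof -
    have "\<omega> c x j m l = - \<omega> c x m j l" "\<omega> c x j k m = \<omega> c x m j k" for m
      using skew(1)[OF assms(1), of j m l] skew(1)[OF assms(1), of j m k] skew(2)[OF assms(1), of j k m] by simp_all
    then show ?thesis
      unfolding cov3_def S_def by (simp add: sum_negf)
  qed
  have "ext_deriv3 \<omega> c x i j k l =
    cov3 D \<omega> c x i j k l - cov3 D \<omega> c x j i k l + cov3 D \<omega> c x k i j l - cov3 D \<omega> c x l i j k"
    unfolding ext_deriv3_def cov
    using S_sym[of i j k l] S_sym[of i k j l] S_sym[of i l j k] S_sym[of j k i l] S_sym[of j l i k] S_sym[of k l i j]
    by linarith
  also have "\<dots> = 4 * \<mu> x * hodge3 g \<omega> c x i j k l"
    using hodge3_skew(1)[of g \<omega> c x j i k l] hodge3_skew(2)[of g \<omega> c x i k j l] hodge3_skew(1)[of g \<omega> c x k i j l]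
      hodge3_skew(3)[of g \<omega> c x i j l k] hodge3_skew(2)[of g \<omega> c x i l j k] hodge3_skew(1)[of g \<omega> c x l i j k]
    unfolding D_\<omega>[OF assms(1)] by (simp add: algebra_simps)
  finally show ?thesis .
qed

text \<open>The squared norm of \<open>*\<omega>\<close> is \<open>7 * 24 / 24 = 7\<close>, so the
  product is \<open>28 * \<mu> x\<close>, where \<open>\<mu> x = 3 * \<tau> x\<close>.\<close>

lemma form_inner4_eq:
  assumes "x \<in> V" and skew: "\<And>y i j k. y \<in> V \<Longrightarrow> \<omega> c y i j k = - \<omega> c y j i k"
    "\<And>y i j k. y \<in> V \<Longrightarrow> \<omega> c y i j k = - \<omega> c y i k j"
  shows "form_inner4 g (ext_deriv3 \<omega>) (hodge3 g \<omega>) c x = 84 * \<tau> x"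
proof -
  let ?h = "hodge3 g \<omega> c x"
  have "form_inner4 g (ext_deriv3 \<omega>) (hodge3 g \<omega>) c x =
    (1 / 24) * (\<Sum>a\<in>UNIV. \<Sum>b\<in>UNIV. \<Sum>c'\<in>UNIV. \<Sum>d\<in>UNIV.
      eval4 (ext_deriv3 \<omega> c x) (e x a) (e x b) (e x c') (e x d) * eval4 ?h (e x a) (e x b) (e x c') (e x d))"
    unfolding form_inner4_def eval4_def
    using gram_contraction4[OF gram_ginv[of g c x "e x", OF orthonormal[OF assms(1)]], of "ext_deriv3 \<omega> c x" ?h]
    by (simp add: fact_numeral)
  also have "ext_deriv3 \<omega> c x = (\<lambda>i j k l. 4 * \<mu> x * ?h i j k l)"
    by (intro ext) (rule ext_deriv3_eq[OF assms])
  also have "(1 / 24) * (\<Sum>a\<in>UNIV. \<Sum>b\<in>UNIV. \<Sum>c'\<in>UNIV. \<Sum>d\<in>UNIV.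
      eval4 (\<lambda>i j k l. 4 * \<mu> x * ?h i j k l) (e x a) (e x b) (e x c') (e x d) * eval4 ?h (e x a) (e x b) (e x c') (e x d))
      = (1 / 24) * (4 * \<mu> x) * (\<Sum>a\<in>UNIV. \<Sum>b\<in>UNIV. \<Sum>c'\<in>UNIV. \<Sum>d\<in>UNIV. psi a b c' d * psi a b c' d)"
    unfolding eval4_scale
      hodge3_frame[where g = g and c = c and x = x and e = "e x" and \<omega> = \<omega>, OF orthonormal[OF assms(1)] det_pos[OF assms(1)] phi[OF assms(1)]]
    by (simp add: sum_distrib_left mult_ac)
  also have "\<dots> = 84 * \<tau> x"
    unfolding psi_psi_trace by (simp add: \<tau>_eq[OF assms(1)])
  finally show ?thesis .
qed

abbreviation "H \<equiv> \<lambda>c y i j k. 3 * torsion g N c y i j k"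

text \<open>Since the derivative of \<open>\<tau>\<close> vanishes, the covariant derivative of
  \<open>H\<close> is a multiple of \<open>hodge3\<close>; a skew tensor contracts to 0 with the
  symmetric inverse metric.\<close>

lemma codiff3_H:
  assumes "x \<in> V"
  shows "codiff3 g D H c x j k = 0"
proof -
  have "cov3 D H c x a b j k = 6 * \<tau> x * cov3 D \<omega> c x a b j k" for a b
  proof -
    have H: "H c y i j k = 6 * \<tau> y * \<omega> c y i j k" if "y \<in> V" for y i j k
      by (simp add: torsion_eq[OF that])
    have "pd a (\<lambda>y. H c y b j k) x = pd a (\<lambda>y. 6 * \<tau> y * \<omega> c y b j k) x"
      by (rule pd_cong[OF open_V assms]) (rule H)
    also have "\<dots> = 6 * \<tau> x * pd a (\<lambda>y. \<omega> c y b j k) x"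
      by (simp add: pd_mult pd_\<tau>[OF assms] differentiable_\<tau>[OF assms] smooth_on_differentiable[OF smooth_\<omega> assms])
    finally show ?thesis
      unfolding cov3_def H[OF assms] by (simp add: right_diff_distrib sum_distrib_left mult_ac)
  qed
  then have "codiff3 g D H c x j k =
      - (6 * \<tau> x * \<mu> x) * (\<Sum>a\<in>UNIV. \<Sum>b\<in>UNIV. ginv g c x a b * hodge3 g \<omega> c x a b j k)"
    unfolding codiff3_def D_\<omega>[OF assms] by (simp add: sum_distrib_left sum_negf mult_ac)
  moreover have "(\<Sum>a\<in>UNIV. \<Sum>b\<in>UNIV. ginv g c x a b * hodge3 g \<omega> c x a b j k) = 0"
  proof -
    let ?S = "\<Sum>a\<in>UNIV. \<Sum>b\<in>UNIV. ginv g c x a b * hodge3 g \<omega> c x a b j k"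
    have sym: "ginv g c x b a = ginv g c x a b" for a b
      unfolding ginv_frame[of g c x "e x", OF orthonormal[OF assms]] by (simp add: mult.commute)
    have "?S = (\<Sum>a\<in>UNIV. \<Sum>b\<in>UNIV. ginv g c x b a * hodge3 g \<omega> c x b a j k)"
      by (rule sum.swap)
    also have "\<dots> = - ?S"
      unfolding sum_negf[symmetric]
    proof (intro sum.cong refl)
      fix a b
      show "ginv g c x b a * hodge3 g \<omega> c x b a j k = - (ginv g c x a b * hodge3 g \<omega> c x a b j k)"
        using sym[of b a] hodge3_skew(1)[of g \<omega> c x b a j k] by simp
    qed
    finally show ?thesis by simp
  qed
  ultimately show ?thesis by simp
qed

text \<open>\<open>f\<close> need not be adapted, so it is expanded in \<open>e\<close>. Both terms
  are then multiples of the same matrix of products of the coefficients \<open>r\<close>.\<close>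

lemma string_equation:
  assumes "x \<in> V" and f: "orthonormal_frame (g c x) f"
  shows "eval2 (ricci D c x) (f i) (f j)
    - (1/4) * (\<Sum>m\<in>UNIV. \<Sum>n\<in>UNIV. eval3 (H c x) (f i) (f m) (f n) * eval3 (H c x) (f j) (f m) (f n)) = 0"
proof -
  define r where "r i a = (\<Sum>k\<in>UNIV. f i $ k * \<theta> x k a)" for i a
  have r: "f i = (\<Sum>a\<in>UNIV. r i a *\<^sub>R e x a)" for i
    unfolding r_def by (rule vector_frame_expansion[OF orthonormal[OF assms(1)], symmetric])
  have "eval2 (ricci D c x) (f i) (f j) = (\<Sum>a\<in>UNIV. \<Sum>b\<in>UNIV. r i a * r j b * (if a = b then 54 * (\<tau> x)\<^sup>2 else 0))"
    unfolding r eval2_expand ricci_eq[OF assms(1)] ..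
  then have ric: "eval2 (ricci D c x) (f i) (f j) = 54 * (\<tau> x)\<^sup>2 * (\<Sum>a\<in>UNIV. r i a * r j a)"
    unfolding sum_distrib_left by (simp add: mult_delta_right mult_ac)
  have *: "(\<Sum>p\<in>UNIV. \<Sum>q\<in>UNIV. (\<Sum>k\<in>UNIV. \<omega> c x k p q * u $ k) * v $ p * w $ q) = eval3 (\<omega> c x) u v w" for u v w
    unfolding eval3_def sum_distrib_right by (rule sum_rotate)
  \<comment> \<open>Both sides are the contraction with the inverse metric, which is the Gram matrix
    of either frame.\<close>
  have "(\<Sum>m\<in>UNIV. \<Sum>n\<in>UNIV. eval3 (\<omega> c x) (f i) (f m) (f n) * eval3 (\<omega> c x) (f j) (f m) (f n)) =
    (\<Sum>m\<in>UNIV. \<Sum>n\<in>UNIV. eval3 (\<omega> c x) (f i) (e x m) (e x n) * eval3 (\<omega> c x) (f j) (e x m) (e x n))"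
    using gram_contraction2[OF gram_ginv[of g c x f, OF f], of "\<lambda>p q. \<Sum>k\<in>UNIV. \<omega> c x k p q * f i $ k" "\<lambda>p q. \<Sum>k\<in>UNIV. \<omega> c x k p q * f j $ k"]
      gram_contraction2[OF gram_ginv[of g c x "e x", OF orthonormal[OF assms(1)]], of "\<lambda>p q. \<Sum>k\<in>UNIV. \<omega> c x k p q * f i $ k" "\<lambda>p q. \<Sum>k\<in>UNIV. \<omega> c x k p q * f j $ k"]
    unfolding * by simp
  also have "\<dots> = (\<Sum>m\<in>UNIV. \<Sum>n\<in>UNIV. (\<Sum>a\<in>UNIV. r i a * phi a m n) * (\<Sum>b\<in>UNIV. r j b * phi b m n))"
  proof -
    have "eval3 (\<omega> c x) (f i) (e x m) (e x n) = (\<Sum>a\<in>UNIV. r i a * phi a m n)" for i m n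
      unfolding r eval3_sum eval3_scaleR phi[OF assms(1)] ..
    then show ?thesis by simp
  qed
  also have "\<dots> = (\<Sum>a\<in>UNIV. \<Sum>b\<in>UNIV. r i a * r j b * (\<Sum>m\<in>UNIV. \<Sum>n\<in>UNIV. phi a m n * phi b m n))"
  proof -
    have "(\<Sum>m\<in>UNIV. \<Sum>n\<in>UNIV. (\<Sum>a\<in>UNIV. r i a * phi a m n) * (\<Sum>b\<in>UNIV. r j b * phi b m n)) =
      (\<Sum>m\<in>UNIV. \<Sum>n\<in>UNIV. \<Sum>a\<in>UNIV. \<Sum>b\<in>UNIV. r i a * r j b * (phi a m n * phi b m n))"
      unfolding sum_product by (simp add: mult_ac)
    also have "\<dots> = (\<Sum>a\<in>UNIV. \<Sum>m\<in>UNIV. \<Sum>n\<in>UNIV. \<Sum>b\<in>UNIV. r i a * r j b * (phi a m n * phi b m n))"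
      by (rule sum_rotate)
    also have "\<dots> = (\<Sum>a\<in>UNIV. \<Sum>b\<in>UNIV. \<Sum>m\<in>UNIV. \<Sum>n\<in>UNIV. r i a * r j b * (phi a m n * phi b m n))"
      by (rule sum.cong[OF refl]) (rule sum_rotate)
    finally show ?thesis
      by (simp add: sum_distrib_left)
  qed
  also have "\<dots> = 6 * (\<Sum>a\<in>UNIV. r i a * r j a)"
    unfolding phi_phi_trace sum_distrib_left by (simp add: mult_delta_right mult_ac)
  finally have \<omega>: "(\<Sum>m\<in>UNIV. \<Sum>n\<in>UNIV. eval3 (\<omega> c x) (f i) (f m) (f n) * eval3 (\<omega> c x) (f j) (f m) (f n)) =
    6 * (\<Sum>a\<in>UNIV. r i a * r j a)" .
  have "eval3 (H c x) u v w = 6 * \<tau> x * eval3 (\<omega> c x) u v w" for u v w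
    using eval3_scale_tensor[of "6 * \<tau> x" "\<omega> c x"] by (simp add: torsion_eq[OF assms(1)] mult.assoc)
  then have "(\<Sum>m\<in>UNIV. \<Sum>n\<in>UNIV. eval3 (H c x) (f i) (f m) (f n) * eval3 (H c x) (f j) (f m) (f n)) =
    (6 * \<tau> x)\<^sup>2 * (\<Sum>m\<in>UNIV. \<Sum>n\<in>UNIV. eval3 (\<omega> c x) (f i) (f m) (f n) * eval3 (\<omega> c x) (f j) (f m) (f n))"
    by (simp add: sum_distrib_left power2_eq_square mult_ac)
  then show ?thesis
    unfolding \<omega> ric by (simp add: power2_eq_square)
qed

end

section \<open>From adapted frames near each point to the manifold\<close>

theorem corollary4p10:
  fixes A :: "('m::{t2_space,second_countable_topology}, 7) chart set"
    and g :: "('m, 7) field2" and \<omega> T D N :: "('m, 7) field3"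
  assumes "oriented_smooth_atlas A" and "riemannian_metric A g" and "levi_civita A g D"
    and "G2_structure A g \<omega>" and "nearly_parallel A g D \<omega>"
    and "affine_connection A N" and "preserves3 A N \<omega>"
    and "T = torsion g N" and "totally_skew A T"
  shows "(\<forall>c\<in>A. \<forall>x\<in>cimg c. \<forall>i j k.
            T c x i j k = (1/42) * form_inner4 g (ext_deriv3 \<omega>) (hodge3 g \<omega>) c x * \<omega> c x i j k) \<and>
         string_equations A g D (\<lambda>c x i j k. 3 * T c x i j k)"
proof -
  obtain lam :: "'m \<Rightarrow> real" where lam: "\<And>c x X j k l. c \<in> A \<Longrightarrow> x \<in> cimg c \<Longrightarrow>
     (\<Sum>i\<in>UNIV. X$i * cov3 D \<omega> c x i j k l) =
       - (lam (cinv c x) / 4) * (\<Sum>i\<in>UNIV. X$i * hodge3 g \<omega> c x i j k l)"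
    using assms(5) unfolding nearly_parallel_def by blast
  have frame: "\<exists>V e. x0 \<in> V \<and> nearly_parallel_frame g c V e \<omega> D N (\<lambda>y. - (lam (cinv c y) / 4)) \<and>
      (\<forall>y\<in>V. \<forall>i j k. \<omega> c y i j k = - \<omega> c y j i k \<and> \<omega> c y i j k = - \<omega> c y i k j)"
    if c: "c \<in> A" and x0: "x0 \<in> cimg c" for c x0
  proof -
    from assms(4)[unfolded G2_structure_def, THEN conjunct2, THEN bspec, OF c, THEN bspec, OF x0]
    obtain V e where V: "open V" "x0 \<in> V" "V \<subseteq> cimg c" and e: "\<And>a. smooth_on (\<lambda>x. e x a) V"
      "\<And>x. x \<in> V \<Longrightarrow> orthonormal_frame (g c x) (e x)" "\<And>x. x \<in> V \<Longrightarrow> det (\<chi> a i. e x a $ i) > 0"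
      "\<And>x i j k. x \<in> V \<Longrightarrow> eval3 (\<omega> c x) (e x i) (e x j) (e x k) = G2_form (axis i 1) (axis j 1) (axis k 1)"
      by (elim exE conjE) (rule that, auto)
    have in_cimg: "y \<in> cimg c" if "y \<in> V" for y
      using V(3) that by blast
    have "smooth_on (\<lambda>x. g c x i j) (cimg c)" "smooth_on (\<lambda>x. \<omega> c x i j k) (cimg c)"
      "smooth_on (\<lambda>x. D c x i j k) (cimg c)" "smooth_on (\<lambda>x. N c x i j k) (cimg c)" for i j k
      using assms(2,3,4,6) c
      by (simp_all add: riemannian_metric_def tensor_field2_def levi_civita_def affine_connection_def
        G2_structure_def three_form_def tensor_field3_def)
    note smooth = this[THEN smooth_on_subset, OF V(3)]
    have "nearly_parallel_frame g c V e \<omega> D N (\<lambda>y. - (lam (cinv c y) / 4))"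
    proof (unfold_locales, goal_cases)
      case (6 y i j k)
      then show ?case by (simp add: e(4) phi_def)
    next
      case (10 y i j k)
      then show ?case using assms(3) c in_cimg unfolding levi_civita_def by blast
    next
      \<comment> \<open>The choice \<open>X = axis i 1\<close> isolates one direction of
        differentiation.\<close>
      case (11 y i j k l)
      then show ?case
        using lam[OF c in_cimg, of y "axis i 1" j k l] by (simp add: axis_def mult_delta_left)
    next
      case (12 y i j k l)
      then show ?case using assms(7) c in_cimg unfolding preserves3_def by blast
    next
      case (13 y i j k)
      then show ?case using assms(8,9) c in_cimg unfolding totally_skew_def by blast
    next
      case (14 y i j k)
      then show ?case using assms(8,9) c in_cimg unfolding totally_skew_def by blast
    qed (use V e smooth in auto)
    moreover have "\<forall>y\<in>V. \<forall>i j k. \<omega> c y i j k = - \<omega> c y j i k \<and> \<omega> c y i j k = - \<omega> c y i k j"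
      using assms(4) c in_cimg unfolding G2_structure_def three_form_def totally_skew_def by blast
    ultimately show ?thesis using V(2) by blast
  qed
  have "T c x i j k = (1/42) * form_inner4 g (ext_deriv3 \<omega>) (hodge3 g \<omega>) c x * \<omega> c x i j k"
    and "orthonormal_frame (g c x) f \<Longrightarrow> eval2 (ricci D c x) (f i) (f j)
        - (1/4) * (\<Sum>m\<in>UNIV. \<Sum>n\<in>UNIV. eval3 (\<lambda>i j k. 3 * T c x i j k) (f i) (f m) (f n) *
            eval3 (\<lambda>i j k. 3 * T c x i j k) (f j) (f m) (f n)) = 0"
    and "codiff3 g D (\<lambda>c x i j k. 3 * T c x i j k) c x j k = 0"
    if cx: "c \<in> A" "x \<in> cimg c" for c x f i j k
  proof -
    obtain V e where "x \<in> V" and loc: "nearly_parallel_frame g c V e \<omega> D N (\<lambda>y. - (lam (cinv c y) / 4))"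
      and skew: "\<And>y i j k. y \<in> V \<Longrightarrow> \<omega> c y i j k = - \<omega> c y j i k" "\<And>y i j k. y \<in> V \<Longrightarrow> \<omega> c y i j k = - \<omega> c y i k j"
      using frame[OF cx] by blast
    interpret nearly_parallel_frame g c V e \<omega> D N "\<lambda>y. - (lam (cinv c y) / 4)"
      by (rule loc)
    show "T c x i j k = (1/42) * form_inner4 g (ext_deriv3 \<omega>) (hodge3 g \<omega>) c x * \<omega> c x i j k"
    proof -
      have "form_inner4 g (ext_deriv3 \<omega>) (hodge3 g \<omega>) c x = 84 * \<tau> x"
        by (rule form_inner4_eq[OF \<open>x \<in> V\<close>]) (fact skew)+
      \<comment> \<open>\<open>84 / 42 = 2\<close> is the factor in
        \<open>torsion_eq\<close>.\<close>
      then show ?thesis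
        using torsion_eq[OF \<open>x \<in> V\<close>, of i j k] assms(8) by simp
    qed
    show "eval2 (ricci D c x) (f i) (f j)
        - (1/4) * (\<Sum>m\<in>UNIV. \<Sum>n\<in>UNIV. eval3 (\<lambda>i j k. 3 * T c x i j k) (f i) (f m) (f n) *
            eval3 (\<lambda>i j k. 3 * T c x i j k) (f j) (f m) (f n)) = 0" if "orthonormal_frame (g c x) f"
      using string_equation[OF \<open>x \<in> V\<close> that] unfolding assms(8) .
    show "codiff3 g D (\<lambda>c x i j k. 3 * T c x i j k) c x j k = 0"
      using codiff3_H[OF \<open>x \<in> V\<close>] unfolding assms(8) .
  qed
  then show ?thesis
    unfolding string_equations_def by blast
qed

end
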